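(* The soft torus $C(\mathbb T^2)_\epsilon$ is very flexibly Hilbert–Schmidt stable and very flexibly operator norm stable.
   Context: For $\epsilon\ge0$ the soft torus is the universal (unital) C*-algebra $$C(\mathbb T^2)_{\epsilon} = C^*\langle u, v\;|\; u \text{ and } v \text{ are unitaries and } \|[u, v]\| \le \epsilon\rangle .$$ Let $\omega$ be any non-trivial ultrafilter on $\mathbb N$, $\|\cdot\|_2$ the normalized Hilbert–Schmidt norm on matrices, and $\prod_{\omega} (M_{k_n}, \|\cdot\|_2) = \prod M_{k_n} / \{(T_n)\;|\; \lim_{n\to\omega}\|T_n\|_2 = 0\}$. A C*-algebra $A$ is very flexibly Hilbert–Schmidt stable if for any $\ast$-homomorphism $f: A \to \prod_{\omega} (M_{k_n}, \|\cdot\|_2)$ there is a $\ast$-homomorphism $g: A \to \prod_{\omega} (M_{m_n}, \|\cdot\|_2)$ (for some sequence $(m_n)$) such that $f\oplus g$ (viewed as a map into $\prod_\omega (M_{k_n+m_n},\|\cdot\|_2)$ block-diagonally) lifts to a $\ast$-homomorphism $A\to \prod M_{k_n+m_n}$. It is very flexibly operator norm stable if for any $\ast$-homomorphism $f: A \to \prod M_{k_n}/\bigoplus M_{k_n}$ there is a $\ast$-homomorphism $g: A \to \prod M_{m_n}/\bigoplus M_{m_n}$ such that $f\oplus g$ lifts to a $\ast$-homomorphism $A\to\prod M_{k_n+m_n}$. Here $\prod$ denotes bounded sequences and $\bigoplus$ sequences tending to $0$ in operator norm. *)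

theory Defs
  imports "Jordan_Normal_Form.Schur_Decomposition" "HOL-Algebra.QuotRing"
begin

section \<open>Unital C*-algebras\<close>

record 'a star_algebra = "'a ring" +
  cscale :: "complex \<Rightarrow> 'a \<Rightarrow> 'a"
  star :: "'a \<Rightarrow> 'a"
  cnorm :: "'a \<Rightarrow> real"

text \<open>The zero algebra is admitted.\<close>

locale cstar_algebra = ring A for A :: "'a star_algebra" (structure) +
  assumes scale_closed: "x \<in> carrier A \<Longrightarrow> cscale A c x \<in> carrier A"
    and scale_add_right: "\<lbrakk>x \<in> carrier A; y \<in> carrier A\<rbrakk> \<Longrightarrow>
          cscale A c (x \<oplus> y) = cscale A c x \<oplus> cscale A c y"
    and scale_add_left: "x \<in> carrier A \<Longrightarrow> cscale A (c + d) x = cscale A c x \<oplus> cscale A d x"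
    and scale_scale: "x \<in> carrier A \<Longrightarrow> cscale A c (cscale A d x) = cscale A (c * d) x"
    and scale_one: "x \<in> carrier A \<Longrightarrow> cscale A 1 x = x"
    and scale_mult_left: "\<lbrakk>x \<in> carrier A; y \<in> carrier A\<rbrakk> \<Longrightarrow>
          cscale A c x \<otimes> y = cscale A c (x \<otimes> y)"
    and scale_mult_right: "\<lbrakk>x \<in> carrier A; y \<in> carrier A\<rbrakk> \<Longrightarrow>
          x \<otimes> cscale A c y = cscale A c (x \<otimes> y)"
    and star_closed: "x \<in> carrier A \<Longrightarrow> star A x \<in> carrier A"
    and star_star: "x \<in> carrier A \<Longrightarrow> star A (star A x) = x"
    and star_add: "\<lbrakk>x \<in> carrier A; y \<in> carrier A\<rbrakk> \<Longrightarrow> star A (x \<oplus> y) = star A x \<oplus> star A y"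
    and star_scale: "x \<in> carrier A \<Longrightarrow> star A (cscale A c x) = cscale A (cnj c) (star A x)"
    and star_mult: "\<lbrakk>x \<in> carrier A; y \<in> carrier A\<rbrakk> \<Longrightarrow> star A (x \<otimes> y) = star A y \<otimes> star A x"
    and norm_eq_zero: "x \<in> carrier A \<Longrightarrow> cnorm A x = 0 \<longleftrightarrow> x = \<zero>"
    and norm_triangle: "\<lbrakk>x \<in> carrier A; y \<in> carrier A\<rbrakk> \<Longrightarrow>
          cnorm A (x \<oplus> y) \<le> cnorm A x + cnorm A y"
    and norm_scale: "x \<in> carrier A \<Longrightarrow> cnorm A (cscale A c x) = cmod c * cnorm A x"
    and norm_mult: "\<lbrakk>x \<in> carrier A; y \<in> carrier A\<rbrakk> \<Longrightarrow> cnorm A (x \<otimes> y) \<le> cnorm A x * cnorm A y"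
    and cstar_identity: "x \<in> carrier A \<Longrightarrow> cnorm A (star A x \<otimes> x) = (cnorm A x)\<^sup>2"
    and complete: "\<lbrakk>\<And>n::nat. X n \<in> carrier A;
          \<And>e. e > 0 \<Longrightarrow> \<exists>N. \<forall>m\<ge>N. \<forall>n\<ge>N. cnorm A (X m \<ominus> X n) < e\<rbrakk> \<Longrightarrow>
          \<exists>L\<in>carrier A. (\<lambda>n. cnorm A (X n \<ominus> L)) \<longlonglongrightarrow> 0"

text \<open>Homomorphisms are not required to preserve the unit.\<close>

definition star_hom :: "'a star_algebra \<Rightarrow> 'b star_algebra \<Rightarrow> ('a \<Rightarrow> 'b) set" where
  "star_hom A B = {h. (\<forall>x\<in>carrier A. h x \<in> carrier B) \<and>
     (\<forall>x\<in>carrier A. \<forall>y\<in>carrier A. h (x \<oplus>\<^bsub>A\<^esub> y) = h x \<oplus>\<^bsub>B\<^esub> h y) \<and>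
     (\<forall>x\<in>carrier A. \<forall>y\<in>carrier A. h (x \<otimes>\<^bsub>A\<^esub> y) = h x \<otimes>\<^bsub>B\<^esub> h y) \<and>
     (\<forall>c. \<forall>x\<in>carrier A. h (cscale A c x) = cscale B c (h x)) \<and>
     (\<forall>x\<in>carrier A. h (star A x) = star B (h x))}"

definition cstar_subalgebra :: "'a star_algebra \<Rightarrow> 'a set \<Rightarrow> bool" where
  "cstar_subalgebra A S \<longleftrightarrow> S \<subseteq> carrier A \<and> \<one>\<^bsub>A\<^esub> \<in> S \<and>
     (\<forall>x\<in>S. \<forall>y\<in>S. x \<oplus>\<^bsub>A\<^esub> y \<in> S \<and> x \<otimes>\<^bsub>A\<^esub> y \<in> S) \<and>
     (\<forall>x\<in>S. star A x \<in> S \<and> (\<forall>c. cscale A c x \<in> S)) \<and>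
     (\<forall>X L. (\<forall>n::nat. X n \<in> S) \<and> L \<in> carrier A \<and>
        (\<lambda>n. cnorm A (X n \<ominus>\<^bsub>A\<^esub> L)) \<longlonglongrightarrow> 0 \<longrightarrow> L \<in> S)"

definition cstar_generated :: "'a star_algebra \<Rightarrow> 'a set \<Rightarrow> 'a set" where
  "cstar_generated A G = \<Inter>{S. cstar_subalgebra A S \<and> G \<subseteq> S}"

definition unitary_elem :: "'a star_algebra \<Rightarrow> 'a \<Rightarrow> bool" where
  "unitary_elem A u \<longleftrightarrow> u \<in> carrier A \<and>
     star A u \<otimes>\<^bsub>A\<^esub> u = \<one>\<^bsub>A\<^esub> \<and> u \<otimes>\<^bsub>A\<^esub> star A u = \<one>\<^bsub>A\<^esub>"


section \<open>The soft torus\<close>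

definition soft_pair :: "real \<Rightarrow> 'a star_algebra \<Rightarrow> 'a \<Rightarrow> 'a \<Rightarrow> bool" where
  "soft_pair \<epsilon> A u v \<longleftrightarrow> unitary_elem A u \<and> unitary_elem A v \<and>
     cnorm A (u \<otimes>\<^bsub>A\<^esub> v \<ominus>\<^bsub>A\<^esub> v \<otimes>\<^bsub>A\<^esub> u) \<le> \<epsilon>"

text \<open>
  HOL cannot quantify over all C*-algebras inside a definition, since their elements may
  live in any type. It suffices to let \<open>B\<close> range over the C*-algebras
  carried by one type with at least continuum many elements: only the C*-subalgebra of \<open>B\<close>
  generated by the two unitaries matters, it has at most continuum many elements, and so an
  isomorphic copy of it lives in that type. The type of sequences of matrices, used below for
  products of matrix algebras, is large enough. The homomorphism out of \<open>A\<close> is unique on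
  the carrier because \<open>u\<close> and \<open>v\<close> generate \<open>A\<close>.
\<close>

definition is_soft_torus :: "real \<Rightarrow> 'a star_algebra \<Rightarrow> 'a \<Rightarrow> 'a \<Rightarrow> bool" where
  "is_soft_torus \<epsilon> A u v \<longleftrightarrow>
     cstar_algebra A \<and> soft_pair \<epsilon> A u v \<and> cstar_generated A {u, v} = carrier A \<and>
     (\<forall>(B :: (nat \<Rightarrow> complex mat) star_algebra) u' v'.
        cstar_algebra B \<and> soft_pair \<epsilon> B u' v' \<longrightarrow>
        (\<exists>h\<in>star_hom A B. h \<one>\<^bsub>A\<^esub> = \<one>\<^bsub>B\<^esub> \<and> h u = u' \<and> h v = v'))"


section \<open>Products and quotients\<close>

definition bounded_prod :: "('i \<Rightarrow> 'a star_algebra) \<Rightarrow> ('i \<Rightarrow> 'a) star_algebra" where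
  "bounded_prod B = \<lparr>
     carrier = {x. (\<forall>i. x i \<in> carrier (B i)) \<and> bdd_above (range (\<lambda>i. cnorm (B i) (x i)))},
     monoid.mult = (\<lambda>x y i. x i \<otimes>\<^bsub>B i\<^esub> y i),
     one = (\<lambda>i. \<one>\<^bsub>B i\<^esub>),
     zero = (\<lambda>i. \<zero>\<^bsub>B i\<^esub>),
     add = (\<lambda>x y i. x i \<oplus>\<^bsub>B i\<^esub> y i),
     cscale = (\<lambda>c x i. cscale (B i) c (x i)),
     star = (\<lambda>x i. star (B i) (x i)),
     cnorm = (\<lambda>x. SUP i. cnorm (B i) (x i))\<rparr>"

text \<open>The additional operations on cosets follow the pattern of \<^const>\<open>rcoset_mult\<close>.\<close>

definition star_quot :: "'a star_algebra \<Rightarrow> 'a set \<Rightarrow> 'a set star_algebra" where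
  "star_quot R I = \<lparr>
     carrier = carrier (R Quot I),
     monoid.mult = monoid.mult (R Quot I),
     one = one (R Quot I),
     zero = zero (R Quot I),
     add = add (R Quot I),
     cscale = (\<lambda>c X. \<Union>x\<in>X. I +>\<^bsub>R\<^esub> cscale R c x),
     star = (\<lambda>X. \<Union>x\<in>X. I +>\<^bsub>R\<^esub> star R x),
     cnorm = (\<lambda>X. INF x\<in>X. cnorm R x)\<rparr>"


section \<open>Matrix algebras\<close>

definition vec_norm2 :: "complex vec \<Rightarrow> real" where
  "vec_norm2 x = sqrt (\<Sum>i<dim_vec x. (cmod (x $ i))\<^sup>2)"

definition mat_op_norm :: "complex mat \<Rightarrow> real" where
  "mat_op_norm T = (SUP x\<in>{x \<in> carrier_vec (dim_col T). vec_norm2 x \<le> 1}. vec_norm2 (T *\<^sub>v x))"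

definition hs_norm :: "complex mat \<Rightarrow> real" where
  "hs_norm T = sqrt ((\<Sum>i<dim_row T. \<Sum>j<dim_col T. (cmod (T $$ (i, j)))\<^sup>2) / dim_row T)"

definition mat_algebra :: "nat \<Rightarrow> complex mat star_algebra" where
  "mat_algebra n = \<lparr>
     carrier = carrier_mat n n,
     monoid.mult = (*),
     one = 1\<^sub>m n,
     zero = 0\<^sub>m n n,
     add = (+),
     cscale = (\<cdot>\<^sub>m),
     star = mat_adjoint,
     cnorm = mat_op_norm\<rparr>"

definition mat_prod :: "(nat \<Rightarrow> nat) \<Rightarrow> (nat \<Rightarrow> complex mat) star_algebra" where
  "mat_prod k = bounded_prod (\<lambda>n. mat_algebra (k n))"

definition op_null :: "(nat \<Rightarrow> nat) \<Rightarrow> (nat \<Rightarrow> complex mat) set" where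
  "op_null k = {T \<in> carrier (mat_prod k). (\<lambda>n. mat_op_norm (T n)) \<longlonglongrightarrow> 0}"

definition hs_null :: "nat filter \<Rightarrow> (nat \<Rightarrow> nat) \<Rightarrow> (nat \<Rightarrow> complex mat) set" where
  "hs_null \<omega> k = {T \<in> carrier (mat_prod k). ((\<lambda>n. hs_norm (T n)) \<longlongrightarrow> 0) \<omega>}"

definition seq_dsum :: "(nat \<Rightarrow> complex mat) \<Rightarrow> (nat \<Rightarrow> complex mat) \<Rightarrow> nat \<Rightarrow> complex mat" where
  "seq_dsum x y n = four_block_mat
     (x n) (0\<^sub>m (dim_row (x n)) (dim_col (y n)))
     (0\<^sub>m (dim_row (y n)) (dim_col (x n))) (y n)"

text \<open>Block sum of two cosets, as a coset of the ideal \<open>I\<close> of \<open>R\<close>; again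
  as in \<^const>\<open>rcoset_mult\<close>.\<close>

definition coset_dsum :: "(nat \<Rightarrow> complex mat) star_algebra \<Rightarrow> (nat \<Rightarrow> complex mat) set \<Rightarrow>
    (nat \<Rightarrow> complex mat) set \<Rightarrow> (nat \<Rightarrow> complex mat) set \<Rightarrow> (nat \<Rightarrow> complex mat) set" where
  "coset_dsum R I X Y = (\<Union>x\<in>X. \<Union>y\<in>Y. I +>\<^bsub>R\<^esub> seq_dsum x y)"


section \<open>Very flexible stability\<close>

definition nontrivial_ultrafilter :: "nat filter \<Rightarrow> bool" where
  "nontrivial_ultrafilter \<omega> \<longleftrightarrow> \<omega> \<noteq> bot \<and>
     (\<forall>P. eventually P \<omega> \<or> eventually (\<lambda>n. \<not> P n) \<omega>) \<and> (\<forall>n. \<omega> \<noteq> principal {n})"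

text \<open>\<open>N k\<close> is the ideal of null sequences in \<open>mat_prod k\<close>. All matrix sizes are positive, since the
  normalized Hilbert-Schmidt norm is meaningless for \<open>n = 0\<close>; \<open>g\<close> may be zero.\<close>

definition very_flexibly_stable ::
    "((nat \<Rightarrow> nat) \<Rightarrow> (nat \<Rightarrow> complex mat) set) \<Rightarrow> 'a star_algebra \<Rightarrow> bool" where
  "very_flexibly_stable N A \<longleftrightarrow>
     (\<forall>k. (\<forall>n. k n > 0) \<longrightarrow>
        (\<forall>f\<in>star_hom A (star_quot (mat_prod k) (N k)).
           \<exists>m. (\<forall>n. m n > 0) \<and>
             (\<exists>g\<in>star_hom A (star_quot (mat_prod m) (N m)).
              \<exists>F\<in>star_hom A (mat_prod (\<lambda>n. k n + m n)).
                \<forall>a\<in>carrier A.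
                  N (\<lambda>n. k n + m n) +>\<^bsub>mat_prod (\<lambda>n. k n + m n)\<^esub> F a =
                  coset_dsum (mat_prod (\<lambda>n. k n + m n)) (N (\<lambda>n. k n + m n)) (f a) (g a))))"

definition very_flexibly_HS_stable :: "nat filter \<Rightarrow> 'a star_algebra \<Rightarrow> bool" where
  "very_flexibly_HS_stable \<omega> A \<longleftrightarrow> very_flexibly_stable (hs_null \<omega>) A"

definition very_flexibly_op_stable :: "'a star_algebra \<Rightarrow> bool" where
  "very_flexibly_op_stable A \<longleftrightarrow> very_flexibly_stable op_null A"

end

theory Submission
  imports Defs "HOL-Analysis.Convex" "HOL-Library.Function_Algebras"
    "HOL-Computational_Algebra.Fundamental_Theorem_Algebra"
begin

text \<open>
  Lift the images of \<open>u\<close> and \<open>v\<close> to sequences of unitaries \<open>U\<close>, \<open>V\<close>; their commutator is bounded by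
  \<open>\<epsilon>\<close> only modulo null sequences. By functional calculus one finds successively unitaries
  \<open>W\<^sub>0, W\<^sub>1, \<dots>\<close> close to \<open>U, V U V\<^sup>*, V\<^sup>2 U V\<^sup>-\<^sup>2, \<dots>\<close> whose consecutive distances are at most \<open>\<epsilon>\<close>
  exactly. The block diagonal \<open>U'\<close> of \<open>W\<^sub>0, \<dots>, W\<^sub>N\<^sub>-\<^sub>1, W\<^sub>N\<^sub>-\<^sub>1, \<dots>, W\<^sub>0\<close> and the cyclic block shift
  \<open>V'\<close> then satisfy \<open>\<parallel>[U', V']\<parallel> \<le> \<epsilon>\<close>, so they define a representation of the soft torus, and the isometry
  \<open>x \<mapsto> N\<^sup>-\<^sup>1\<^sup>/\<^sup>2 (x, V x, \<dots>, V\<^sup>N\<^sup>-\<^sup>1 x, 0, \<dots>, 0)\<close> intertwines \<open>(U, V)\<close> with \<open>(U', V')\<close> up to a null sequence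
  and an error of order \<open>N\<^sup>-\<^sup>1\<^sup>/\<^sup>2\<close>. Letting \<open>N\<close> grow slowly, the given homomorphism becomes a corner
  of a genuine one up to null sequences, and \<open>g\<close> is the complementary corner.

  Matrices of all sizes are embedded into one ring of finitely supported infinite matrices, in
  which \<open>uid n\<close> is the unit of the corner of \<open>n\<close> by \<open>n\<close> matrices.
\<close>

section \<open>Finitely supported matrices\<close>

text \<open>Both notions of stability are instances of one statement about a norm
  \<open>\<nu>\<close> as in \<open>ideal_norm\<close>, a weight \<open>w\<close> and a filter
  \<open>G\<close>. The obstacle is that Hilbert-Schmidt null sequences say nothing about operator
  norms, so lifts of \<open>u\<close> and \<open>v\<close> may violate the commutator bound badly.
  Every inequality \<open>cnorm A a < c\<close> is therefore first turned into an equation with a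
  positive complement, which homomorphisms preserve up to null sequences (\<open>dominated\<close>),
  and every use of functional calculus comes with a bound on the square of \<open>\<nu>\<close> that
  is linear in the defect.

  The palindrome is needed because \<open>V\<^sup>N U V\<^sup>-\<^sup>N\<close> need not be near
  \<open>U\<close>: a plain cycle through \<open>W\<^sub>0, ..., W\<^sub>N\<^sub>-\<^sub>1\<close>
  would break the bound where it closes. Walking back along the same unitaries closes it, and the
  second half does no harm since the isometry vanishes there. Homomorphisms need not be unital; what
  is lifted to unitaries is \<open>f u + 1 - f 1\<close> and \<open>f v + 1 - f 1\<close>, and the
  corner \<open>1 - f 1\<close> is cut off again by a projection.\<close>

typedef fmat = "{f :: nat \<Rightarrow> nat \<Rightarrow> complex. \<exists>n. \<forall>i j. f i j \<noteq> 0 \<longrightarrow> i < n \<and> j < n}"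
  morphisms ent Fmat
  by (rule exI[of _ "\<lambda>_ _. 0"]) auto

setup_lifting type_definition_fmat

lemma fmat_eqI: "(\<And>i j. ent A i j = ent B i j) \<Longrightarrow> A = B"
  by (metis ent_inject ext)

definition corner :: "nat \<Rightarrow> fmat \<Rightarrow> bool" where
  "corner n A \<longleftrightarrow> (\<forall>i j. ent A i j \<noteq> 0 \<longrightarrow> i < n \<and> j < n)"

lemma corner_zero: "corner n A \<Longrightarrow> \<not> i < n \<or> \<not> j < n \<Longrightarrow> ent A i j = 0"
  unfolding corner_def by blast

lemma corner_mono: "corner n A \<Longrightarrow> n \<le> m \<Longrightarrow> corner m A"
  unfolding corner_def by (meson less_le_trans)

lemma corner_ex: "\<exists>n. corner n A"
  using ent[of A] unfolding corner_def by simp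

text \<open>Products and inner products take no size argument, so the range of summation has to be
  read off a factor. Its exact value is immaterial: \<open>ent_times\<close> and
  \<open>inner_fmat_eq\<close> allow any size that holds one of the factors.\<close>

definition size_bound :: "fmat \<Rightarrow> nat" where
  "size_bound A = (LEAST n. corner n A)"

lemma corner_size_bound: "corner (size_bound A) A"
  unfolding size_bound_def by (rule LeastI_ex[OF corner_ex])

lemma size_bound_le: "corner n A \<Longrightarrow> size_bound A \<le> n"
  unfolding size_bound_def by (rule Least_le)

lemma corner_common: obtains n where "corner n A" "corner n B" "corner n C"
proof -
  obtain a b c where "corner a A" "corner b B" "corner c C"
    using corner_ex by blast
  then have "corner (max a (max b c)) A" "corner (max a (max b c)) B" "corner (max a (max b c)) C"
    by (auto intro: corner_mono)
  then show thesis by (rule that)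
qed

lemma ent_Fmat: "(\<And>i j. f i j \<noteq> 0 \<Longrightarrow> i < n \<and> j < n) \<Longrightarrow> ent (Fmat f) = f"
  by (rule Fmat_inverse) auto

lemma sum_extend_zero:
  fixes f :: "nat \<Rightarrow> 'b::comm_monoid_add"
  assumes "m \<le> n" "\<And>l. m \<le> l \<Longrightarrow> f l = 0"
  shows "(\<Sum>l<m. f l) = (\<Sum>l<n. f l)"
  by (rule sum.mono_neutral_left) (use assms in auto)

section \<open>The non-unital ring of finitely supported matrices\<close>

instantiation fmat :: ring
begin

lift_definition zero_fmat :: fmat is "\<lambda>_ _. 0" by simp
lift_definition plus_fmat :: "fmat \<Rightarrow> fmat \<Rightarrow> fmat" is "\<lambda>f g i j. f i j + g i j"
proof -
  fix f g :: "nat \<Rightarrow> nat \<Rightarrow> complex"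
  assume "\<exists>n. \<forall>i j. f i j \<noteq> 0 \<longrightarrow> i < n \<and> j < n" "\<exists>n. \<forall>i j. g i j \<noteq> 0 \<longrightarrow> i < n \<and> j < n"
  then obtain m n where "\<forall>i j. f i j \<noteq> 0 \<longrightarrow> i < n \<and> j < n" "\<forall>i j. g i j \<noteq> 0 \<longrightarrow> i < m \<and> j < m" by blast
  then show "\<exists>n. \<forall>i j. f i j + g i j \<noteq> 0 \<longrightarrow> i < n \<and> j < n"
    by (intro exI[of _ "max m n"]) (auto simp: less_max_iff_disj, (metis add_0)+)
qed
lift_definition uminus_fmat :: "fmat \<Rightarrow> fmat" is "\<lambda>f i j. - f i j" by simp
definition minus_fmat :: "fmat \<Rightarrow> fmat \<Rightarrow> fmat" where "A - B = A + - (B::fmat)"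
definition times_fmat :: "fmat \<Rightarrow> fmat \<Rightarrow> fmat" where
  "A * B = Fmat (\<lambda>i j. \<Sum>l<size_bound A. ent A i l * ent B l j)"

lemma ent_zero: "ent 0 i j = 0" by transfer simp
lemma ent_plus: "ent (A + B) i j = ent A i j + ent B i j" by transfer simp
lemma ent_uminus: "ent (- A) i j = - ent A i j" by transfer simp
lemma ent_minus: "ent (A - B) i j = ent A i j - ent B i j"
  by (simp add: minus_fmat_def ent_plus ent_uminus)

lemma ent_times0: "ent (A * B) i j = (\<Sum>l<size_bound A. ent A i l * ent B l j)"
proof -
  obtain n where n: "corner n A" "corner n B" by (rule corner_common)
  have "ent (A * B) = (\<lambda>i j. \<Sum>l<size_bound A. ent A i l * ent B l j)"
    unfolding times_fmat_def
  proof (rule ent_Fmat[of _ n])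
    fix i j assume "(\<Sum>l<size_bound A. ent A i l * ent B l j) \<noteq> 0"
    then obtain l where "ent A i l * ent B l j \<noteq> 0" by (meson sum.neutral)
    then show "i < n \<and> j < n" using n unfolding corner_def by auto
  qed
  then show ?thesis by simp
qed

lemma ent_times: "corner n A \<or> corner n B \<Longrightarrow> ent (A * B) i j = (\<Sum>l<n. ent A i l * ent B l j)"
proof (elim disjE)
  assume "corner n A"
  then show ?thesis unfolding ent_times0
    by (intro sum_extend_zero size_bound_le) (auto simp: corner_zero[OF corner_size_bound])
next
  assume B: "corner n B"
  let ?m = "max n (size_bound A)"
  have "(\<Sum>l<n. ent A i l * ent B l j) = (\<Sum>l<?m. ent A i l * ent B l j)"
    by (rule sum_extend_zero) (auto simp: corner_zero[OF B])
  moreover have "(\<Sum>l<size_bound A. ent A i l * ent B l j) = (\<Sum>l<?m. ent A i l * ent B l j)"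
    by (rule sum_extend_zero) (auto simp: corner_zero[OF corner_size_bound])
  ultimately show ?thesis unfolding ent_times0 by simp
qed

lemma cornerI: "(\<And>i j. \<not> (i < n \<and> j < n) \<Longrightarrow> ent A i j = 0) \<Longrightarrow> corner n A"
  unfolding corner_def by blast

lemma corner_times: "corner n A \<Longrightarrow> corner n B \<Longrightarrow> corner n (A * B)"
  by (rule cornerI) (auto simp: ent_times0 corner_zero)

lemma corner_plus: "corner n A \<Longrightarrow> corner n B \<Longrightarrow> corner n (A + B)"
  by (rule cornerI) (auto simp: ent_plus corner_zero)

instance
proof
  fix A B C :: fmat
  obtain n where n: "corner n A" "corner n B" "corner n C" by (rule corner_common)
  show "A + B + C = A + (B + C)" "A + B = B + A" "0 + A = A" "- A + A = 0" "A - B = A + - B"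
    by (auto intro!: fmat_eqI simp: ent_plus ent_uminus ent_zero ent_minus)
  show "A * B * C = A * (B * C)"
    by (rule fmat_eqI)
       (simp only: ent_times[of n] n corner_times sum_distrib_left sum_distrib_right mult.assoc simp_thms, rule sum.swap)
  have w: "corner n (A + B)" by (rule corner_plus[OF n(1,2)])
  show "(A + B) * C = A * C + B * C"
    by (rule fmat_eqI) (simp add: ent_plus ent_times[of n] n sum.distrib distrib_right w)
  show "A * (B + C) = A * B + A * C"
    by (rule fmat_eqI) (simp add: ent_plus ent_times[of n] n sum.distrib distrib_left)
qed
end

lemma ent_sum: "ent (\<Sum>x\<in>S. f x) i j = (\<Sum>x\<in>S. ent (f x) i j)"
  by (induction S rule: infinite_finite_induct) (auto simp: ent_plus ent_zero)

lift_definition adj :: "fmat \<Rightarrow> fmat" is "\<lambda>f i j. cnj (f j i)"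
  by auto
lift_definition cs :: "complex \<Rightarrow> fmat \<Rightarrow> fmat" is "\<lambda>c f i j. c * f i j"
  by auto

lemma ent_adj: "ent (adj A) i j = cnj (ent A j i)" by transfer simp
lemma ent_cs: "ent (cs c A) i j = c * ent A i j" by transfer simp

instantiation fmat :: real_inner
begin
definition scaleR_fmat :: "real \<Rightarrow> fmat \<Rightarrow> fmat" where "scaleR r A = cs (of_real r) A"
text \<open>The real part of the trace of \<open>adj A * B\<close>, since the type class wants a
  real inner product. Thus \<open>norm\<close> is the Frobenius norm, while the operator norm is
  \<open>opn\<close>.\<close>

definition inner_fmat :: "fmat \<Rightarrow> fmat \<Rightarrow> real" where
  "inner A B = (\<Sum>i<size_bound A. \<Sum>j<size_bound A. Re (cnj (ent A i j) * ent B i j))"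
definition norm_fmat :: "fmat \<Rightarrow> real" where "norm_fmat A = sqrt (inner A A)"
definition sgn_fmat :: "fmat \<Rightarrow> fmat" where "sgn_fmat A = scaleR (inverse (norm A)) A"
definition dist_fmat :: "fmat \<Rightarrow> fmat \<Rightarrow> real" where "dist_fmat A B = norm (A - B)"
definition uniformity_fmat :: "(fmat \<times> fmat) filter" where
  "uniformity_fmat = (INF e\<in>{0 <..}. principal {(x, y). dist x y < e})"
definition open_fmat :: "fmat set \<Rightarrow> bool" where
  "open_fmat S \<longleftrightarrow> (\<forall>x\<in>S. \<forall>\<^sub>F (x', y) in uniformity. x' = x \<longrightarrow> y \<in> S)"

lemma ent_scaleR: "ent (scaleR r A) i j = of_real r * ent A i j"
  by (simp add: scaleR_fmat_def ent_cs)

lemma inner_fmat_eq: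
  assumes "corner n A \<or> corner n B"
  shows "inner A B = (\<Sum>i<n. \<Sum>j<n. Re (cnj (ent A i j) * ent B i j))"
proof -
  let ?f = "\<lambda>i j. Re (cnj (ent A i j) * ent B i j)"
  have *: "(\<Sum>i<k. \<Sum>j<k. ?f i j) = (\<Sum>i<l. \<Sum>j<l. ?f i j)" if "k \<le> l" "corner k A \<or> corner k B" for k l
  proof -
    have z: "?f i j = 0" if "k \<le> i \<or> k \<le> j" for i j
      using that \<open>corner k A \<or> corner k B\<close> by (auto simp: corner_zero[of k _ i j])
    have "(\<Sum>i<k. \<Sum>j<k. ?f i j) = (\<Sum>i<k. \<Sum>j<l. ?f i j)"
      by (intro sum.cong refl sum_extend_zero that z) auto
    also have "\<dots> = (\<Sum>i<l. \<Sum>j<l. ?f i j)"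
      by (intro sum_extend_zero that sum.neutral ballI z) auto
    finally show ?thesis .
  qed
  let ?m = "max n (size_bound A)"
  show ?thesis unfolding inner_fmat_def
    using *[of n ?m] *[of "size_bound A" ?m] assms corner_size_bound[of A] by simp
qed

instance
proof
  fix A B C :: fmat and r s :: real
  obtain n where n: "corner n A" "corner n B" "corner n C" by (rule corner_common)
  show "scaleR r (A + B) = scaleR r A + scaleR r B" "scaleR (r + s) A = scaleR r A + scaleR s A"
    "scaleR r (scaleR s A) = scaleR (r * s) A" "scaleR 1 A = A"
    by (rule fmat_eqI, simp add: ent_scaleR ent_plus algebra_simps)+
  show "dist A B = norm (A - B)" by (rule dist_fmat_def)
  show "sgn A = scaleR (inverse (norm A)) A" by (rule sgn_fmat_def)
  show "(uniformity :: (fmat \<times> fmat) filter) = (INF e\<in>{0<..}. principal {(x, y). dist x y < e})"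
    by (rule uniformity_fmat_def)
  show "open U = (\<forall>x\<in>U. \<forall>\<^sub>F (x', y) in uniformity. x' = x \<longrightarrow> y \<in> U)" for U :: "fmat set"
    by (rule open_fmat_def)
  show "inner A B = inner B A"
    by (simp only: inner_fmat_eq[of n] n simp_thms) (simp add: mult.commute)
  show "inner (A + B) C = inner A C + inner B C"
    by (simp only: inner_fmat_eq[of n] n simp_thms ent_plus sum.distrib[symmetric])
      (simp add: ring_distribs algebra_simps)
  show "inner (scaleR r A) B = r * inner A B"
    by (simp only: inner_fmat_eq[of n] n simp_thms ent_scaleR sum_distrib_left)
      (simp add: algebra_simps)
  have sq: "Re (cnj (ent A i j) * ent A i j) = (cmod (ent A i j))\<^sup>2" for i j
    by (simp add: cmod_power2) (simp add: power2_eq_square)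
  show "0 \<le> inner A A"
    unfolding inner_fmat_def sq by (intro sum_nonneg) auto
  show "(inner A A = 0) = (A = 0)"
  proof
    assume "inner A A = 0"
    then have "\<forall>i<n. \<forall>j<n. ent A i j = 0"
      unfolding inner_fmat_eq[OF disjI1, OF n(1)] sq
      by (subst (asm) sum_nonneg_eq_0_iff, simp, simp add: sum_nonneg,
          subst (asm) sum_nonneg_eq_0_iff, auto)
    then show "A = 0" using n(1) unfolding corner_def by (intro fmat_eqI) (metis ent_zero)
  qed (simp add: inner_fmat_def ent_zero)
  show "norm A = sqrt (inner A A)" by (rule norm_fmat_def)
qed
end

section \<open>Adjoint and norms\<close>

lemma adj_adj [simp]: "adj (adj A) = A"
  by (rule fmat_eqI) (simp add: ent_adj)
lemma adj_zero [simp]: "adj 0 = 0"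
  by (rule fmat_eqI) (simp add: ent_adj ent_zero)
lemma adj_plus: "adj (A + B) = adj A + adj B"
  by (rule fmat_eqI) (simp add: ent_adj ent_plus)
lemma adj_minus: "adj (A - B) = adj A - adj B"
  by (rule fmat_eqI) (simp add: ent_adj ent_minus)
lemma adj_cs: "adj (cs c A) = cs (cnj c) (adj A)"
  by (rule fmat_eqI) (simp add: ent_adj ent_cs)
lemma adj_sum: "adj (\<Sum>x\<in>S. f x) = (\<Sum>x\<in>S. adj (f x))"
  by (induction S rule: infinite_finite_induct) (auto simp: adj_plus)
lemma corner_adj [simp]: "corner n (adj A) \<longleftrightarrow> corner n A"
  unfolding corner_def ent_adj by auto
lemma adj_times: "adj (A * B) = adj B * adj A"
proof -
  obtain n where n: "corner n A" "corner n B" by (rule corner_common)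
  show ?thesis
    by (rule fmat_eqI) (simp add: ent_adj ent_times[of n] n mult.commute)
qed
lemmas adj_simps = adj_plus adj_minus adj_times adj_cs

lemma cs_add: "cs c (A + B) = cs c A + cs c B"
  by (rule fmat_eqI) (simp add: ent_cs ent_plus algebra_simps)
lemma cs_diff: "cs c (A - B) = cs c A - cs c B"
  by (rule fmat_eqI) (simp add: ent_cs ent_minus algebra_simps)
lemma cs_add_left: "cs (c + d) A = cs c A + cs d A"
  by (rule fmat_eqI) (simp add: ent_cs ent_plus algebra_simps)
lemma cs_diff_left: "cs (c - d) A = cs c A - cs d A"
  by (rule fmat_eqI) (simp add: ent_cs ent_minus algebra_simps)
lemma cs_cs [simp]: "cs c (cs d A) = cs (c * d) A"
  by (rule fmat_eqI) (simp add: ent_cs)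
lemma cs_one [simp]: "cs 1 A = A"
  by (rule fmat_eqI) (simp add: ent_cs)
lemma cs_zero [simp]: "cs c 0 = 0" "cs 0 A = 0"
  by (auto intro!: fmat_eqI simp add: ent_cs ent_zero)
lemma corner_cs: "corner n A \<Longrightarrow> corner n (cs c A)"
  unfolding corner_def ent_cs by auto
lemma corner_zero_mat [simp]: "corner n 0"
  unfolding corner_def ent_zero by auto
lemma corner_minus: "corner n A \<Longrightarrow> corner n B \<Longrightarrow> corner n (A - B)"
  by (rule cornerI) (auto simp: ent_minus corner_zero)
lemma corner_sum: "(\<And>x. x \<in> S \<Longrightarrow> corner n (f x)) \<Longrightarrow> corner n (\<Sum>x\<in>S. f x)"
  by (induction S rule: infinite_finite_induct) (auto intro: corner_plus)
lemma cs_times_left [simp]: "cs c A * B = cs c (A * B)"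
proof -
  obtain n where n: "corner n A" "corner n B" by (rule corner_common)
  show ?thesis
    by (rule fmat_eqI) (simp add: ent_cs ent_times[of n] n sum_distrib_left mult.assoc)
qed
lemma cs_times_right [simp]: "A * cs c B = cs c (A * B)"
  by (metis adj_adj adj_cs adj_times cs_times_left complex_cnj_cnj)
lemma scaleR_cs: "scaleR r A = cs (of_real r) A"
  by (rule scaleR_fmat_def)

lemma norm_sq_fmat: "(norm A)\<^sup>2 = inner A (A::fmat)"
  by (simp add: power2_norm_eq_inner)

lemma norm_sq_ent:
  assumes "corner n A"
  shows "(norm A)\<^sup>2 = (\<Sum>i<n. \<Sum>j<n. (cmod (ent A i j))\<^sup>2)"
proof -
  have sq: "Re (cnj (ent A i j) * ent A i j) = (cmod (ent A i j))\<^sup>2" for i j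
    by (simp add: cmod_power2) (simp add: power2_eq_square)
  show ?thesis
    unfolding norm_sq_fmat inner_fmat_eq[OF disjI1[OF assms]] sq ..
qed

lemma cmod_ent_le: "cmod (ent A i j) \<le> norm A"
proof (cases "ent A i j = 0")
  case False
  obtain n where n: "corner n A" using corner_ex by blast
  with False have ij: "i < n" "j < n" unfolding corner_def by auto
  have "(cmod (ent A i j))\<^sup>2 \<le> (\<Sum>j<n. (cmod (ent A i j))\<^sup>2)"
    using ij member_le_sum[of j "{..<n}" "\<lambda>j. (cmod (ent A i j))\<^sup>2"] by simp
  also have "\<dots> \<le> (\<Sum>i<n. \<Sum>j<n. (cmod (ent A i j))\<^sup>2)"
    using ij member_le_sum[of i "{..<n}" "\<lambda>i. \<Sum>j<n. (cmod (ent A i j))\<^sup>2"] by (simp add: sum_nonneg)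
  finally show ?thesis unfolding norm_sq_ent[OF n, symmetric] by (rule power2_le_imp_le) simp
qed simp

lemma inner_adj: "inner (adj A) (adj B) = inner A B"
proof -
  obtain n where n: "corner n A" "corner n B" by (rule corner_common)
  show ?thesis
    by (simp only: inner_fmat_eq[of n] n corner_adj simp_thms ent_adj) (subst sum.swap, simp add: mult.commute)
qed

lemma norm_adj [simp]: "norm (adj A) = norm A"
  by (simp add: norm_eq_sqrt_inner inner_adj)

lemma norm_cs: "norm (cs c A) = cmod c * norm A"
proof -
  obtain n where n: "corner n A" using corner_ex by blast
  have "(norm (cs c A))\<^sup>2 = (cmod c * norm A)\<^sup>2"
    by (simp add: norm_sq_ent[OF corner_cs[OF n]] norm_sq_ent[OF n] power_mult_distrib ent_cs norm_mult sum_distrib_left)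
  then show ?thesis by simp
qed

text \<open>With this, whole matrices stand for vectors: ring elements act on them from the left and
  \<open>adj\<close> is the adjoint of that action, which is all that the quadratic form arguments
  use.\<close>

lemma inner_times_left: "inner (A * B) C = inner B (adj A * C)"
proof -
  obtain n where n: "corner n A" "corner n B" "corner n C" by (rule corner_common)
  have 1: "inner (A * B) C = (\<Sum>i<n. \<Sum>j<n. \<Sum>l<n. Re (cnj (ent A i l * ent B l j) * ent C i j))"
    by (simp only: inner_fmat_eq[of n] n corner_times simp_thms ent_times[of n] cnj_sum sum_distrib_right Re_sum)
  have 2: "inner B (adj A * C) = (\<Sum>l<n. \<Sum>j<n. \<Sum>i<n. Re (cnj (ent B l j) * (cnj (ent A i l) * ent C i j)))"
    by (simp only: inner_fmat_eq[of n] n corner_times corner_adj simp_thms ent_times[of n] ent_adj sum_distrib_left Re_sum)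
  have "inner (A * B) C = (\<Sum>i<n. \<Sum>l<n. \<Sum>j<n. Re (cnj (ent A i l * ent B l j) * ent C i j))"
    unfolding 1 by (intro sum.cong refl sum.swap)
  also have "\<dots> = (\<Sum>l<n. \<Sum>i<n. \<Sum>j<n. Re (cnj (ent A i l * ent B l j) * ent C i j))"
    by (rule sum.swap)
  also have "\<dots> = (\<Sum>l<n. \<Sum>j<n. \<Sum>i<n. Re (cnj (ent A i l * ent B l j) * ent C i j))"
    by (intro sum.cong refl sum.swap)
  finally show ?thesis unfolding 2 by (simp only: complex_cnj_mult mult_ac)
qed

lemma norm_times_le: "norm (A * B :: fmat) \<le> norm A * norm B"
proof -
  obtain n where n: "corner n A" "corner n B" by (rule corner_common)
  have e: "(cmod (ent (A * B) i j))\<^sup>2 \<le> (\<Sum>l<n. (cmod (ent A i l))\<^sup>2) * (\<Sum>l<n. (cmod (ent B l j))\<^sup>2)" for i j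
  proof -
    have "cmod (ent (A * B) i j) \<le> (\<Sum>l<n. cmod (ent A i l) * cmod (ent B l j))"
      unfolding ent_times[OF disjI1, OF n(1)] by (rule order_trans[OF norm_sum]) (simp add: norm_mult)
    then have "(cmod (ent (A * B) i j))\<^sup>2 \<le> (\<Sum>l<n. cmod (ent A i l) * cmod (ent B l j))\<^sup>2"
      by (rule power_mono) simp
    also have "\<dots> \<le> (\<Sum>l<n. (cmod (ent A i l))\<^sup>2) * (\<Sum>l<n. (cmod (ent B l j))\<^sup>2)"
      by (rule Cauchy_Schwarz_ineq_sum)
    finally show ?thesis .
  qed
  have "(norm (A * B))\<^sup>2 = (\<Sum>i<n. \<Sum>j<n. (cmod (ent (A * B) i j))\<^sup>2)"
    by (rule norm_sq_ent[OF corner_times[OF n]])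
  also have "\<dots> \<le> (\<Sum>i<n. \<Sum>j<n. (\<Sum>l<n. (cmod (ent A i l))\<^sup>2) * (\<Sum>l<n. (cmod (ent B l j))\<^sup>2))"
    by (intro sum_mono e)
  also have "\<dots> = (norm A)\<^sup>2 * (norm B)\<^sup>2"
    unfolding norm_sq_ent[OF n(1)] norm_sq_ent[OF n(2)]
    by (subst sum.swap[of _ _ "{..<n}", where g = "\<lambda>i j. (cmod (ent B i j))\<^sup>2"]) (simp add: sum_product)
  finally have "(norm (A * B))\<^sup>2 \<le> (norm A * norm B)\<^sup>2" by (simp add: power_mult_distrib)
  then show ?thesis by (rule power2_le_imp_le) simp
qed

text \<open>The norm of \<open>A\<close> acting on matrices from the left. The action is columnwise
  and squared Frobenius norms add up over columns, so this is the usual operator norm on vectors;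
  \<open>mat_op_norm_emb\<close> proves it.\<close>

definition opn :: "fmat \<Rightarrow> real" where
  "opn A = Sup {norm (A * X) | X. norm X \<le> 1}"

lemma opn_bdd: "bdd_above {norm ((A::fmat) * X) | X. norm X \<le> 1}"
proof (rule bdd_aboveI)
  fix r assume "r \<in> {norm (A * X) | X. norm X \<le> 1}"
  then obtain X where X: "r = norm (A * X)" "norm X \<le> 1" by auto
  have "norm (A * X) \<le> norm A * norm X" by (rule norm_times_le)
  also have "\<dots> \<le> norm A * 1" using X by (intro mult_left_mono) auto
  finally show "r \<le> norm A" using X by simp
qed

lemma opn_upper: "norm X \<le> 1 \<Longrightarrow> norm (A * X) \<le> opn A"
  unfolding opn_def by (rule cSup_upper[OF _ opn_bdd]) auto

lemma opn_nonneg [simp]: "0 \<le> opn A"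
  using opn_upper[of 0 A] by simp

lemma norm_le_opn: "norm (A * X) \<le> opn A * norm X"
proof (cases "X = 0")
  case False
  have "A * X = scaleR (norm X) (A * scaleR (inverse (norm X)) X)"
    using False by (simp add: scaleR_cs flip: of_real_mult)
  then have "norm (A * X) = norm X * norm (A * scaleR (inverse (norm X)) X)"
    by (metis abs_norm_cancel norm_scaleR)
  also have "\<dots> \<le> norm X * opn A"
    using False by (intro mult_left_mono opn_upper) auto
  finally show ?thesis by (simp add: mult.commute)
qed simp

lemma opn_least: "0 \<le> c \<Longrightarrow> (\<And>X. norm (A * X) \<le> c * norm X) \<Longrightarrow> opn A \<le> c"
proof -
  assume c: "0 \<le> c" and *: "\<And>X. norm (A * X) \<le> c * norm X"
  show ?thesis unfolding opn_def
  proof (rule cSup_least)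
    show "{norm (A * X) | X. norm X \<le> 1} \<noteq> {}" by (auto intro!: exI[of _ 0])
    fix r assume "r \<in> {norm (A * X) | X. norm X \<le> 1}"
    then obtain X where X: "r = norm (A * X)" "norm X \<le> 1" by auto
    then show "r \<le> c" using *[of X] c by (smt (verit) mult_left_le)
  qed
qed

lemma opn_least_sq: "0 \<le> c \<Longrightarrow> (\<And>X. (norm (A * X))\<^sup>2 \<le> c\<^sup>2 * (norm X)\<^sup>2) \<Longrightarrow> opn A \<le> c"
  by (rule opn_least, assumption, rule power2_le_imp_le) (simp_all add: power_mult_distrib)

lemma opn_le_norm: "opn A \<le> norm A"
  by (rule opn_least) (auto simp: norm_times_le)

lemma opn_zero [simp]: "opn 0 = 0"
  using opn_le_norm[of 0] opn_nonneg[of 0] by simp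

lemma opn_triangle: "opn (A + B) \<le> opn A + opn B"
  by (rule opn_least) (auto simp: distrib_right intro!: order_trans[OF norm_triangle_ineq] add_mono norm_le_opn)

lemma opn_times: "opn (A * B) \<le> opn A * opn B"
proof (rule opn_least)
  fix X
  have "norm (A * B * X) \<le> opn A * norm (B * X)" by (simp add: mult.assoc norm_le_opn)
  also have "\<dots> \<le> opn A * (opn B * norm X)" by (intro mult_left_mono norm_le_opn) simp
  finally show "norm (A * B * X) \<le> opn A * opn B * norm X" by (simp add: mult.assoc)
qed simp

lemma opn_adj_times: "(opn A)\<^sup>2 \<le> opn (adj A * A)"
proof -
  have "opn A \<le> sqrt (opn (adj A * A))"
  proof (rule opn_least_sq)
    fix X
    have "(norm (A * X))\<^sup>2 = inner X ((adj A * A) * X)"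
      by (simp add: norm_sq_fmat inner_times_left mult.assoc)
    also have "\<dots> \<le> norm X * norm ((adj A * A) * X)" by (rule norm_cauchy_schwarz)
    also have "\<dots> \<le> norm X * (opn (adj A * A) * norm X)" by (intro mult_left_mono norm_le_opn) simp
    finally show "(norm (A * X))\<^sup>2 \<le> (sqrt (opn (adj A * A)))\<^sup>2 * (norm X)\<^sup>2"
      by (simp add: power2_eq_square mult_ac)
  qed simp
  then show ?thesis by (metis opn_nonneg power_mono real_sqrt_pow2)
qed

lemma opn_le_adj: "opn A \<le> opn (adj A)"
proof (cases "opn A = 0")
  case False
  have "opn A * opn A \<le> opn (adj A) * opn A"
    using opn_adj_times[of A] opn_times[of "adj A" A] by (simp add: power2_eq_square)
  then show ?thesis using False opn_nonneg[of A] by (simp add: order_less_le)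
qed simp

lemma opn_adj [simp]: "opn (adj A) = opn A"
  using opn_le_adj[of A] opn_le_adj[of "adj A"] by simp

lemma opn_cstar: "opn (adj A * A) = (opn A)\<^sup>2"
  using opn_adj_times[of A] opn_times[of "adj A" A] by (simp add: power2_eq_square)

lemma opn_cs: "opn (cs c A) = cmod c * opn A"
proof -
  have le: "opn (cs c A) \<le> cmod c * opn A" for c A
    by (rule opn_least) (auto simp: norm_cs mult.assoc intro!: mult_left_mono norm_le_opn)
  show ?thesis
  proof (cases "c = 0")
    case False
    have "cmod c * opn A = cmod c * opn (cs (1/c) (cs c A))" using False by simp
    also have "\<dots> \<le> cmod c * (cmod (1/c) * opn (cs c A))" by (intro mult_left_mono le) simp
    also have "\<dots> = opn (cs c A)" using False by (simp add: norm_divide)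
    finally show ?thesis using le[of c A] by simp
  qed simp
qed

lemma opn_minus: "opn (A - B) \<le> opn A + opn B"
proof -
  have "A - B = A + cs (-1) B" by (rule fmat_eqI) (simp add: ent_minus ent_plus ent_cs)
  moreover have "opn (cs (-1) B) = opn B" by (simp add: opn_cs)
  ultimately show ?thesis using opn_triangle[of A "cs (-1) B"] by (simp only:)
qed

lemma opn_minus_commute: "opn (A - B) = opn (B - A)"
proof -
  have "A - B = cs (-1) (B - A)" by (rule fmat_eqI) (simp add: ent_minus ent_cs)
  then show ?thesis by (simp add: opn_cs)
qed

lemma norm_le_opn_right: "norm (X * A) \<le> norm X * opn A"
proof -
  have "norm (X * A) = norm (adj A * adj X)" by (simp flip: adj_times)
  also have "\<dots> \<le> opn A * norm X" using norm_le_opn[of "adj A" "adj X"] by simp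
  finally show ?thesis by (simp add: mult.commute)
qed

lemma opn_eq_0: "opn A = 0 \<longleftrightarrow> A = 0"
proof
  assume "opn A = 0"
  then have "norm (A * adj A) \<le> 0" using norm_le_opn[of A "adj A"] by simp
  then have "inner (adj A) (adj A * (A * adj A)) = 0" by simp
  obtain n where n: "corner n A" using corner_ex by blast
  have "ent A i j = 0" for i j
  proof -
    \<comment> \<open>The diagonal of \<open>A * adj A\<close> holds the squared lengths of the rows
      of \<open>A\<close>.\<close>
    have "ent (A * adj A) i i = (\<Sum>l<n. of_real ((cmod (ent A i l))\<^sup>2))"
      by (simp add: ent_times[of n] n ent_adj complex_norm_square mult.commute del: of_real_power)
    then have "(\<Sum>l<n. (cmod (ent A i l))\<^sup>2) = 0"
      using \<open>norm (A * adj A) \<le> 0\<close> by (metis norm_le_zero_iff ent_zero of_real_sum of_real_eq_0_iff)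
    then have "\<forall>l<n. ent A i l = 0" by (subst (asm) sum_nonneg_eq_0_iff) auto
    then show ?thesis using n unfolding corner_def by blast
  qed
  then show "A = 0" by (intro fmat_eqI) (simp add: ent_zero)
qed simp

section \<open>Diagonal matrices, matrix units and block shifts\<close>

definition diagm :: "nat \<Rightarrow> (nat \<Rightarrow> complex) \<Rightarrow> fmat" where
  "diagm n d = Fmat (\<lambda>i j. if i = j \<and> i < n then d i else 0)"
definition uid :: "nat \<Rightarrow> fmat" where "uid n = diagm n (\<lambda>_. 1)"
text \<open>A diagonal matrix unit. \<open>X * munit i\<close> is column \<open>i\<close> of
  \<open>X\<close> left in its place, and \<open>q * munit i = q\<close> says that \<open>q\<close>
  is such a column; these columns play the part of vectors.\<close>

definition munit :: "nat \<Rightarrow> fmat" where "munit i = Fmat (\<lambda>k l. if k = i \<and> l = i then 1 else 0)"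
text \<open>The partial isometry carrying coordinate \<open>j < n\<close> to \<open>a + j\<close>.
  Conjugation by it puts a block of size \<open>n\<close> at offset \<open>a\<close>.\<close>

definition shift :: "nat \<Rightarrow> nat \<Rightarrow> fmat" where
  "shift a n = Fmat (\<lambda>i j. if j < n \<and> i = a + j then 1 else 0)"

lemma ent_diagm: "ent (diagm n d) i j = (if i = j \<and> i < n then d i else 0)"
  unfolding diagm_def by (subst ent_Fmat[of _ n]) (auto split: if_splits)
lemma ent_uid: "ent (uid n) i j = (if i = j \<and> i < n then 1 else 0)"
  unfolding uid_def ent_diagm ..
lemma ent_munit: "ent (munit i) k l = (if k = i \<and> l = i then 1 else 0)"
  unfolding munit_def by (subst ent_Fmat[of _ "Suc i"]) (auto split: if_splits)
lemma ent_shift: "ent (shift a n) i j = (if j < n \<and> i = a + j then 1 else 0)"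
  unfolding shift_def by (subst ent_Fmat[of _ "a + n"]) (auto split: if_splits)

lemma corner_diagm [simp]: "corner n (diagm n d)"
  unfolding corner_def ent_diagm by auto
lemma corner_uid [simp]: "corner n (uid n)"
  unfolding uid_def by simp
lemma corner_munit [simp]: "i < n \<Longrightarrow> corner n (munit i)"
  unfolding corner_def ent_munit by auto
lemma corner_shift [simp]: "a + k \<le> n \<Longrightarrow> corner n (shift a k)"
  unfolding corner_def ent_shift by auto

lemma ent_diagm_times: "ent (diagm n d * A) i j = (if i < n then d i * ent A i j else 0)"
proof -
  have "ent (diagm n d * A) i j = (\<Sum>l<n. if l = i then d i * ent A i j else 0)"
    unfolding ent_times[OF disjI1, OF corner_diagm] ent_diagm by (intro sum.cong) auto
  then show ?thesis by simp
qed

lemma ent_times_diagm: "ent (A * diagm n d) i j = (if j < n then ent A i j * d j else 0)"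
proof -
  have "ent (A * diagm n d) i j = (\<Sum>l<n. if l = j then ent A i j * d j else 0)"
    unfolding ent_times[OF disjI2, OF corner_diagm] ent_diagm by (intro sum.cong) auto
  then show ?thesis by simp
qed

text \<open>Membership in a corner becomes a pair of ring equations, which can be checked by
  rewriting without looking at entries.\<close>

lemma corner_iff: "corner n A \<longleftrightarrow> uid n * A = A \<and> A * uid n = A"
proof
  assume "corner n A"
  then show "uid n * A = A \<and> A * uid n = A"
    by (auto intro!: fmat_eqI simp: uid_def ent_diagm_times ent_times_diagm corner_zero)
next
  assume *: "uid n * A = A \<and> A * uid n = A"
  show "corner n A"
  proof (rule cornerI)
    fix i j assume "\<not> (i < n \<and> j < n)"
    then show "ent A i j = 0" using * by (metis ent_diagm_times ent_times_diagm uid_def)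
  qed
qed

lemma uid_left: "corner n A \<Longrightarrow> uid n * A = A"
  and uid_right: "corner n A \<Longrightarrow> A * uid n = A"
  unfolding corner_iff by auto

lemma uid_times_uid: "uid m * uid n = uid (min m n)"
  by (auto intro!: fmat_eqI simp: uid_def ent_diagm_times ent_diagm)
lemma uid_idem [simp]: "uid n * uid n = uid n"
  by (simp add: uid_times_uid)
lemma adj_uid [simp]: "adj (uid n) = uid n"
  by (auto intro!: fmat_eqI simp: ent_adj ent_uid)
lemma adj_diagm: "adj (diagm n d) = diagm n (\<lambda>i. cnj (d i))"
  by (auto intro!: fmat_eqI simp: ent_adj ent_diagm)
lemma diagm_times: "diagm n d * diagm n e = diagm n (\<lambda>i. d i * e i)"
  by (auto intro!: fmat_eqI simp: ent_diagm_times ent_diagm)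
lemma diagm_minus: "diagm n d - diagm n e = diagm n (\<lambda>i. d i - e i)"
  by (auto intro!: fmat_eqI simp: ent_minus ent_diagm)
lemma shift_adj_shift [simp]: "adj (shift a n) * shift a n = uid n"
proof (rule fmat_eqI)
  fix i j
  have "ent (adj (shift a n) * shift a n) i j = (\<Sum>l<a+n. if l = a + i \<and> i = j \<and> i < n then 1 else 0)"
    by (subst ent_times[of "a + n"]) (auto simp: ent_adj ent_shift intro!: sum.cong)
  also have "\<dots> = (if i = j \<and> i < n then 1 else 0)" by (cases "i = j \<and> i < n") auto
  finally show "ent (adj (shift a n) * shift a n) i j = ent (uid n) i j" by (simp add: ent_uid)
qed

lemma shift_disjoint: "a + n \<le> b \<Longrightarrow> adj (shift a n) * shift b m = 0"
proof (rule fmat_eqI)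
  fix i j assume "a + n \<le> b"
  then have "ent (adj (shift a n) * shift b m) i j = (\<Sum>l<a+n. 0)"
    by (subst ent_times[of "a + n"]) (auto simp: ent_adj ent_shift intro!: sum.cong)
  then show "ent (adj (shift a n) * shift b m) i j = ent 0 i j" by (simp add: ent_zero)
qed

lemma shift_disjoint': "a + n \<le> b \<Longrightarrow> adj (shift b m) * shift a n = 0"
  using shift_disjoint[of a n b m] by (metis adj_adj adj_times adj_zero)

lemma shift_0: "shift 0 n = uid n"
  by (auto intro!: fmat_eqI simp: ent_shift ent_uid)

lemma ent_shift_times:
  "ent (shift a n * A * adj (shift a n)) i j =
    (if a \<le> i \<and> i < a + n \<and> a \<le> j \<and> j < a + n then ent A (i - a) (j - a) else 0)"
proof -
  have 1: "ent (shift a n * A) i k = (if a \<le> i \<and> i < a + n then ent A (i - a) k else 0)" for A i k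
  proof -
    have "ent (shift a n * A) i k = (\<Sum>l<a+n. if l = i - a \<and> a \<le> i \<and> i < a + n then ent A l k else 0)"
      by (subst ent_times[of "a + n"]) (auto simp: ent_shift intro!: sum.cong)
    then show ?thesis by (cases "a \<le> i \<and> i < a + n") (auto simp: less_diff_conv)
  qed
  have "ent (shift a n * A * adj (shift a n)) i j = cnj (ent (shift a n * adj (shift a n * A)) j i)"
    by (subst ent_adj[symmetric]) (simp add: adj_times)
  then show ?thesis by (auto simp: 1 ent_adj)
qed

lemma shift_uid [simp]: "shift a n * uid n = shift a n"
  by (auto intro!: fmat_eqI simp: uid_def ent_times_diagm ent_shift)

lemma ent_shift_adj_shift:
  "ent (shift a n * adj (shift a n)) i j = (if i = j \<and> a \<le> i \<and> i < a + n then 1 else 0)"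
  using ent_shift_times[of a n "uid n" i j] by (auto simp: ent_uid)

lemma shift_blocks:
  "(\<Sum>a<L. shift (a * k) k * adj (shift (a * k) k)) = uid (L * k)"
proof (induction L)
  case (Suc L)
  show ?case
    by (rule fmat_eqI) (auto simp: Suc ent_plus ent_shift_adj_shift ent_uid)
qed (auto intro!: fmat_eqI simp: ent_zero ent_uid)

section \<open>Comparison with matrices of fixed size\<close>

definition emb :: "complex mat \<Rightarrow> fmat" where
  "emb A = Fmat (\<lambda>i j. if i < dim_row A \<and> j < dim_col A then A $$ (i, j) else 0)"
definition tomat :: "nat \<Rightarrow> nat \<Rightarrow> fmat \<Rightarrow> complex mat" where
  "tomat r c A = mat r c (\<lambda>(i, j). ent A i j)"

lemma ent_emb: "ent (emb A) i j = (if i < dim_row A \<and> j < dim_col A then A $$ (i, j) else 0)"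
  unfolding emb_def by (subst ent_Fmat[of _ "max (dim_row A) (dim_col A)"]) (auto split: if_splits)

lemma tomat_carrier [simp]: "tomat r c A \<in> carrier_mat r c"
  by (simp add: tomat_def)

lemma emb_tomat: "corner n A \<Longrightarrow> emb (tomat n n A) = A"
  by (rule fmat_eqI) (auto simp: ent_emb tomat_def corner_zero)

lemma corner_emb: "A \<in> carrier_mat n n \<Longrightarrow> corner n (emb A)"
  unfolding corner_def ent_emb by auto

lemma emb_inj: "A \<in> carrier_mat r c \<Longrightarrow> B \<in> carrier_mat r c \<Longrightarrow> emb A = emb B \<Longrightarrow> A = B"
proof (rule eq_matI)
  fix i j assume *: "A \<in> carrier_mat r c" "B \<in> carrier_mat r c" "emb A = emb B" and "i < dim_row B" "j < dim_col B"
  then show "A $$ (i, j) = B $$ (i, j)"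
    using arg_cong[OF *(3), of "\<lambda>X. ent X i j"] *(1,2) unfolding ent_emb by auto
qed auto

lemma emb_add: "A \<in> carrier_mat r c \<Longrightarrow> B \<in> carrier_mat r c \<Longrightarrow> emb (A + B) = emb A + emb B"
  by (rule fmat_eqI) (auto simp: ent_emb ent_plus)
lemma emb_smult: "emb (c \<cdot>\<^sub>m A) = cs c (emb A)"
  by (rule fmat_eqI) (auto simp: ent_emb ent_cs)
lemma emb_zero: "emb (0\<^sub>m r c) = 0"
  by (rule fmat_eqI) (auto simp: ent_emb ent_zero)
lemma emb_one: "emb (1\<^sub>m n) = uid n"
  by (rule fmat_eqI) (auto simp: ent_emb ent_uid)

lemma mat_adjoint_dims: "dim_row (mat_adjoint A) = dim_col A" "dim_col (mat_adjoint A) = dim_row A"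
  by (auto simp: mat_adjoint_def)
lemma mat_adjoint_carrier: "A \<in> carrier_mat r c \<Longrightarrow> mat_adjoint A \<in> carrier_mat c r"
  by (auto simp: mat_adjoint_dims)
lemma mat_adjoint_index:
  "i < dim_col A \<Longrightarrow> j < dim_row A \<Longrightarrow> mat_adjoint (A :: complex mat) $$ (i, j) = cnj (A $$ (j, i))"
  by (simp add: mat_adjoint_def mat_of_rows_index)

lemma emb_adjoint: "emb (mat_adjoint A) = adj (emb A)"
  by (rule fmat_eqI) (auto simp: ent_emb ent_adj mat_adjoint_dims mat_adjoint_index)

lemma emb_mult:
  assumes "dim_col A = dim_row B"
  shows "emb (A * B) = emb A * emb B"
proof (rule fmat_eqI)
  fix i j
  let ?n = "dim_col A + dim_row A + dim_col B"
  have "corner ?n (emb A)" by (rule cornerI) (auto simp: ent_emb)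
  then have "ent (emb A * emb B) i j = (\<Sum>l<?n. ent (emb A) i l * ent (emb B) l j)"
    by (intro ent_times) auto
  also have "\<dots> = (\<Sum>l<dim_col A. ent (emb A) i l * ent (emb B) l j)"
    by (rule sum_extend_zero[symmetric]) (auto simp: ent_emb)
  also have "\<dots> = ent (emb (A * B)) i j"
    using assms by (auto simp: ent_emb scalar_prod_def lessThan_atLeast0 intro!: sum.cong)
  finally show "ent (emb (A * B)) i j = ent (emb A * emb B) i j" by simp
qed

lemma emb_four_block:
  assumes "A \<in> carrier_mat k k" "B \<in> carrier_mat m m"
  shows "emb (four_block_mat A (0\<^sub>m k m) (0\<^sub>m m k) B) = emb A + shift k m * emb B * adj (shift k m)"
  by (rule fmat_eqI) (use assms in \<open>auto simp: ent_emb ent_plus ent_shift_times\<close>)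

lemma hs_norm_emb: "A \<in> carrier_mat n n \<Longrightarrow> hs_norm A = norm (emb A) / sqrt n"
proof -
  assume A: "A \<in> carrier_mat n n"
  have "(norm (emb A))\<^sup>2 = (\<Sum>i<n. \<Sum>j<n. (cmod (A $$ (i, j)))\<^sup>2)"
    unfolding norm_sq_ent[OF corner_emb[OF A]] using A by (intro sum.cong refl) (auto simp: ent_emb)
  then have "norm (emb A) = sqrt (\<Sum>i<n. \<Sum>j<n. (cmod (A $$ (i, j)))\<^sup>2)"
    by (metis norm_ge_zero real_sqrt_unique)
  then show ?thesis using A by (simp add: hs_norm_def real_sqrt_divide)
qed

section \<open>Vectors as columns, and agreement of the two operator norms\<close>

definition colm :: "nat \<Rightarrow> complex vec \<Rightarrow> fmat" where
  "colm m x = Fmat (\<lambda>i j. if j = m \<and> i < dim_vec x then x $ i else 0)"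

lemma ent_colm: "ent (colm m x) i j = (if j = m \<and> i < dim_vec x then x $ i else 0)"
  unfolding colm_def by (subst ent_Fmat[of _ "Suc (max m (dim_vec x))"]) (auto split: if_splits)

lemma norm_colm: "norm (colm m x) = vec_norm2 x"
proof -
  let ?n = "Suc (max m (dim_vec x))"
  have "corner ?n (colm m x)" by (rule cornerI) (auto simp: ent_colm)
  then have "(norm (colm m x))\<^sup>2 = (\<Sum>i<?n. \<Sum>j<?n. (cmod (ent (colm m x) i j))\<^sup>2)"
    by (rule norm_sq_ent)
  also have "\<dots> = (\<Sum>i<?n. if i < dim_vec x then (cmod (x $ i))\<^sup>2 else 0)"
  proof (intro sum.cong refl)
    fix i
    have "(\<Sum>j<?n. (cmod (ent (colm m x) i j))\<^sup>2) =
        (\<Sum>j<?n. if j = m then (if i < dim_vec x then (cmod (x $ i))\<^sup>2 else 0) else 0)"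
      by (intro sum.cong) (auto simp: ent_colm)
    then show "(\<Sum>j<?n. (cmod (ent (colm m x) i j))\<^sup>2) = (if i < dim_vec x then (cmod (x $ i))\<^sup>2 else 0)"
      by simp
  qed
  also have "\<dots> = (\<Sum>i<dim_vec x. if i < dim_vec x then (cmod (x $ i))\<^sup>2 else 0)"
    by (rule sum_extend_zero[symmetric]) auto
  also have "\<dots> = (\<Sum>i<dim_vec x. (cmod (x $ i))\<^sup>2)" by (rule sum.cong) auto
  finally show ?thesis unfolding vec_norm2_def by (metis norm_ge_zero real_sqrt_unique)
qed

lemma emb_times_colm:
  assumes "A \<in> carrier_mat r c" "x \<in> carrier_vec c"
  shows "emb A * colm m x = colm m (A *\<^sub>v x)"
proof (rule fmat_eqI)
  fix i j
  have "corner (r + c) (emb A)" by (rule cornerI) (use assms in \<open>auto simp: ent_emb\<close>)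
  then have "ent (emb A * colm m x) i j = (\<Sum>l<r+c. ent (emb A) i l * ent (colm m x) l j)"
    by (intro ent_times) auto
  also have "\<dots> = (\<Sum>l<c. ent (emb A) i l * ent (colm m x) l j)"
    by (rule sum_extend_zero[symmetric]) (use assms in \<open>auto simp: ent_emb\<close>)
  also have "\<dots> = ent (colm m (A *\<^sub>v x)) i j"
    using assms by (auto simp: ent_emb ent_colm scalar_prod_def lessThan_atLeast0 intro!: sum.cong)
  finally show "ent (emb A * colm m x) i j = ent (colm m (A *\<^sub>v x)) i j" .
qed

lemma colm_times_munit: "ent (X * munit j) i l = (if l = j then ent X i j else 0)"
proof -
  let ?n = "Suc j"
  have "ent (X * munit j) i l = (\<Sum>k<?n. if k = j then (if l = j then ent X i j else 0) else 0)"
    by (subst ent_times[of ?n]) (auto simp: ent_munit intro!: sum.cong)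
  then show ?thesis by simp
qed

lemma norm_sq_columns_le: "(\<Sum>i<n. (norm (X * munit i))\<^sup>2) \<le> (norm X)\<^sup>2"
  and norm_sq_columns: "corner n X \<Longrightarrow> (\<Sum>i<n. (norm (X * munit i))\<^sup>2) = (norm X)\<^sup>2"
proof -
  have *: "(norm (X * munit i))\<^sup>2 = (\<Sum>k<m. (cmod (ent X k i))\<^sup>2)" if "corner m X" "i < m" for i m
  proof -
    have "(norm (X * munit i))\<^sup>2 = (\<Sum>k<m. \<Sum>l<m. (cmod (ent (X * munit i) k l))\<^sup>2)"
      by (rule norm_sq_ent) (use that in \<open>simp add: corner_times\<close>)
    also have "\<dots> = (\<Sum>k<m. \<Sum>l<m. if l = i then (cmod (ent X k i))\<^sup>2 else 0)"
      by (intro sum.cong) (auto simp: colm_times_munit)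
    finally show ?thesis using that by simp
  qed
  have eq: "(\<Sum>i<m. (norm (X * munit i))\<^sup>2) = (norm X)\<^sup>2" if "corner m X" for m
    unfolding norm_sq_ent[OF that] by (subst sum.swap) (simp add: *[OF that])
  then show "corner n X \<Longrightarrow> (\<Sum>i<n. (norm (X * munit i))\<^sup>2) = (norm X)\<^sup>2" .
  obtain m where m: "corner m X" using corner_ex by blast
  then have "corner (max m n) X" by (rule corner_mono) simp
  then have "(norm X)\<^sup>2 = (\<Sum>i<max m n. (norm (X * munit i))\<^sup>2)" by (simp add: eq)
  moreover have "(\<Sum>i<n. (norm (X * munit i))\<^sup>2) \<le> (\<Sum>i<max m n. (norm (X * munit i))\<^sup>2)"
    by (rule sum_mono2) auto
  ultimately show "(\<Sum>i<n. (norm (X * munit i))\<^sup>2) \<le> (norm X)\<^sup>2" by simp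
qed

lemma mat_op_norm_emb:
  assumes A: "A \<in> carrier_mat n n"
  shows "mat_op_norm A = opn (emb A)"
proof -
  let ?S = "{x \<in> carrier_vec (dim_col A). vec_norm2 x \<le> 1}"
  have eq: "vec_norm2 (A *\<^sub>v x) = norm (emb A * colm m x)" if "x \<in> carrier_vec n" for x m
    using emb_times_colm[OF A that] by (simp add: norm_colm)
  have up: "vec_norm2 (A *\<^sub>v x) \<le> opn (emb A)" if "x \<in> ?S" for x
    using that A eq[of x 0] opn_upper[of "colm 0 x" "emb A"] by (auto simp: norm_colm)
  then have bdd: "bdd_above ((\<lambda>x. vec_norm2 (A *\<^sub>v x)) ` ?S)" by (intro bdd_aboveI2)
  have z: "0\<^sub>v n \<in> ?S" using A by (auto simp: vec_norm2_def)
  have le: "mat_op_norm A \<le> opn (emb A)"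
    unfolding mat_op_norm_def by (rule cSUP_least) (use z up in auto)
  have upper: "vec_norm2 (A *\<^sub>v x) \<le> mat_op_norm A" if "x \<in> ?S" for x
    unfolding mat_op_norm_def by (rule cSUP_upper[OF that bdd])
  have nonneg: "0 \<le> mat_op_norm A"
    using upper[OF z] by (rule order_trans[rotated]) (simp add: vec_norm2_def sum_nonneg)
  have col: "norm (emb A * colm j x) \<le> mat_op_norm A * norm (colm j x)" if x: "x \<in> carrier_vec n" for x j
  proof (cases "vec_norm2 x = 0")
    case True
    then have "colm j x = 0" by (metis norm_colm norm_eq_zero)
    then show ?thesis by simp
  next
    case False
    \<comment> \<open>The supremum in \<open>mat_op_norm\<close> runs over the unit ball, hence the
      rescaling.\<close>
    define y where "y = complex_of_real (inverse (vec_norm2 x)) \<cdot>\<^sub>v x"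
    have y: "y \<in> carrier_vec n" using x by (simp add: y_def)
    have xy: "colm j y = cs (inverse (vec_norm2 x)) (colm j x)"
      by (rule fmat_eqI) (auto simp: y_def ent_colm ent_cs)
    then have "norm (colm j y) = 1" using False by (simp add: norm_cs norm_colm norm_inverse) (metis abs_ge_zero abs_of_nonneg left_inverse norm_colm norm_ge_zero)
    then have "norm (emb A * colm j y) \<le> mat_op_norm A"
      using upper[of y] y A eq[OF y] by (simp add: norm_colm)
    moreover have "norm (emb A * colm j y) = norm (emb A * colm j x) / vec_norm2 x"
      using False unfolding xy by (simp add: norm_cs norm_inverse) (metis abs_of_nonneg norm_colm norm_ge_zero divide_inverse mult.commute)
    ultimately show ?thesis using False norm_ge_zero[of "colm j x"]
      by (simp add: norm_colm divide_le_eq)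
  qed
  have "opn (emb A) \<le> mat_op_norm A"
  proof (rule opn_least_sq[OF nonneg])
    fix X
    obtain m0 where "corner m0 X" using corner_ex by blast
    then have m: "corner (max m0 n) X" "corner (max m0 n) (emb A)"
      by (auto intro: corner_mono[OF _ max.cobounded1] corner_mono[OF corner_emb[OF A]])
    let ?m = "max m0 n"
    let ?x = "\<lambda>j. vec n (\<lambda>i. ent X i j)"
    have c: "uid n * X * munit j = colm j (?x j)" for j
      by (rule fmat_eqI) (auto simp: mult.assoc uid_def ent_diagm_times colm_times_munit ent_colm)
    \<comment> \<open>\<open>A\<close> does not see the rows of \<open>X\<close> beyond
      \<open>n\<close>; cutting them off makes the columns of \<open>X\<close> vectors of the right
      dimension.\<close>
    have e: "emb A * X = emb A * (uid n * X)"
      using uid_right[OF corner_emb[OF A]] by (simp flip: mult.assoc)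
    have "(norm (emb A * X))\<^sup>2 = (\<Sum>j<?m. (norm (emb A * (uid n * X * munit j)))\<^sup>2)"
      unfolding e using norm_sq_columns[of ?m "emb A * (uid n * X)"] m
      by (simp add: corner_times corner_mono[of n] mult.assoc)
    also have "\<dots> \<le> (\<Sum>j<?m. (mat_op_norm A)\<^sup>2 * (norm (uid n * X * munit j))\<^sup>2)"
      unfolding c power_mult_distrib[symmetric] by (intro sum_mono power_mono col) auto
    also have "\<dots> \<le> (mat_op_norm A)\<^sup>2 * (norm (uid n * X))\<^sup>2"
      unfolding sum_distrib_left[symmetric] by (intro mult_left_mono norm_sq_columns_le) auto
    also have "\<dots> \<le> (mat_op_norm A)\<^sup>2 * (norm X)\<^sup>2"
    proof -
      have "(norm (uid n * X))\<^sup>2 = inner X (uid n * X)"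
        by (simp add: norm_sq_fmat inner_times_left) (simp flip: mult.assoc)
      also have "\<dots> \<le> norm X * norm (uid n * X)" by (rule norm_cauchy_schwarz)
      finally have "norm (uid n * X) \<le> norm X"
        by (metis mult_right_le_imp_le norm_ge_zero order_le_less power2_eq_square)
      then show ?thesis by (intro mult_left_mono power_mono) auto
    qed
    finally show "(norm (emb A * X))\<^sup>2 \<le> (mat_op_norm A)\<^sup>2 * (norm X)\<^sup>2" .
  qed
  then show ?thesis using le by simp
qed

section \<open>The spectral theorem for normal matrices\<close>

definition funitary :: "nat \<Rightarrow> fmat \<Rightarrow> bool" where
  "funitary n Q \<longleftrightarrow> corner n Q \<and> adj Q * Q = uid n \<and> Q * adj Q = uid n"

lemma funitary_uid: "funitary n (uid n)"
  by (simp add: funitary_def)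
lemma funitary_adj: "funitary n Q \<Longrightarrow> funitary n (adj Q)"
  by (auto simp: funitary_def)
lemma funitary_times:
  assumes "funitary n P" "funitary n Q" shows "funitary n (P * Q)"
proof -
  have "adj (P * Q) * (P * Q) = adj Q * (adj P * P) * Q" by (simp add: adj_times mult.assoc)
  also have "\<dots> = uid n" using assms by (simp add: funitary_def uid_right)
  finally have 1: "adj (P * Q) * (P * Q) = uid n" .
  have "(P * Q) * adj (P * Q) = P * (Q * adj Q) * adj P" by (simp add: adj_times mult.assoc)
  also have "\<dots> = uid n" using assms by (simp add: funitary_def uid_right)
  finally show ?thesis using 1 assms by (simp add: funitary_def corner_times)
qed

lemma funitary_cancel:
  assumes "funitary n Q"
  shows "adj Q * (Q * A) = uid n * A" "Q * (adj Q * A) = uid n * A"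
    "A * Q * adj Q = A * uid n" "A * adj Q * Q = A * uid n"
  using assms by (simp_all add: funitary_def mult.assoc) (simp_all add: funitary_def flip: mult.assoc)

text \<open>\<open>Q\<close> is isometric only on its own corner, hence the cut-off on the
  right.\<close>

lemma norm_funitary:
  assumes "funitary n Q" shows "norm (Q * X) = norm (uid n * X)"
proof -
  have "(norm (Q * X))\<^sup>2 = (norm (uid n * X))\<^sup>2"
    using assms by (simp add: norm_sq_fmat inner_times_left funitary_cancel)
      (simp flip: mult.assoc)
  then show ?thesis by simp
qed

lemma opn_uid_le: "opn (uid n) \<le> 1"
proof -
  have "(opn (uid n))\<^sup>2 = opn (uid n)" using opn_cstar[of "uid n"] by simp
  then have "opn (uid n) = 0 \<or> opn (uid n) = 1" by (simp add: power2_eq_square)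
  then show ?thesis by auto
qed

lemma opn_uid: "0 < n \<Longrightarrow> opn (uid n) = 1"
proof -
  assume "0 < n"
  have "(opn (uid n))\<^sup>2 = opn (uid n)" using opn_cstar[of "uid n"] by simp
  then have "opn (uid n) = 0 \<or> opn (uid n) = 1" by (simp add: power2_eq_square)
  moreover have "uid n \<noteq> 0" using \<open>0 < n\<close> ent_uid[of n 0 0] by (auto simp: ent_zero)
  ultimately show ?thesis by (simp add: opn_eq_0)
qed

lemma opn_isometry_le: "adj A * A = uid n \<Longrightarrow> opn A \<le> 1"
  using opn_cstar[of A] opn_uid_le[of n] by (metis opn_nonneg power2_le_imp_le power_one zero_le_one)

lemma opn_funitary_le: "funitary n Q \<Longrightarrow> opn Q \<le> 1"
  by (auto simp: funitary_def intro: opn_isometry_le)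

lemma opn_diagm_le:
  assumes "\<And>i. i < n \<Longrightarrow> cmod (d i) \<le> M" "0 \<le> M"
  shows "opn (diagm n d) \<le> M"
proof (rule opn_least_sq[OF assms(2)])
  fix X
  obtain m where m: "corner m X" using corner_ex by blast
  let ?m = "max n m"
  have c: "corner ?m X" "corner ?m (diagm n d)"
    by (auto intro: corner_mono[OF m] corner_mono[OF corner_diagm])
  have "(norm (diagm n d * X))\<^sup>2 = (\<Sum>i<?m. \<Sum>j<?m. (cmod (ent (diagm n d * X) i j))\<^sup>2)"
    by (rule norm_sq_ent) (intro corner_times c)
  also have "\<dots> \<le> (\<Sum>i<?m. \<Sum>j<?m. M\<^sup>2 * (cmod (ent X i j))\<^sup>2)"
    by (intro sum_mono)
       (auto simp: ent_diagm_times norm_mult power_mult_distrib intro!: mult_right_mono power_mono assms)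
  also have "\<dots> = M\<^sup>2 * (norm X)\<^sup>2"
    unfolding norm_sq_ent[OF c(1)] by (simp add: sum_distrib_left)
  finally show "(norm (diagm n d * X))\<^sup>2 \<le> M\<^sup>2 * (norm X)\<^sup>2" .
qed

text \<open>A matter of finite dimension, imported from square matrices through
  \<open>tomat\<close>.\<close>

lemma left_inverse_right_inverse:
  assumes "corner n A" "corner n B" "A * B = uid n"
  shows "B * A = uid n"
proof -
  let ?A = "tomat n n A" and ?B = "tomat n n B"
  have "emb (?A * ?B) = emb (1\<^sub>m n)"
    by (subst emb_mult) (simp_all add: carrier_matD[OF tomat_carrier] emb_tomat assms emb_one)
  then have "?A * ?B = 1\<^sub>m n" by (rule emb_inj[rotated 2]) (rule mult_carrier_mat[OF tomat_carrier tomat_carrier], simp)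
  then have "?B * ?A = 1\<^sub>m n" by (rule mat_mult_left_right_inverse[OF tomat_carrier tomat_carrier])
  then have "emb (?B * ?A) = emb (1\<^sub>m n)" by simp
  then show ?thesis
    by (subst (asm) emb_mult) (simp_all add: emb_tomat assms emb_one carrier_matD[OF tomat_carrier])
qed

text \<open>A root of the characteristic polynomial gives an eigenvector. It is stored in column
  \<open>m\<close> so that it is of the same kind as \<open>munit m\<close>, with which
  \<open>reflection\<close> exchanges it.\<close>

lemma eigen_column:
  assumes "corner n T" "m < n"
  shows "\<exists>t q. T * q = cs t q \<and> corner n q \<and> q * munit m = q \<and> norm q = 1"
proof -
  let ?A = "tomat n n T"
  have A: "?A \<in> carrier_mat n n" by simp
  have "degree (char_poly ?A) = n" using degree_monic_char_poly[OF A] by simp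
  then have "\<not> constant (poly (char_poly ?A))" using assms(2) by (simp add: constant_degree)
  then obtain t where "poly (char_poly ?A) t = 0" using fundamental_theorem_of_algebra by blast
  then have "eigenvalue ?A t" using eigenvalue_root_char_poly[OF A] by simp
  then obtain v where v: "v \<in> carrier_vec n" "v \<noteq> 0\<^sub>v n" "?A *\<^sub>v v = t \<cdot>\<^sub>v v"
    unfolding eigenvalue_def eigenvector_def using A by auto
  let ?q = "colm m v"
  have q: "T * ?q = cs t ?q"
    using emb_times_colm[OF A v(1), of m] assms(1) unfolding v(3) emb_tomat[OF assms(1)]
    by (auto intro!: fmat_eqI simp: ent_colm ent_cs)
  have "?q \<noteq> 0"
  proof
    assume "?q = 0"
    then have "v $ i = 0" if "i < n" for i
      using that v(1) ent_colm[of m v i m] by (auto simp: ent_zero)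
    then have "v = 0\<^sub>v n" using v(1) by (intro eq_vecI) auto
    with v(2) show False ..
  qed
  moreover have "corner n ?q" using assms(2) v(1) by (intro cornerI) (auto simp: ent_colm)
  moreover have "?q * munit m = ?q"
    by (rule fmat_eqI) (auto simp: colm_times_munit ent_colm)
  ultimately show ?thesis
    by (intro exI[of _ t] exI[of _ "cs (1 / norm ?q) ?q"])
       (simp add: q norm_cs corner_cs mult.commute norm_divide)
qed

lemma munit_idem [simp]: "munit m * munit m = munit m"
  by (rule fmat_eqI) (auto simp: colm_times_munit ent_munit)
lemma adj_munit [simp]: "adj (munit m) = munit m"
  by (rule fmat_eqI) (auto simp: ent_adj ent_munit)

lemma munit_sandwich: "munit m * A * munit m = cs (ent A m m) (munit m)"
proof -
  have "ent (munit m * A * munit m) i j = (if j = m then ent (munit m * A) i m else 0)" for i j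
    by (rule colm_times_munit)
  moreover have "ent (munit m * A) i m = cnj (ent (adj A * munit m) m i)" for i
    by (subst ent_adj[symmetric]) (simp add: adj_times)
  ultimately show ?thesis
    by (intro fmat_eqI) (auto simp: colm_times_munit ent_adj ent_cs ent_munit)
qed

text \<open>All of \<open>q\<close> sits in column \<open>m\<close>, so the Gram matrix can only
  have an entry at \<open>(m, m)\<close>, and that entry is a squared length.\<close>

lemma column_gram:
  assumes "q * munit m = q"
  shows "adj q * q = cs (of_real ((norm q)\<^sup>2)) (munit m)"
proof -
  have "adj q * q = munit m * (adj q * q) * munit m"
    by (metis adj_munit adj_times assms mult.assoc)
  then have 1: "adj q * q = cs (ent (adj q * q) m m) (munit m)" by (simp add: munit_sandwich)
  obtain n where n: "corner n q" "corner n (munit m)" by (rule corner_common)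
  then have mn: "m < n" unfolding corner_def ent_munit by auto
  have "ent (adj q * q) m m = (\<Sum>l<n. of_real ((cmod (ent q l m))\<^sup>2))"
    by (subst ent_times[of n]) (simp_all add: n ent_adj complex_norm_square mult.commute del: of_real_power)
  also have "(\<Sum>l<n. (cmod (ent q l m))\<^sup>2) = (norm q)\<^sup>2"
  proof -
    have "(norm q)\<^sup>2 = (\<Sum>l<n. \<Sum>j<n. if j = m then (cmod (ent q l m))\<^sup>2 else 0)"
      unfolding norm_sq_ent[OF n(1)]
      by (intro sum.cong refl) (metis (no_types, lifting) assms colm_times_munit norm_zero zero_power2)
    then show ?thesis using mn by simp
  qed
  then have "(\<Sum>l<n. of_real ((cmod (ent q l m))\<^sup>2)) = (of_real ((norm q)\<^sup>2) :: complex)"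
    by (metis of_real_sum)
  finally show ?thesis using 1 by simp
qed

text \<open>The reflection exchanging the unit columns \<open>a = munit m\<close> and \<open>q\<close>; the phase of \<open>q\<close> must make
  \<open>adj a * q\<close> real.\<close>

lemma reflection:
  assumes m: "m < n" and q: "corner n q" "q * munit m = q" "norm q = 1" and r: "ent q m m = of_real r"
  shows "\<exists>W. funitary n W \<and> adj W = W \<and> W * munit m = q"
proof (cases "q = munit m")
  case True
  then show ?thesis using m by (intro exI[of _ "uid n"]) (simp add: funitary_uid uid_left)
next
  case False
  define a where "a = munit m"
  define w where "w = a - q"
  have ca: "corner n a" using m by (simp add: a_def)
  have qq: "adj q * q = a" using column_gram[OF q(2)] q(3) by (simp add: a_def)
  have aq: "a * q = cs (of_real r) a"
    using munit_sandwich[of m q] q(2) r by (simp add: a_def mult.assoc)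
  have qa: "adj q * a = cs (of_real r) a"
    using arg_cong[OF aq, of adj] by (simp add: adj_times adj_cs a_def)
  have wa: "adj w * a = cs (of_real (1 - r)) a"
    by (simp add: w_def adj_minus left_diff_distrib qa cs_diff_left) (simp add: a_def)
  have ww: "adj w * w = cs (of_real (2 * (1 - r))) a"
  proof -
    have "adj w * w = a * a - a * q - (adj q * a - adj q * q)"
      by (simp add: w_def adj_minus left_diff_distrib right_diff_distrib) (simp add: a_def)
    also have "\<dots> = a - cs (of_real r) a - (cs (of_real r) a - a)"
      unfolding aq qa qq by (simp add: a_def)
    also have "\<dots> = cs (of_real (2 * (1 - r))) a"
      by (rule fmat_eqI) (simp only: ent_minus ent_cs, simp add: algebra_simps)
    finally show ?thesis .
  qed
  have wA: "w * a = w" using q(2) by (simp add: w_def left_diff_distrib a_def)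
  \<comment> \<open>Equality in the Cauchy-Schwarz inequality would force
    \<open>q = munit m\<close>.\<close>
  have "r \<noteq> 1"
  proof
    assume "r = 1"
    then have "adj w * w = 0" using ww by simp
    then have "norm w = 0" by (metis inner_times_left inner_zero_right norm_sq_fmat uid_left
          power_zero_numeral zero_eq_power2 uid_right w_def ca corner_minus q(1))
    then show False using False by (simp add: w_def a_def)
  qed
  \<comment> \<open>This is \<open>2\<close> over the squared length \<open>2 * (1 - r)\<close> of
    \<open>w\<close>, the factor in the Householder reflection along \<open>w\<close>.\<close>
  define c where "c = complex_of_real (1 / (1 - r))"
  have c: "c * of_real (1 - r) = 1" using \<open>r \<noteq> 1\<close> by (simp add: c_def flip: of_real_mult)
  have c1: "c * (1 - of_real r) = 1" using c by simp
  define W where "W = uid n - cs c (w * adj w)"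
  have cw: "corner n w" by (simp add: w_def corner_minus ca q(1))
  have sa: "adj W = W" by (simp add: W_def adj_minus adj_cs adj_times c_def)
  have cW: "corner n W" by (simp add: W_def corner_minus corner_cs corner_times cw)
  have "W * a = q"
    using ca by (simp add: W_def left_diff_distrib uid_left mult.assoc wa)
      (simp add: wA c1, simp add: w_def)
  moreover have "W * W = uid n"
  proof -
    have "w * adj w * (w * adj w) = cs (of_real (2 * (1 - r))) (w * adj w)"
    proof -
      have "w * adj w * (w * adj w) = w * (adj w * w) * adj w" by (simp add: mult.assoc)
      also have "\<dots> = cs (of_real (2 * (1 - r))) (w * a * adj w)" unfolding ww by (simp add: mult.assoc)
      finally show ?thesis by (simp add: wA)
    qed
    then have "cs c (w * adj w) * cs c (w * adj w) = cs (2 * c * (c * of_real (1 - r))) (w * adj w)"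
      by (simp add: mult_ac)
    then have "cs c (w * adj w) * cs c (w * adj w) = cs (2 * c) (w * adj w)" unfolding c by simp
    moreover define H where "H = cs c (w * adj w)"
    moreover have "uid n * H = H" "H * uid n = H"
      using uid_left[OF corner_times, OF cw, of "adj w"] uid_right[OF corner_times, OF cw, of "adj w"] cw
      by (simp_all add: H_def)
    moreover have "cs (2 * c) (w * adj w) = H + H"
      by (simp add: H_def flip: cs_add_left)
    ultimately have H: "H * H = H + H" "uid n * H = H" "H * uid n = H" "W = uid n - H"
      by (simp_all only: W_def)
    show ?thesis unfolding H(4) by (simp add: left_diff_distrib right_diff_distrib H(1-3))
  qed
  ultimately show ?thesis using sa cW unfolding funitary_def a_def by metis
qed

text \<open>Used to see that a normal matrix and its adjoint have the same kernel.\<close>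

lemma normal_norm_adj:
  assumes "adj T * T = T * adj T"
  shows "norm (T * X) = norm (adj T * X)"
proof -
  have "(norm (T * X))\<^sup>2 = inner X (adj T * T * X)" by (simp add: norm_sq_fmat inner_times_left mult.assoc)
  also have "\<dots> = (norm (adj T * X))\<^sup>2" unfolding assms by (simp add: norm_sq_fmat inner_times_left mult.assoc)
  finally show ?thesis by simp
qed

text \<open>Deflation. A reflection turns an eigenvector into the last coordinate vector. By
  normality it is an eigenvector of the adjoint too, so the last row and the last column both vanish
  off the diagonal, and what remains is normal and one size smaller.\<close>

theorem spectral_theorem:
  assumes "corner n T" "adj T * T = T * adj T"
  shows "\<exists>Q d. funitary n Q \<and> T = Q * diagm n d * adj Q"
  using assms
proof (induction n arbitrary: T)
  case 0
  then have "T = 0" by (intro fmat_eqI) (simp add: corner_zero ent_zero)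
  moreover have "diagm 0 (\<lambda>_. 0) = 0" by (rule fmat_eqI) (simp add: ent_diagm ent_zero)
  ultimately have "T = uid 0 * diagm 0 (\<lambda>_. 0) * adj (uid 0)" by simp
  then show ?case using funitary_uid by blast
next
  case (Suc n T)
  let ?a = "munit n"
  obtain t q0 where q0: "T * q0 = cs t q0" "corner (Suc n) q0" "q0 * ?a = q0" "norm q0 = 1"
    using eigen_column[OF Suc.prems(1), of n] by auto
  \<comment> \<open>\<open>reflection\<close> asks for a real diagonal entry; a phase factor in
    front of the eigenvector arranges this.\<close>
  obtain z where z: "cmod z = 1" "z * ent q0 n n = of_real (cmod (ent q0 n n))"
  proof (cases "ent q0 n n = 0")
    case False
    show ?thesis
      by (rule that[of "of_real (cmod (ent q0 n n)) / ent q0 n n"]) (use False in \<open>auto simp: norm_divide\<close>)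
  qed (auto intro: that[of 1])
  define q where "q = cs z q0"
  have q: "T * q = cs t q" "corner (Suc n) q" "q * ?a = q" "norm q = 1"
    "ent q n n = of_real (cmod (ent q0 n n))"
    using q0 z by (auto simp: q_def corner_cs norm_cs mult.commute ent_cs)
  obtain W where W: "funitary (Suc n) W" "adj W = W" "W * ?a = q"
    using reflection[OF _ q(2-5)] by auto
  have cW: "corner (Suc n) W" and WW: "W * W = uid (Suc n)"
    using W unfolding funitary_def by auto
  have ca: "corner (Suc n) ?a" by simp
  define S where "S = W * T * W"
  have cS: "corner (Suc n) S" unfolding S_def by (intro corner_times cW Suc.prems(1))
  have Wq: "W * q = ?a" using WW W(3) uid_left[OF ca] by (metis mult.assoc)
  have Sa: "S * ?a = cs t ?a" by (simp add: S_def mult.assoc W(3) q(1) Wq)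
  have WTW: "W * X * W * (W * Y * W) = W * (X * Y) * W" if "corner (Suc n) Y" for X Y
  proof -
    have "W * X * W * (W * Y * W) = W * X * (W * W) * Y * W" by (simp add: mult.assoc)
    then show ?thesis unfolding WW using that by (simp add: mult.assoc uid_left flip: mult.assoc[of "uid (Suc n)"])
  qed
  have adjS: "adj S = W * adj T * W" by (simp add: S_def adj_times W(2) mult.assoc)
  have normS: "adj S * S = S * adj S"
    unfolding adjS unfolding S_def using Suc.prems by (simp add: WTW)
  \<comment> \<open>\<open>N\<close> is normal and kills \<open>munit n\<close>; by
    \<open>normal_norm_adj\<close> so does \<open>adj N\<close>.\<close>
  define N where "N = S - cs t (uid (Suc n))"
  have uS: "uid (Suc n) * S = S" "S * uid (Suc n) = S" using cS by (auto simp: uid_left uid_right)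
  have uS': "uid (Suc n) * adj S = adj S" "adj S * uid (Suc n) = adj S"
    using cS by (auto simp: uid_left uid_right)
  have "adj N * N = adj S * S - cs t (adj S) - (cs (cnj t) S - cs (cnj t * t) (uid (Suc n)))"
    by (simp add: N_def adj_minus adj_cs left_diff_distrib right_diff_distrib uS uS' cs_diff mult.commute[of "cnj t" t])
  also have "\<dots> = S * adj S - cs (cnj t) S - (cs t (adj S) - cs (t * cnj t) (uid (Suc n)))"
    unfolding normS by (rule fmat_eqI) (simp only: ent_minus ent_cs, simp add: algebra_simps)
  also have "\<dots> = N * adj N"
    by (simp add: N_def adj_minus adj_cs left_diff_distrib right_diff_distrib uS uS' cs_diff mult.commute[of "cnj t" t])
  finally have "adj N * N = N * adj N" .
  then have "norm (adj N * ?a) = norm (N * ?a)" by (rule normal_norm_adj[symmetric])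
  also have "N * ?a = 0" by (simp add: N_def left_diff_distrib Sa uid_left ca)
  finally have "adj N * ?a = 0" by simp
  then have adjSa: "adj S * ?a = cs (cnj t) ?a"
    by (simp add: N_def adj_minus adj_cs left_diff_distrib uid_left ca)
  have aS: "?a * S = cs t ?a"
    using arg_cong[OF adjSa, of adj] by (simp add: adj_times adj_cs)
  have aadjS: "?a * adj S = cs (cnj t) ?a"
    using arg_cong[OF Sa, of adj] by (simp add: adj_times adj_cs)
  define R where "R = S - cs t ?a"
  have Ra: "R * ?a = 0" and aR: "?a * R = 0"
    by (simp_all add: R_def left_diff_distrib right_diff_distrib Sa aS)
  have u: "uid (Suc n) = uid n + ?a"
    by (rule fmat_eqI) (auto simp: ent_plus ent_uid ent_munit)
  have cR: "corner n R"
  proof -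
    have "corner (Suc n) R" by (simp add: R_def corner_minus corner_cs cS)
    then have "uid (Suc n) * R = R" "R * uid (Suc n) = R" by (auto simp: uid_left uid_right)
    then show ?thesis unfolding corner_iff u by (simp add: distrib_left distrib_right Ra aR)
  qed
  have "adj R * R = adj S * S - cs t (cs (cnj t) ?a) - (cs (cnj t) (cs t ?a) - cs (cnj t) (cs t ?a))"
    by (simp add: R_def adj_minus adj_cs left_diff_distrib right_diff_distrib aS adjSa mult.commute[of "cnj t" t])
  also have "\<dots> = S * adj S - cs (cnj t) (cs t ?a) - (cs t (cs (cnj t) ?a) - cs t (cs (cnj t) ?a))"
    unfolding normS by (rule fmat_eqI) (simp only: ent_minus ent_cs, simp add: algebra_simps)
  also have "\<dots> = R * adj R"
    by (simp add: R_def adj_minus adj_cs left_diff_distrib right_diff_distrib Sa aadjS mult.commute[of "cnj t" t])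
  finally have "adj R * R = R * adj R" .
  from Suc.IH[OF cR this] obtain Q d where Q: "funitary n Q" "R = Q * diagm n d * adj Q" by blast
  have cQ: "corner n Q" using Q(1) by (simp add: funitary_def)
  have ua: "uid n * ?a = 0" "?a * uid n = 0"
    by (auto intro!: fmat_eqI simp: uid_def ent_diagm_times ent_times_diagm ent_munit ent_zero)
  have Qa: "X * ?a = 0" "?a * X = 0" if "corner n X" for X
    using that ua by (metis corner_iff mult.assoc mult_zero_right, metis corner_iff mult.assoc mult_zero_left)
  \<comment> \<open>The diagonalising unitary of the smaller corner, extended by \<open>1\<close> on
    the last coordinate.\<close>
  define P where "P = Q + ?a"
  have cP: "corner (Suc n) P" unfolding P_def by (intro corner_plus ca corner_mono[OF cQ]) simp
  have QQ: "adj Q * Q = uid n" "Q * adj Q = uid n" using Q(1) by (auto simp: funitary_def)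
  have P: "funitary (Suc n) P"
    using cP by (simp add: funitary_def P_def adj_plus distrib_left distrib_right QQ Qa cQ u)
  define e where "e = d(n := t)"
  have De: "diagm (Suc n) e = diagm n d + cs t ?a"
    by (rule fmat_eqI) (auto simp: ent_plus ent_diagm ent_cs ent_munit e_def)
  have "P * diagm (Suc n) e * adj P = R + cs t ?a"
    unfolding De P_def Q(2)
    by (simp add: adj_plus distrib_left distrib_right Qa cQ corner_times mult.assoc)
  then have S: "S = P * diagm (Suc n) e * adj P" by (simp add: R_def)
  have "T = uid (Suc n) * T * uid (Suc n)" using Suc.prems(1) by (simp add: uid_left uid_right)
  also have "\<dots> = W * S * W" unfolding WW[symmetric] S_def by (simp add: mult.assoc)
  also have "\<dots> = (W * P) * diagm (Suc n) e * adj (W * P)" unfolding S by (simp add: adj_times W(2) mult.assoc)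
  finally show ?case using funitary_times[OF W(1) P] by blast
qed

section \<open>Square roots in C*-algebras\<close>

context cstar_algebra
begin

lemma scale_zero_left: "x \<in> carrier A \<Longrightarrow> cscale A 0 x = \<zero>"
  using scale_add_left[of x 0 0] scale_closed[of x 0]
  by (metis add.Units_eq add.one_closed add.Units_l_cancel add_0 r_zero)

lemma a_inv_scale: "x \<in> carrier A \<Longrightarrow> \<ominus> x = cscale A (- 1) x"
proof -
  assume x: "x \<in> carrier A"
  have "cscale A (-1) x \<oplus> x = \<zero>"
    using scale_add_left[OF x, of "-1" 1] scale_one[OF x] scale_zero_left[OF x] by simp
  then show ?thesis using x scale_closed[OF x] by (intro minus_equality) auto
qed

lemma norm_zero: "cnorm A \<zero> = 0"
  using norm_eq_zero[of \<zero>] by simp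

lemma norm_a_inv: "x \<in> carrier A \<Longrightarrow> cnorm A (\<ominus> x) = cnorm A x"
  by (simp add: a_inv_scale norm_scale)

lemma norm_nonneg: "x \<in> carrier A \<Longrightarrow> 0 \<le> cnorm A x"
  using norm_triangle[of x "\<ominus> x"] by (simp add: norm_a_inv r_neg norm_zero)

lemma norm_minus_le: "x \<in> carrier A \<Longrightarrow> y \<in> carrier A \<Longrightarrow> cnorm A (x \<ominus> y) \<le> cnorm A x + cnorm A y"
  using norm_triangle[of x "\<ominus> y"] by (simp add: norm_a_inv minus_eq)

lemma norm_minus_commute: "x \<in> carrier A \<Longrightarrow> y \<in> carrier A \<Longrightarrow> cnorm A (x \<ominus> y) = cnorm A (y \<ominus> x)"
  using norm_a_inv[of "x \<ominus> y"] by (simp add: minus_eq minus_add a_comm)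

lemma norm_dist_triangle:
  assumes "x \<in> carrier A" "y \<in> carrier A" "z \<in> carrier A"
  shows "cnorm A (x \<ominus> z) \<le> cnorm A (x \<ominus> y) + cnorm A (y \<ominus> z)"
proof -
  have "x \<ominus> z = (x \<ominus> y) \<oplus> (y \<ominus> z)"
    using assms by (simp add: minus_eq a_assoc) (simp add: l_neg flip: a_assoc)
  then show ?thesis using assms norm_triangle[of "x \<ominus> y" "y \<ominus> z"] by simp
qed

lemma norm_star_le: "x \<in> carrier A \<Longrightarrow> cnorm A x \<le> cnorm A (star A x)"
proof (cases "cnorm A x = 0")
  case False
  assume x: "x \<in> carrier A"
  have "cnorm A x * cnorm A x \<le> cnorm A (star A x) * cnorm A x"
    using cstar_identity[OF x] norm_mult[OF star_closed[OF x] x] by (simp add: power2_eq_square)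
  then show ?thesis using False norm_nonneg[OF x] by (simp add: order_less_le)
qed (simp add: norm_nonneg star_closed)

lemma norm_star: "x \<in> carrier A \<Longrightarrow> cnorm A (star A x) = cnorm A x"
  using norm_star_le[of x] norm_star_le[of "star A x"] by (simp add: star_closed star_star)

lemma star_a_inv: "x \<in> carrier A \<Longrightarrow> star A (\<ominus> x) = \<ominus> star A x"
  by (simp add: a_inv_scale star_scale star_closed)

lemma star_minus: "x \<in> carrier A \<Longrightarrow> y \<in> carrier A \<Longrightarrow> star A (x \<ominus> y) = star A x \<ominus> star A y"
  by (simp add: minus_eq star_add star_a_inv)

lemma star_one: "star A \<one> = \<one>"
  by (metis l_one one_closed r_one star_closed star_mult star_star)

lemma scale_minus_right: "x \<in> carrier A \<Longrightarrow> y \<in> carrier A \<Longrightarrow> cscale A c (x \<ominus> y) = cscale A c x \<ominus> cscale A c y"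
  by (simp add: minus_eq scale_add_right a_inv_scale scale_closed scale_scale mult.commute)

lemma eq_if_norm_dist_small:
  assumes "x \<in> carrier A" "y \<in> carrier A" "\<And>e. e > 0 \<Longrightarrow> cnorm A (x \<ominus> y) \<le> e"
  shows "x = y"
proof -
  have "cnorm A (x \<ominus> y) = 0"
    using assms(3)[of "cnorm A (x \<ominus> y) / 2"] norm_nonneg[of "x \<ominus> y"] assms(1,2) by (cases "cnorm A (x \<ominus> y) = 0") auto
  then have "x \<ominus> y = \<zero>" using norm_eq_zero assms(1,2) by simp
  then have "\<zero> \<oplus> y = x \<oplus> (\<ominus> y \<oplus> y)"
    using assms(1,2) by (simp add: minus_eq flip: a_assoc)
  then show ?thesis using assms(1,2) by (simp add: l_neg)
qed

text \<open>The square root of \<open>\<one> \<ominus> x\<close> is \<open>\<one> \<ominus> y\<close>, where \<open>y\<close> is the fixed point of the contraction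
  \<open>y \<mapsto> (x \<oplus> y \<otimes> y) / 2\<close> of the ball of radius \<open>cnorm A x\<close>.\<close>

lemma sqrt_one_minus:
  assumes x: "x \<in> carrier A" "star A x = x" "cnorm A x < 1"
  shows "\<exists>b\<in>carrier A. star A b = b \<and> b \<otimes> b \<oplus> x = \<one>"
proof -
  define q where "q = cnorm A x"
  have q: "0 \<le> q" "q < 1" using x norm_nonneg by (auto simp: q_def)
  define T where "T y = cscale A (1/2) (x \<oplus> y \<otimes> y)" for y
  have Tc: "T y \<in> carrier A" if "y \<in> carrier A" for y using that x by (simp add: T_def scale_closed)
  define Y where "Y n = (T ^^ n) \<zero>" for n
  have Y0: "Y 0 = \<zero>" and YS: "Y (Suc n) = T (Y n)" for n by (simp_all add: Y_def)
  have Yc: "Y n \<in> carrier A" for n by (induction n) (simp_all add: Y0 YS Tc)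
  have contr: "cnorm A (T y \<ominus> T z) \<le> q * cnorm A (y \<ominus> z)"
    if yz: "y \<in> carrier A" "z \<in> carrier A" "cnorm A y \<le> q" "cnorm A z \<le> q" for y z
  proof -
    have "T y \<ominus> T z = cscale A (1/2) ((x \<oplus> y \<otimes> y) \<ominus> (x \<oplus> z \<otimes> z))"
      using yz x by (simp add: T_def scale_minus_right)
    also have "(x \<oplus> y \<otimes> y) \<ominus> (x \<oplus> z \<otimes> z) = y \<otimes> y \<ominus> z \<otimes> z"
    proof -
      have "(x \<oplus> y \<otimes> y) \<ominus> (x \<oplus> z \<otimes> z) = (y \<otimes> y \<oplus> x) \<oplus> (\<ominus> x \<ominus> z \<otimes> z)"
        using x yz by (simp add: minus_eq minus_add a_comm)
      also have "\<dots> = y \<otimes> y \<oplus> (x \<oplus> \<ominus> x) \<ominus> z \<otimes> z"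
        using x yz by (simp add: minus_eq a_assoc)
      finally show ?thesis using x yz by (simp add: r_neg)
    qed
    also have "y \<otimes> y \<ominus> z \<otimes> z = y \<otimes> (y \<ominus> z) \<oplus> (y \<ominus> z) \<otimes> z"
      using yz by (simp add: minus_eq r_distr l_distr l_minus r_minus a_assoc)
        (simp add: l_neg flip: a_assoc)
    finally have "cnorm A (T y \<ominus> T z) = 1/2 * cnorm A (y \<otimes> (y \<ominus> z) \<oplus> (y \<ominus> z) \<otimes> z)"
      using yz by (simp add: norm_scale)
    also have "\<dots> \<le> 1/2 * (cnorm A y * cnorm A (y \<ominus> z) + cnorm A (y \<ominus> z) * cnorm A z)"
      using yz by (intro mult_left_mono order_trans[OF norm_triangle] add_mono norm_mult) auto
    also have "\<dots> \<le> 1/2 * (q * cnorm A (y \<ominus> z) + cnorm A (y \<ominus> z) * q)"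
      using yz by (intro mult_left_mono add_mono mult_right_mono norm_nonneg) auto
    finally show ?thesis by simp
  qed
  have ball: "cnorm A (T y) \<le> q" if y: "y \<in> carrier A" "cnorm A y \<le> q" for y
  proof -
    have "cnorm A (T y) \<le> 1/2 * (q + cnorm A y * cnorm A y)"
      using x y norm_triangle[of x "y \<otimes> y"] norm_mult[of y y] by (simp add: T_def norm_scale q_def)
    also have "\<dots> \<le> 1/2 * (q + q * 1)"
      using y q norm_nonneg[of y] by (intro mult_left_mono add_left_mono mult_mono) auto
    finally show ?thesis by simp
  qed
  have Yq: "cnorm A (Y n) \<le> q" for n
    by (induction n) (simp_all add: Y0 YS norm_zero q ball Yc)
  have step: "cnorm A (Y n \<ominus> Y (Suc n)) \<le> q ^ n" for n
  proof (induction n)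
    case 0
    show ?case using norm_minus_le[OF Yc Yc, of 0 1] Yq[of 1] q(2) by (simp add: Y0 norm_zero)
  next
    case (Suc n)
    have "cnorm A (Y (Suc n) \<ominus> Y (Suc (Suc n))) \<le> q * cnorm A (Y n \<ominus> Y (Suc n))"
      unfolding YS[of n] YS[of "Suc n"] by (rule contr) (use Yc Yq Tc ball in \<open>auto simp: YS[of n, symmetric]\<close>)
    then show ?case using Suc q mult_left_mono[of _ _ q] by fastforce
  qed
  have tail: "cnorm A (Y n \<ominus> Y (n + k)) \<le> (\<Sum>i<k. q ^ (n + i))" for n k
  proof (induction k)
    case (Suc k)
    have "cnorm A (Y n \<ominus> Y (n + Suc k)) \<le> cnorm A (Y n \<ominus> Y (n + k)) + cnorm A (Y (n + k) \<ominus> Y (Suc (n + k)))"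
      using norm_dist_triangle[OF Yc Yc Yc] by simp
    then show ?case using Suc step[of "n + k"] by simp
  qed (use Yc in \<open>simp add: norm_zero minus_eq r_neg\<close>)
  have tail': "cnorm A (Y n \<ominus> Y (n + k)) \<le> q ^ n / (1 - q)" for n k
  proof -
    have "(\<Sum>i<k. q ^ (n + i)) = q ^ n * (\<Sum>i<k. q ^ i)" by (simp add: power_add sum_distrib_left)
    also have "\<dots> = q ^ n * ((1 - q ^ k) / (1 - q))" using q by (simp add: sum_gp_strict)
    also have "\<dots> \<le> q ^ n * (1 / (1 - q))" using q by (intro mult_left_mono divide_right_mono) auto
    finally show ?thesis using tail[of n k] by simp
  qed
  have lim0: "(\<lambda>n. q ^ n / (1 - q)) \<longlonglongrightarrow> 0"
    using q by (intro tendsto_divide_zero LIMSEQ_power_zero) auto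
  have "\<exists>L\<in>carrier A. (\<lambda>n. cnorm A (Y n \<ominus> L)) \<longlonglongrightarrow> 0"
  proof (rule complete[OF Yc])
    fix e :: real assume "e > 0"
    then have "\<forall>\<^sub>F n in sequentially. q ^ n / (1 - q) < e" using order_tendstoD(2)[OF lim0] by blast
    then obtain N where N: "\<And>n. n \<ge> N \<Longrightarrow> q ^ n / (1 - q) < e" unfolding eventually_sequentially by blast
    have *: "cnorm A (Y m \<ominus> Y n) < e" if "m \<ge> N" "m \<le> n" for m n
      using tail'[of m "n - m"] N[OF that(1)] that(2) by simp
    show "\<exists>N. \<forall>m\<ge>N. \<forall>n\<ge>N. cnorm A (Y m \<ominus> Y n) < e"
      by (intro exI[of _ N] allI impI) (metis * nle_le norm_minus_commute Yc)
  qed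
  then obtain y where y: "y \<in> carrier A" "(\<lambda>n. cnorm A (Y n \<ominus> y)) \<longlonglongrightarrow> 0" by blast
  have close: "\<exists>n. cnorm A (Y n \<ominus> y) < e \<and> cnorm A (Y (Suc n) \<ominus> y) < e" if "e > 0" for e
    using order_tendstoD(2)[OF y(2) that] unfolding eventually_sequentially by (meson le_Suc_eq order_refl)
  have yq: "cnorm A y \<le> q"
  proof (rule field_le_epsilon)
    fix e :: real assume "e > 0"
    then obtain n where n: "cnorm A (Y n \<ominus> y) < e" using close by blast
    have "y = Y n \<ominus> (Y n \<ominus> y)" using y(1) Yc[of n]
      by (simp add: minus_eq minus_add) (simp add: r_neg flip: a_assoc)
    then have "cnorm A y \<le> cnorm A (Y n) + cnorm A (Y n \<ominus> y)"
      using norm_minus_le[of "Y n" "Y n \<ominus> y"] y(1) Yc[of n] by simp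
    then show "cnorm A y \<le> q + e" using Yq[of n] n by simp
  qed
  have fix_y: "y = T y"
  proof (rule eq_if_norm_dist_small[OF y(1) Tc[OF y(1)]])
    fix e :: real assume "e > 0"
    then obtain n where n: "cnorm A (Y n \<ominus> y) < e/2" "cnorm A (Y (Suc n) \<ominus> y) < e/2"
      using close[of "e/2"] by auto
    have "cnorm A (y \<ominus> T y) \<le> cnorm A (y \<ominus> Y (Suc n)) + cnorm A (Y (Suc n) \<ominus> T y)"
      using y(1) Yc Tc by (intro norm_dist_triangle) auto
    also have "cnorm A (Y (Suc n) \<ominus> T y) \<le> q * cnorm A (Y n \<ominus> y)"
      unfolding YS by (rule contr) (use Yc Yq y yq in auto)
    also have "\<dots> \<le> 1 * cnorm A (Y n \<ominus> y)"
      using q Yc[of n] y by (intro mult_right_mono norm_nonneg) auto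
    finally show "cnorm A (y \<ominus> T y) \<le> e"
      using n norm_minus_commute[OF y(1) Yc[of "Suc n"]] by simp
  qed
  have starY: "star A (Y n) = Y n" for n
  proof (induction n)
    case 0
    have "star A \<zero> = \<zero>" using scale_zero_left[of \<zero>] star_scale[of \<zero> 0]
      by (simp add: star_closed scale_zero_left)
    then show ?case by (simp add: Y0)
  next
    case (Suc n)
    then show ?case using x Yc[of n] by (simp add: YS T_def star_scale star_add star_mult)
  qed
  have star_y: "star A y = y"
  proof (rule eq_if_norm_dist_small[OF star_closed[OF y(1)] y(1)])
    fix e :: real assume "e > 0"
    then obtain n where n: "cnorm A (Y n \<ominus> y) < e/2" using close[of "e/2"] by auto
    have "cnorm A (star A y \<ominus> y) \<le> cnorm A (star A y \<ominus> Y n) + cnorm A (Y n \<ominus> y)"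
      using y(1) Yc star_closed by (intro norm_dist_triangle) auto
    also have "cnorm A (star A y \<ominus> Y n) = cnorm A (y \<ominus> Y n)"
      using norm_star[of "y \<ominus> Y n"] y(1) Yc[of n] starY[of n] by (simp add: star_minus)
    finally show "cnorm A (star A y \<ominus> y) \<le> e"
      using n norm_minus_commute[OF y(1) Yc[of n]] by simp
  qed
  \<comment> \<open>The fixed point equation freed of the factor \<open>1 / 2\<close>; it says that
    the square of \<open>\<one> \<ominus> y\<close> is \<open>\<one> \<ominus> x\<close>.\<close>
  have yy: "y \<oplus> y = x \<oplus> y \<otimes> y"
  proof -
    have "y \<oplus> y = cscale A 1 y \<oplus> cscale A 1 y" using y(1) by (simp add: scale_one)
    also have "\<dots> = cscale A 2 y" using scale_add_left[OF y(1), of 1 1] by simp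
    also have "\<dots> = cscale A 2 (T y)" using fix_y by simp
    finally show ?thesis using x y(1) by (simp add: T_def scale_scale scale_one)
  qed
  define b where "b = \<one> \<ominus> y"
  have "b \<otimes> b \<oplus> x = \<one>"
  proof -
    have "b \<otimes> b = \<one> \<ominus> y \<ominus> y \<oplus> y \<otimes> y"
      using y(1) by (simp add: b_def minus_eq l_distr r_distr l_minus r_minus a_assoc minus_add)
    then have "b \<otimes> b \<oplus> x = \<one> \<oplus> (\<ominus> (y \<oplus> y) \<oplus> (x \<oplus> y \<otimes> y))"
      using y(1) x by (simp add: minus_eq minus_add a_assoc) (simp add: a_comm)
    also have "\<dots> = \<one>" using y(1) by (simp add: l_neg flip: yy)
    finally show ?thesis .
  qed
  moreover have "star A b = b" using y(1) star_y by (simp add: b_def star_minus star_one)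
  moreover have "b \<in> carrier A" using y(1) by (simp add: b_def)
  ultimately show ?thesis by blast
qed

text \<open>The square root of \<open>\<one> \<ominus> star A a \<otimes> a\<close> trades the
  inequality \<open>cnorm A a < 1\<close> for an equation. Equations pass through homomorphisms
  modulo null sequences, where no norm estimate is at hand.\<close>

lemma contraction_complement:
  assumes a: "a \<in> carrier A" "cnorm A a < 1"
  shows "\<exists>b\<in>carrier A. star A b \<otimes> b \<oplus> star A a \<otimes> a = \<one>"
proof -
  have "cnorm A (star A a \<otimes> a) < 1"
    using a norm_nonneg[OF a(1)] by (simp add: cstar_identity power_less_one_iff abs_if)
  moreover have "star A (star A a \<otimes> a) = star A a \<otimes> a"
    using a by (simp add: star_mult star_closed star_star)
  ultimately obtain b where "b \<in> carrier A" "star A b = b" "b \<otimes> b \<oplus> star A a \<otimes> a = \<one>"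
    using sqrt_one_minus[of "star A a \<otimes> a"] a star_closed by auto
  then show ?thesis by (intro bexI[of _ b]) auto
qed

end

section \<open>Products of matrix algebras\<close>

lemma (in abelian_group) minus_eqI:
  "x \<in> carrier G \<Longrightarrow> y \<in> carrier G \<Longrightarrow> z \<in> carrier G \<Longrightarrow> z \<oplus> y = x \<Longrightarrow> x \<ominus> y = z"
  by (auto simp: minus_eq a_assoc r_neg)

lemma (in abelian_group) minus_add_cancel:
  "x \<in> carrier G \<Longrightarrow> y \<in> carrier G \<Longrightarrow> x \<ominus> y \<oplus> y = x"
  by (simp add: minus_eq a_assoc l_neg)

context
  fixes B :: "'i \<Rightarrow> 'b star_algebra"
  assumes B: "\<And>i. cstar_algebra (B i)"
begin

lemma factor_ring: "ring (B i)"
  using B cstar_algebra.axioms(1) by blast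

lemma bounded_prod_carrier:
  "x \<in> carrier (bounded_prod B) \<longleftrightarrow>
    (\<forall>i. x i \<in> carrier (B i)) \<and> (\<exists>c. \<forall>i. cnorm (B i) (x i) \<le> c)"
  by (auto simp: bounded_prod_def bdd_above_def)

lemma bounded_prod_carrierI:
  "(\<And>i. x i \<in> carrier (B i)) \<Longrightarrow> (\<And>i. cnorm (B i) (x i) \<le> c) \<Longrightarrow> x \<in> carrier (bounded_prod B)"
  unfolding bounded_prod_carrier by blast

lemma bounded_prod_norm_upper:
  "x \<in> carrier (bounded_prod B) \<Longrightarrow> cnorm (B i) (x i) \<le> cnorm (bounded_prod B) x"
  by (auto simp: bounded_prod_def intro: cSUP_upper)

lemma bounded_prod_norm_least:
  "(\<And>i. cnorm (B i) (x i) \<le> c) \<Longrightarrow> cnorm (bounded_prod B) x \<le> c"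
  by (auto simp: bounded_prod_def intro: cSUP_least)

lemma bounded_prod_sel:
  "(x \<oplus>\<^bsub>bounded_prod B\<^esub> y) i = x i \<oplus>\<^bsub>B i\<^esub> y i"
  "(x \<otimes>\<^bsub>bounded_prod B\<^esub> y) i = x i \<otimes>\<^bsub>B i\<^esub> y i"
  "\<zero>\<^bsub>bounded_prod B\<^esub> i = \<zero>\<^bsub>B i\<^esub>" "\<one>\<^bsub>bounded_prod B\<^esub> i = \<one>\<^bsub>B i\<^esub>"
  "cscale (bounded_prod B) c x i = cscale (B i) c (x i)"
  "star (bounded_prod B) x i = star (B i) (x i)"
  by (simp_all add: bounded_prod_def)

lemma bounded_prod_closed:
  "x \<in> carrier (bounded_prod B) \<Longrightarrow> x i \<in> carrier (B i)"
  by (simp add: bounded_prod_carrier)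

lemma bounded_prod_add_closed:
  assumes "x \<in> carrier (bounded_prod B)" "y \<in> carrier (bounded_prod B)"
  shows "x \<oplus>\<^bsub>bounded_prod B\<^esub> y \<in> carrier (bounded_prod B)"
proof -
  obtain c d where "\<And>i. cnorm (B i) (x i) \<le> c" "\<And>i. cnorm (B i) (y i) \<le> d"
    using assms unfolding bounded_prod_carrier by blast
  then show ?thesis using assms[THEN bounded_prod_closed]
    by (intro bounded_prod_carrierI[of _ "c + d"])
       (auto simp: bounded_prod_sel ring.ring_simprules(1)[OF factor_ring]
         intro!: order_trans[OF cstar_algebra.norm_triangle[OF B]] add_mono)
qed

lemma bounded_prod_mult_closed:
  assumes "x \<in> carrier (bounded_prod B)" "y \<in> carrier (bounded_prod B)"
  shows "x \<otimes>\<^bsub>bounded_prod B\<^esub> y \<in> carrier (bounded_prod B)"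
proof -
  obtain c d where cd: "\<And>i. cnorm (B i) (x i) \<le> c" "\<And>i. cnorm (B i) (y i) \<le> d"
    using assms unfolding bounded_prod_carrier by blast
  have "0 \<le> c" using cd(1) cstar_algebra.norm_nonneg[OF B] bounded_prod_closed[OF assms(1)] by (meson order_trans)
  then show ?thesis using assms[THEN bounded_prod_closed] cd
    by (intro bounded_prod_carrierI[of _ "c * d"])
       (auto simp: bounded_prod_sel ring.ring_simprules(5)[OF factor_ring]
         intro!: order_trans[OF cstar_algebra.norm_mult[OF B]] mult_mono cstar_algebra.norm_nonneg[OF B])
qed

lemma bounded_prod_scale_closed:
  assumes "x \<in> carrier (bounded_prod B)"
  shows "cscale (bounded_prod B) c x \<in> carrier (bounded_prod B)"
proof -
  obtain d where "\<And>i. cnorm (B i) (x i) \<le> d"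
    using assms unfolding bounded_prod_carrier by blast
  then show ?thesis using assms[THEN bounded_prod_closed]
    by (intro bounded_prod_carrierI[of _ "cmod c * d"])
       (auto simp: bounded_prod_sel cstar_algebra.scale_closed[OF B] cstar_algebra.norm_scale[OF B]
         intro!: mult_left_mono)
qed

lemma bounded_prod_star_closed:
  assumes "x \<in> carrier (bounded_prod B)"
  shows "star (bounded_prod B) x \<in> carrier (bounded_prod B)"
  using assms unfolding bounded_prod_carrier
  by (auto simp: bounded_prod_sel cstar_algebra.star_closed[OF B] cstar_algebra.norm_star[OF B])

lemma bounded_prod_zero_closed: "\<zero>\<^bsub>bounded_prod B\<^esub> \<in> carrier (bounded_prod B)"
  by (rule bounded_prod_carrierI[of _ 0])
     (auto simp: bounded_prod_sel cstar_algebra.norm_zero[OF B] ring.ring_simprules(2)[OF factor_ring])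

lemma bounded_prod_one_closed: "\<one>\<^bsub>bounded_prod B\<^esub> \<in> carrier (bounded_prod B)"
proof (rule bounded_prod_carrierI[of _ 1])
  fix i
  interpret C: cstar_algebra "B i" by (rule B)
  show "\<one>\<^bsub>bounded_prod B\<^esub> i \<in> carrier (B i)" by (simp add: bounded_prod_sel)
  \<comment> \<open>The norm of the unit is idempotent, hence \<open>0\<close> or \<open>1\<close>;
    the value \<open>0\<close> occurs when the factor is the zero algebra.\<close>
  have "cnorm (B i) \<one>\<^bsub>B i\<^esub> * cnorm (B i) \<one>\<^bsub>B i\<^esub> = cnorm (B i) \<one>\<^bsub>B i\<^esub>"
    using C.cstar_identity[OF C.one_closed] by (simp add: C.star_one power2_eq_square)
  then show "cnorm (B i) (\<one>\<^bsub>bounded_prod B\<^esub> i) \<le> 1" by (auto simp: bounded_prod_sel)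
qed

lemma bounded_prod_ring: "ring (bounded_prod B)"
proof (rule ringI)
  show "abelian_group (bounded_prod B)"
  proof (rule abelian_groupI)
    fix x y z assume xyz: "x \<in> carrier (bounded_prod B)" "y \<in> carrier (bounded_prod B)" "z \<in> carrier (bounded_prod B)"
    show "x \<oplus>\<^bsub>bounded_prod B\<^esub> y \<oplus>\<^bsub>bounded_prod B\<^esub> z = x \<oplus>\<^bsub>bounded_prod B\<^esub> (y \<oplus>\<^bsub>bounded_prod B\<^esub> z)"
      using xyz by (intro ext) (simp add: bounded_prod_sel bounded_prod_closed ring.ring_simprules(7)[OF factor_ring])
  next
    fix x y assume xy: "x \<in> carrier (bounded_prod B)" "y \<in> carrier (bounded_prod B)"
    show "x \<oplus>\<^bsub>bounded_prod B\<^esub> y = y \<oplus>\<^bsub>bounded_prod B\<^esub> x"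
      using xy by (intro ext) (simp add: bounded_prod_sel bounded_prod_closed ring.ring_simprules(10)[OF factor_ring])
  next
    fix x assume x: "x \<in> carrier (bounded_prod B)"
    show "\<zero>\<^bsub>bounded_prod B\<^esub> \<oplus>\<^bsub>bounded_prod B\<^esub> x = x"
      using x by (intro ext) (simp add: bounded_prod_sel bounded_prod_closed ring.ring_simprules(8)[OF factor_ring])
    have "cscale (bounded_prod B) (-1) x \<oplus>\<^bsub>bounded_prod B\<^esub> x = \<zero>\<^bsub>bounded_prod B\<^esub>"
    proof
      fix i
      interpret C: cstar_algebra "B i" by (rule B)
      show "(cscale (bounded_prod B) (-1) x \<oplus>\<^bsub>bounded_prod B\<^esub> x) i = \<zero>\<^bsub>bounded_prod B\<^esub> i"
        using bounded_prod_closed[OF x, of i] by (simp add: bounded_prod_sel C.l_neg flip: C.a_inv_scale)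
    qed
    then show "\<exists>y\<in>carrier (bounded_prod B). y \<oplus>\<^bsub>bounded_prod B\<^esub> x = \<zero>\<^bsub>bounded_prod B\<^esub>"
      using bounded_prod_scale_closed[OF x] by blast
  qed (auto intro: bounded_prod_add_closed bounded_prod_zero_closed)
  show "Group.monoid (bounded_prod B)"
  proof
    fix x y z assume xyz: "x \<in> carrier (bounded_prod B)" "y \<in> carrier (bounded_prod B)" "z \<in> carrier (bounded_prod B)"
    show "x \<otimes>\<^bsub>bounded_prod B\<^esub> y \<otimes>\<^bsub>bounded_prod B\<^esub> z = x \<otimes>\<^bsub>bounded_prod B\<^esub> (y \<otimes>\<^bsub>bounded_prod B\<^esub> z)"
      using xyz by (intro ext) (simp add: bounded_prod_sel bounded_prod_closed ring.ring_simprules(11)[OF factor_ring])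
  next
    fix x assume x: "x \<in> carrier (bounded_prod B)"
    show "\<one>\<^bsub>bounded_prod B\<^esub> \<otimes>\<^bsub>bounded_prod B\<^esub> x = x"
      using x by (intro ext) (simp add: bounded_prod_sel bounded_prod_closed ring.ring_simprules(12)[OF factor_ring])
    show "x \<otimes>\<^bsub>bounded_prod B\<^esub> \<one>\<^bsub>bounded_prod B\<^esub> = x"
    proof
      fix i
      interpret C: cstar_algebra "B i" by (rule B)
      show "(x \<otimes>\<^bsub>bounded_prod B\<^esub> \<one>\<^bsub>bounded_prod B\<^esub>) i = x i"
        using bounded_prod_closed[OF x, of i] by (simp add: bounded_prod_sel)
    qed
  qed (auto intro: bounded_prod_mult_closed bounded_prod_one_closed)
  fix x y z assume xyz: "x \<in> carrier (bounded_prod B)" "y \<in> carrier (bounded_prod B)" "z \<in> carrier (bounded_prod B)"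
  show "(x \<oplus>\<^bsub>bounded_prod B\<^esub> y) \<otimes>\<^bsub>bounded_prod B\<^esub> z = x \<otimes>\<^bsub>bounded_prod B\<^esub> z \<oplus>\<^bsub>bounded_prod B\<^esub> y \<otimes>\<^bsub>bounded_prod B\<^esub> z"
    using xyz by (intro ext) (simp add: bounded_prod_sel bounded_prod_closed ring.ring_simprules(13)[OF factor_ring])
  show "z \<otimes>\<^bsub>bounded_prod B\<^esub> (x \<oplus>\<^bsub>bounded_prod B\<^esub> y) = z \<otimes>\<^bsub>bounded_prod B\<^esub> x \<oplus>\<^bsub>bounded_prod B\<^esub> z \<otimes>\<^bsub>bounded_prod B\<^esub> y"
    using xyz by (intro ext) (simp add: bounded_prod_sel bounded_prod_closed ring.ring_simprules(23)[OF factor_ring])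
qed

text \<open>Subtraction is not a field of the record but comes from additive inverses, which are
  determined only through cancellation.\<close>

lemma bounded_prod_minus:
  assumes "x \<in> carrier (bounded_prod B)" "y \<in> carrier (bounded_prod B)"
  shows "(x \<ominus>\<^bsub>bounded_prod B\<^esub> y) i = x i \<ominus>\<^bsub>B i\<^esub> y i"
proof -
  interpret P: ring "bounded_prod B" by (rule bounded_prod_ring)
  interpret C: ring "B i" by (rule factor_ring)
  have "(x \<ominus>\<^bsub>bounded_prod B\<^esub> y) \<oplus>\<^bsub>bounded_prod B\<^esub> y = x"
    using assms by (rule P.minus_add_cancel)
  then have "(x \<ominus>\<^bsub>bounded_prod B\<^esub> y) i \<oplus>\<^bsub>B i\<^esub> y i = x i"
    by (metis bounded_prod_sel(1))
  then show ?thesis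
    using assms by (intro C.minus_eqI[symmetric]) (auto intro: bounded_prod_closed)
qed

theorem bounded_prod_cstar: "cstar_algebra (bounded_prod B)"
proof -
  let ?P = "bounded_prod B"
  interpret P: ring ?P by (rule bounded_prod_ring)
  note cl = bounded_prod_closed
  note up = bounded_prod_norm_upper
  have nn: "0 \<le> cnorm (B i) (x i)" if "x \<in> carrier ?P" for x i
    by (rule cstar_algebra.norm_nonneg[OF B cl[OF that]])
  have pn: "0 \<le> cnorm ?P x" if "x \<in> carrier ?P" for x
    using nn[OF that] up[OF that] by (rule order_trans)
  show ?thesis
  proof (unfold_locales)
    fix x y :: "'i \<Rightarrow> 'b" and c d :: complex
    assume x: "x \<in> carrier ?P"
    show "cscale ?P c x \<in> carrier ?P" by (rule bounded_prod_scale_closed[OF x])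
    show "star ?P x \<in> carrier ?P" by (rule bounded_prod_star_closed[OF x])
    show "cscale ?P (c + d) x = cscale ?P c x \<oplus>\<^bsub>?P\<^esub> cscale ?P d x"
      using cl[OF x] by (intro ext) (simp add: bounded_prod_sel cstar_algebra.scale_add_left[OF B])
    show "cscale ?P c (cscale ?P d x) = cscale ?P (c * d) x"
      using cl[OF x] by (intro ext) (simp add: bounded_prod_sel cstar_algebra.scale_scale[OF B])
    show "cscale ?P 1 x = x"
      using cl[OF x] by (intro ext) (simp add: bounded_prod_sel cstar_algebra.scale_one[OF B])
    show "star ?P (star ?P x) = x"
      using cl[OF x] by (intro ext) (simp add: bounded_prod_sel cstar_algebra.star_star[OF B])
    show "star ?P (cscale ?P c x) = cscale ?P (cnj c) (star ?P x)"
      using cl[OF x] by (intro ext) (simp add: bounded_prod_sel cstar_algebra.star_scale[OF B])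
    show "(cnorm ?P x = 0) = (x = \<zero>\<^bsub>?P\<^esub>)"
    proof
      assume "cnorm ?P x = 0"
      then have "cnorm (B i) (x i) = 0" for i using up[OF x, of i] nn[OF x, of i] by simp
      then show "x = \<zero>\<^bsub>?P\<^esub>"
        using cl[OF x] by (intro ext) (simp add: bounded_prod_sel cstar_algebra.norm_eq_zero[OF B])
    next
      assume "x = \<zero>\<^bsub>?P\<^esub>"
      then have "cnorm (B i) (x i) \<le> 0" for i by (simp add: bounded_prod_sel cstar_algebra.norm_zero[OF B])
      then have "cnorm ?P x \<le> 0" by (rule bounded_prod_norm_least)
      then show "cnorm ?P x = 0" using pn[OF x] by simp
    qed
    show "cnorm ?P (cscale ?P c x) = cmod c * cnorm ?P x"
    proof (rule antisym)
      show "cnorm ?P (cscale ?P c x) \<le> cmod c * cnorm ?P x"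
        using cl[OF x] up[OF x] by (intro bounded_prod_norm_least)
          (simp add: bounded_prod_sel cstar_algebra.norm_scale[OF B] mult_left_mono)
      show "cmod c * cnorm ?P x \<le> cnorm ?P (cscale ?P c x)"
      proof (cases "c = 0")
        case False
        have "cnorm ?P x \<le> cnorm ?P (cscale ?P c x) / cmod c"
        proof (rule bounded_prod_norm_least)
          fix i
          have "cmod c * cnorm (B i) (x i) \<le> cnorm ?P (cscale ?P c x)"
            using up[OF bounded_prod_scale_closed[OF x, of c], of i] cl[OF x, of i]
            by (simp add: bounded_prod_sel cstar_algebra.norm_scale[OF B])
          then show "cnorm (B i) (x i) \<le> cnorm ?P (cscale ?P c x) / cmod c"
            using False by (simp add: field_simps)
        qed
        then show ?thesis using False by (simp add: field_simps)
      qed (use pn[OF bounded_prod_scale_closed[OF x]] in simp)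
    qed
    show "cnorm ?P (star ?P x \<otimes>\<^bsub>?P\<^esub> x) = (cnorm ?P x)\<^sup>2"
    proof (rule antisym)
      have e: "cnorm (B i) ((star ?P x \<otimes>\<^bsub>?P\<^esub> x) i) = (cnorm (B i) (x i))\<^sup>2" for i
        using cl[OF x] by (simp add: bounded_prod_sel cstar_algebra.cstar_identity[OF B])
      show "cnorm ?P (star ?P x \<otimes>\<^bsub>?P\<^esub> x) \<le> (cnorm ?P x)\<^sup>2"
        by (intro bounded_prod_norm_least) (simp only: e power_mono[OF up[OF x] nn[OF x]])
      have c: "star ?P x \<otimes>\<^bsub>?P\<^esub> x \<in> carrier ?P"
        by (intro bounded_prod_mult_closed bounded_prod_star_closed x)
      have "cnorm ?P x \<le> sqrt (cnorm ?P (star ?P x \<otimes>\<^bsub>?P\<^esub> x))"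
        by (intro bounded_prod_norm_least real_le_rsqrt) (metis e up[OF c])
      then show "(cnorm ?P x)\<^sup>2 \<le> cnorm ?P (star ?P x \<otimes>\<^bsub>?P\<^esub> x)"
        using pn[OF x] pn[OF c] by (metis power_mono real_sqrt_pow2)
    qed
    assume y: "y \<in> carrier ?P"
    show "cscale ?P c (x \<oplus>\<^bsub>?P\<^esub> y) = cscale ?P c x \<oplus>\<^bsub>?P\<^esub> cscale ?P c y"
      using cl[OF x] cl[OF y] by (intro ext) (simp add: bounded_prod_sel cstar_algebra.scale_add_right[OF B])
    show "cscale ?P c x \<otimes>\<^bsub>?P\<^esub> y = cscale ?P c (x \<otimes>\<^bsub>?P\<^esub> y)"
      using cl[OF x] cl[OF y] by (intro ext) (simp add: bounded_prod_sel cstar_algebra.scale_mult_left[OF B])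
    show "x \<otimes>\<^bsub>?P\<^esub> cscale ?P c y = cscale ?P c (x \<otimes>\<^bsub>?P\<^esub> y)"
      using cl[OF x] cl[OF y] by (intro ext) (simp add: bounded_prod_sel cstar_algebra.scale_mult_right[OF B])
    show "star ?P (x \<oplus>\<^bsub>?P\<^esub> y) = star ?P x \<oplus>\<^bsub>?P\<^esub> star ?P y"
      using cl[OF x] cl[OF y] by (intro ext) (simp add: bounded_prod_sel cstar_algebra.star_add[OF B])
    show "star ?P (x \<otimes>\<^bsub>?P\<^esub> y) = star ?P y \<otimes>\<^bsub>?P\<^esub> star ?P x"
      using cl[OF x] cl[OF y] by (intro ext) (simp add: bounded_prod_sel cstar_algebra.star_mult[OF B])
    show "cnorm ?P (x \<oplus>\<^bsub>?P\<^esub> y) \<le> cnorm ?P x + cnorm ?P y"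
      using cl[OF x] cl[OF y] by (intro bounded_prod_norm_least)
        (auto simp: bounded_prod_sel intro!: order_trans[OF cstar_algebra.norm_triangle[OF B]] add_mono up x y)
    show "cnorm ?P (x \<otimes>\<^bsub>?P\<^esub> y) \<le> cnorm ?P x * cnorm ?P y"
      using cl[OF x] cl[OF y] by (intro bounded_prod_norm_least)
        (auto simp: bounded_prod_sel intro!: order_trans[OF cstar_algebra.norm_mult[OF B]] mult_mono up x y nn pn)
  next
    fix X :: "nat \<Rightarrow> 'i \<Rightarrow> 'b"
    assume X: "\<And>n. X n \<in> carrier ?P"
      and Cau: "\<And>e. e > 0 \<Longrightarrow> \<exists>N. \<forall>m\<ge>N. \<forall>n\<ge>N. cnorm ?P (X m \<ominus>\<^bsub>?P\<^esub> X n) < e"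
    have pt: "cnorm (B i) (X m i \<ominus>\<^bsub>B i\<^esub> X n i) \<le> cnorm ?P (X m \<ominus>\<^bsub>?P\<^esub> X n)" for i m n
      using up[of "X m \<ominus>\<^bsub>?P\<^esub> X n" i] X by (simp add: bounded_prod_minus)
    have "\<exists>L\<in>carrier (B i). (\<lambda>n. cnorm (B i) (X n i \<ominus>\<^bsub>B i\<^esub> L)) \<longlonglongrightarrow> 0" for i
      by (rule cstar_algebra.complete[OF B]) (use cl[OF X] Cau pt in \<open>blast, meson order_le_less_trans\<close>)
    then obtain L where L: "\<And>i. L i \<in> carrier (B i)"
      "\<And>i. (\<lambda>n. cnorm (B i) (X n i \<ominus>\<^bsub>B i\<^esub> L i)) \<longlonglongrightarrow> 0" by metis
    \<comment> \<open>The Cauchy bound holds for all coordinates at once, so the coordinatewise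
      limits are approached uniformly. This gives both the boundedness of \<open>L\<close> and
      convergence in the supremum norm.\<close>
    have unif: "\<exists>N. \<forall>m\<ge>N. \<forall>i. cnorm (B i) (X m i \<ominus>\<^bsub>B i\<^esub> L i) \<le> e" if e: "e > 0" for e
    proof -
      obtain N where N: "\<And>m n. m \<ge> N \<Longrightarrow> n \<ge> N \<Longrightarrow> cnorm ?P (X m \<ominus>\<^bsub>?P\<^esub> X n) < e" using Cau[OF e] by blast
      have "cnorm (B i) (X m i \<ominus>\<^bsub>B i\<^esub> L i) \<le> e" if "m \<ge> N" for m i
      proof (rule field_le_epsilon)
        fix d :: real assume "d > 0"
        then obtain M where "\<And>n. n \<ge> M \<Longrightarrow> cnorm (B i) (X n i \<ominus>\<^bsub>B i\<^esub> L i) < d"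
          using order_tendstoD(2)[OF L(2)] unfolding eventually_sequentially by blast
        then have n: "cnorm (B i) (X (max M N) i \<ominus>\<^bsub>B i\<^esub> L i) < d" by simp
        have "cnorm (B i) (X m i \<ominus>\<^bsub>B i\<^esub> L i) \<le>
            cnorm (B i) (X m i \<ominus>\<^bsub>B i\<^esub> X (max M N) i) + cnorm (B i) (X (max M N) i \<ominus>\<^bsub>B i\<^esub> L i)"
          by (rule cstar_algebra.norm_dist_triangle[OF B cl[OF X] cl[OF X] L(1)])
        moreover have "cnorm (B i) (X m i \<ominus>\<^bsub>B i\<^esub> X (max M N) i) < e"
          using N[OF that, of "max M N"] by (intro le_less_trans[OF pt]) simp
        ultimately show "cnorm (B i) (X m i \<ominus>\<^bsub>B i\<^esub> L i) \<le> e + d" using n by simp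
      qed
      then show ?thesis by blast
    qed
    have Lc: "L \<in> carrier ?P"
    proof -
      obtain N where N: "\<And>i. cnorm (B i) (X N i \<ominus>\<^bsub>B i\<^esub> L i) \<le> 1" using unif[of 1] by auto
      show ?thesis
      proof (rule bounded_prod_carrierI[OF L(1)])
        fix i
        interpret C: cstar_algebra "B i" by (rule B)
        have "L i = X N i \<ominus>\<^bsub>B i\<^esub> (X N i \<ominus>\<^bsub>B i\<^esub> L i)" using L(1)[of i] cl[OF X[of N], of i]
          by (simp add: C.minus_eq C.minus_add) (simp add: C.r_neg flip: C.a_assoc)
        then have "cnorm (B i) (L i) \<le> cnorm (B i) (X N i) + cnorm (B i) (X N i \<ominus>\<^bsub>B i\<^esub> L i)"
          using C.norm_minus_le[of "X N i" "X N i \<ominus>\<^bsub>B i\<^esub> L i"] L(1)[of i] cl[OF X[of N], of i] by simp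
        then show "cnorm (B i) (L i) \<le> cnorm ?P (X N) + 1" using N[of i] up[OF X[of N], of i] by simp
      qed
    qed
    show "\<exists>L\<in>carrier ?P. (\<lambda>n. cnorm ?P (X n \<ominus>\<^bsub>?P\<^esub> L)) \<longlonglongrightarrow> 0"
    proof (intro bexI[OF _ Lc] LIMSEQ_I)
      fix r :: real assume "0 < r"
      then obtain N where N: "\<And>m i. m \<ge> N \<Longrightarrow> cnorm (B i) (X m i \<ominus>\<^bsub>B i\<^esub> L i) \<le> r / 2" using unif[of "r/2"] by auto
      have "cnorm ?P (X m \<ominus>\<^bsub>?P\<^esub> L) \<le> r / 2" if "m \<ge> N" for m
        by (rule bounded_prod_norm_least) (simp only: bounded_prod_minus[OF X Lc] N[OF that])
      then show "\<exists>no. \<forall>n\<ge>no. norm (cnorm ?P (X n \<ominus>\<^bsub>?P\<^esub> L) - 0) < r"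
        using \<open>0 < r\<close> pn[of "X _ \<ominus>\<^bsub>?P\<^esub> L"] X Lc by (intro exI[of _ N]) (fastforce simp: abs_of_nonneg)
    qed
  qed
qed

end

section \<open>Matrix algebras of fixed size and their products\<close>

lemma mat_algebra_sel [simp]:
  "carrier (mat_algebra n) = carrier_mat n n" "x \<otimes>\<^bsub>mat_algebra n\<^esub> y = x * y"
  "x \<oplus>\<^bsub>mat_algebra n\<^esub> y = x + y" "\<zero>\<^bsub>mat_algebra n\<^esub> = 0\<^sub>m n n" "\<one>\<^bsub>mat_algebra n\<^esub> = 1\<^sub>m n"
  "cscale (mat_algebra n) c x = c \<cdot>\<^sub>m x" "star (mat_algebra n) x = mat_adjoint x"
  "cnorm (mat_algebra n) x = mat_op_norm x"
  by (simp_all add: mat_algebra_def)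

lemma mat_algebra_ring: "ring (mat_algebra n)"
proof (rule ringI)
  show "abelian_group (mat_algebra n)"
    by (rule abelian_groupI) (auto intro!: bexI[of _ "- _"] simp: comm_add_mat)
  show "Group.monoid (mat_algebra n)"
    by unfold_locales auto
qed (auto simp: add_mult_distrib_mat mult_add_distrib_mat)

lemma emb_mat_minus:
  assumes "x \<in> carrier_mat n n" "y \<in> carrier_mat n n"
  shows "x \<ominus>\<^bsub>mat_algebra n\<^esub> y \<in> carrier_mat n n" "emb (x \<ominus>\<^bsub>mat_algebra n\<^esub> y) = emb x - emb y"
proof -
  interpret M: ring "mat_algebra n" by (rule mat_algebra_ring)
  show c: "x \<ominus>\<^bsub>mat_algebra n\<^esub> y \<in> carrier_mat n n" using M.minus_closed[of x y] assms by simp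
  have "(x \<ominus>\<^bsub>mat_algebra n\<^esub> y) \<oplus>\<^bsub>mat_algebra n\<^esub> y = x"
    using M.minus_add_cancel[of x y] assms by simp
  then show "emb (x \<ominus>\<^bsub>mat_algebra n\<^esub> y) = emb x - emb y"
    using emb_add[OF c assms(2)] by (simp add: eq_diff_eq)
qed

lemma cmod_ent_le_opn: "cmod (ent A i j) \<le> opn A"
proof -
  have "(norm (munit j))\<^sup>2 = 1"
    by (subst norm_sq_ent[of "Suc j"]) (auto simp: ent_munit if_distrib[of cmod] if_distrib[of "\<lambda>x. x\<^sup>2"] if_conn sum.delta cong: if_cong)
  then have "norm (munit j) = 1" by (metis norm_ge_zero one_power2 power2_eq_iff_nonneg zero_le_one)
  then have "norm (A * munit j) \<le> opn A" by (intro opn_upper) simp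
  moreover have "cmod (ent (A * munit j) i j) \<le> norm (A * munit j)" by (rule cmod_ent_le)
  ultimately show ?thesis by (simp add: colm_times_munit)
qed

theorem mat_algebra_cstar: "cstar_algebra (mat_algebra n)"
proof -
  interpret M: ring "mat_algebra n" by (rule mat_algebra_ring)
  show ?thesis
  proof (unfold_locales; (simp only: mat_algebra_sel)?)
    fix x y :: "complex mat" and c d :: complex
    assume x: "x \<in> carrier_mat n n"
    note eqI = emb_inj[of _ n n]
    show "c \<cdot>\<^sub>m x \<in> carrier_mat n n" using x by simp
    show "mat_adjoint x \<in> carrier_mat n n" using x by (rule mat_adjoint_carrier)
    show "(c + d) \<cdot>\<^sub>m x = c \<cdot>\<^sub>m x + d \<cdot>\<^sub>m x" using x by (intro eq_matI) (auto simp: algebra_simps)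
    show "c \<cdot>\<^sub>m (d \<cdot>\<^sub>m x) = (c * d) \<cdot>\<^sub>m x" using x by (intro eq_matI) auto
    show "1 \<cdot>\<^sub>m x = x" using x by (intro eq_matI) auto
    show "mat_adjoint (mat_adjoint x) = x"
      using x by (intro eqI) (auto simp: mat_adjoint_dims emb_adjoint)
    show "mat_adjoint (c \<cdot>\<^sub>m x) = cnj c \<cdot>\<^sub>m mat_adjoint x"
      using x by (intro eqI) (auto simp: mat_adjoint_dims emb_adjoint emb_smult adj_cs)
    show "(mat_op_norm x = 0) = (x = 0\<^sub>m n n)"
      using x emb_inj[OF x, of "0\<^sub>m n n"] by (auto simp: mat_op_norm_emb[of _ n] opn_eq_0 emb_zero)
    show "mat_op_norm (c \<cdot>\<^sub>m x) = cmod c * mat_op_norm x"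
      using x by (simp add: mat_op_norm_emb[of _ n] emb_smult opn_cs)
    show "mat_op_norm (mat_adjoint x * x) = (mat_op_norm x)\<^sup>2"
      using x mult_carrier_mat[OF mat_adjoint_carrier[OF x] x]
      by (simp add: mat_op_norm_emb[of _ n] emb_mult emb_adjoint mat_adjoint_dims opn_cstar)
    assume y: "y \<in> carrier_mat n n"
    show "c \<cdot>\<^sub>m (x + y) = c \<cdot>\<^sub>m x + c \<cdot>\<^sub>m y" using x y by (intro eq_matI) (auto simp: algebra_simps)
    show "c \<cdot>\<^sub>m x * y = c \<cdot>\<^sub>m (x * y)"
      using x y by (intro eqI) (auto simp: emb_mult emb_smult)
    show "x * (c \<cdot>\<^sub>m y) = c \<cdot>\<^sub>m (x * y)"
      using x y by (intro eqI) (auto simp: emb_mult emb_smult)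
    show "mat_adjoint (x + y) = mat_adjoint x + mat_adjoint y"
      using x y by (intro eqI) (auto simp: mat_adjoint_dims emb_adjoint emb_add[of _ n n] adj_plus mat_adjoint_carrier)
    show "mat_adjoint (x * y) = mat_adjoint y * mat_adjoint x"
      using x y by (intro eqI) (auto simp: mat_adjoint_dims emb_adjoint emb_mult adj_times)
    show "mat_op_norm (x + y) \<le> mat_op_norm x + mat_op_norm y"
      using x y by (simp add: mat_op_norm_emb[of _ n] emb_add[of _ n n] opn_triangle)
    show "mat_op_norm (x * y) \<le> mat_op_norm x * mat_op_norm y"
      using x y mult_carrier_mat[OF x y] by (simp add: mat_op_norm_emb[of _ n] emb_mult opn_times)
  next
    fix X :: "nat \<Rightarrow> complex mat"
    assume X: "\<And>k. X k \<in> carrier_mat n n"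
      and Cau: "\<And>e. 0 < e \<Longrightarrow> \<exists>N. \<forall>p\<ge>N. \<forall>q\<ge>N. mat_op_norm (X p \<ominus>\<^bsub>mat_algebra n\<^esub> X q) < e"
    have on: "mat_op_norm (X p \<ominus>\<^bsub>mat_algebra n\<^esub> Y) = opn (emb (X p) - emb Y)" if "Y \<in> carrier_mat n n" for p Y
      using emb_mat_minus[OF X that] by (simp add: mat_op_norm_emb[of _ n])
    have "Cauchy (\<lambda>p. ent (emb (X p)) i j)" for i j
    proof (rule CauchyI)
      fix e :: real assume "0 < e"
      then obtain N where "\<forall>p\<ge>N. \<forall>q\<ge>N. opn (emb (X p) - emb (X q)) < e"
        using Cau[of e] unfolding on[OF X] by blast
      then show "\<exists>N. \<forall>p\<ge>N. \<forall>q\<ge>N. norm (ent (emb (X p)) i j - ent (emb (X q)) i j) < e"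
        by (intro exI[of _ N]) (metis cmod_ent_le_opn ent_minus le_less_trans)
    qed
    then have "\<exists>l. (\<lambda>p. ent (emb (X p)) i j) \<longlonglongrightarrow> l" for i j
      using Cauchy_convergent_iff convergent_def by blast
    then obtain l where l: "\<And>i j. (\<lambda>p. ent (emb (X p)) i j) \<longlonglongrightarrow> l i j" by metis
    define L where "L = mat n n (\<lambda>(i, j). l i j)"
    have Lc: "L \<in> carrier_mat n n" by (simp add: L_def)
    \<comment> \<open>At a fixed size, entrywise convergence gives convergence in the Frobenius
      norm, which dominates the operator norm.\<close>
    have "(\<lambda>p. \<Sum>i<n. \<Sum>j<n. (cmod (ent (emb (X p) - emb L) i j))\<^sup>2) \<longlonglongrightarrow> (\<Sum>i<n. \<Sum>j<n. 0\<^sup>2)"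
    proof (intro tendsto_sum tendsto_power)
      fix i j assume "i \<in> {..<n}" "j \<in> {..<n}"
      then have "ent (emb L) i j = l i j" by (simp add: ent_emb L_def)
      then show "(\<lambda>p. cmod (ent (emb (X p) - emb L) i j)) \<longlonglongrightarrow> 0"
        using l[of i j] by (simp add: ent_minus tendsto_norm_zero_iff LIM_zero_iff)
    qed
    then have "(\<lambda>p. (norm (emb (X p) - emb L))\<^sup>2) \<longlonglongrightarrow> 0"
      by (simp add: norm_sq_ent[of n] corner_minus corner_emb X Lc)
    then have "(\<lambda>p. sqrt ((norm (emb (X p) - emb L))\<^sup>2)) \<longlonglongrightarrow> sqrt 0" by (rule tendsto_real_sqrt)
    then have "(\<lambda>p. norm (emb (X p) - emb L)) \<longlonglongrightarrow> 0" by simp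
    then have "(\<lambda>p. opn (emb (X p) - emb L)) \<longlonglongrightarrow> 0"
      by (rule tendsto_sandwich[rotated 3, OF _ ]) (auto simp: opn_le_norm)
    then show "\<exists>L\<in>carrier_mat n n. (\<lambda>p. mat_op_norm (X p \<ominus>\<^bsub>mat_algebra n\<^esub> L)) \<longlonglongrightarrow> 0"
      using Lc by (intro bexI[of _ L]) (simp_all only: on[OF Lc])
  qed
qed

lemma mat_prod_cstar: "cstar_algebra (mat_prod k)"
  unfolding mat_prod_def by (rule bounded_prod_cstar) (rule mat_algebra_cstar)

lemma mat_prod_sel:
  "(x \<oplus>\<^bsub>mat_prod k\<^esub> y) i = x i + y i" "(x \<otimes>\<^bsub>mat_prod k\<^esub> y) i = x i * y i"
  "\<zero>\<^bsub>mat_prod k\<^esub> i = 0\<^sub>m (k i) (k i)" "\<one>\<^bsub>mat_prod k\<^esub> i = 1\<^sub>m (k i)"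
  "cscale (mat_prod k) c x i = c \<cdot>\<^sub>m x i" "star (mat_prod k) x i = mat_adjoint (x i)"
  by (simp_all add: mat_prod_def bounded_prod_def)

lemma mat_prod_carrier:
  "x \<in> carrier (mat_prod k) \<longleftrightarrow> (\<forall>n. x n \<in> carrier_mat (k n) (k n)) \<and> (\<exists>c. \<forall>n. opn (emb (x n)) \<le> c)"
  unfolding mat_prod_def bounded_prod_carrier[OF mat_algebra_cstar]
  by (simp, metis mat_op_norm_emb)

lemma mat_prod_minus:
  assumes "x \<in> carrier (mat_prod k)" "y \<in> carrier (mat_prod k)"
  shows "emb ((x \<ominus>\<^bsub>mat_prod k\<^esub> y) n) = emb (x n) - emb (y n)"
  using bounded_prod_minus[OF mat_algebra_cstar assms[unfolded mat_prod_def]] assms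
    emb_mat_minus(2)[of "x n" "k n" "y n"]
  by (simp add: mat_prod_def[symmetric] mat_prod_carrier)

section \<open>Perturbation of matrices in an ideal norm\<close>

text \<open>As \<open>inner\<close> is a real part, this says that the real part of the quadratic
  form is nonnegative. The condition is stable under sums and under conjugation to
  \<open>adj V * B * V\<close>.\<close>

definition posm :: "fmat \<Rightarrow> bool" where
  "posm B \<longleftrightarrow> (\<forall>Z. 0 \<le> inner Z (B * Z))"

lemma posm_adj_times: "posm (adj B * B)"
proof -
  have "inner Z (adj B * B * Z) = inner (B * Z) (B * Z)" for Z by (simp add: inner_times_left mult.assoc)
  then show ?thesis unfolding posm_def by simp
qed

lemma posm_conj: "posm B \<Longrightarrow> posm (adj V * B * V)"
proof -
  have "inner Z (adj V * B * V * Z) = inner (V * Z) (B * (V * Z))" for Z by (simp add: inner_times_left mult.assoc)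
  then show "posm B \<Longrightarrow> ?thesis" unfolding posm_def by simp
qed

lemma posm_add: "posm A \<Longrightarrow> posm B \<Longrightarrow> posm (A + B)"
  unfolding posm_def by (simp add: distrib_right inner_add_right)

lemma norm_munit [simp]: "norm (munit j) = 1"
proof -
  have "(norm (munit j))\<^sup>2 = (\<Sum>k<Suc j. \<Sum>l<Suc j. if l = j then (if k = j then 1 else 0) else 0)"
    by (subst norm_sq_ent[of "Suc j"]) (auto simp: ent_munit intro!: sum.cong)
  then have "(norm (munit j))\<^sup>2 = 1" by simp
  then show ?thesis by (metis norm_ge_zero one_power2 power2_eq_iff_nonneg zero_le_one)
qed

section \<open>Functional calculus for diagonalised matrices\<close>

lemma diagm_munit: "i < n \<Longrightarrow> diagm n d * munit i = cs (d i) (munit i)"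
  by (rule fmat_eqI) (auto simp: ent_diagm_times ent_cs ent_munit)

lemma conj_diag_munit:
  assumes "funitary n Q" "i < n"
  shows "Q * diagm n d * adj Q * Q * munit i = cs (d i) (Q * munit i)"
proof -
  have "Q * diagm n d * adj Q * Q * munit i = Q * (diagm n d * (adj Q * Q) * munit i)" by (simp add: mult.assoc)
  also have "\<dots> = Q * (diagm n d * munit i)"
    using assms by (simp add: funitary_def uid_right)
  finally show ?thesis using assms(2) by (simp add: diagm_munit)
qed

lemma norm_funitary_munit: "funitary n Q \<Longrightarrow> i < n \<Longrightarrow> norm (Q * munit i) = 1"
  by (simp add: norm_funitary uid_left)

lemma conj_diag_mult:
  assumes "funitary n Q"
  shows "(Q * diagm n d * adj Q) * (Q * diagm n e * adj Q) = Q * diagm n (\<lambda>i. d i * e i) * adj Q"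
proof -
  have "(Q * diagm n d * adj Q) * (Q * diagm n e * adj Q) = Q * (diagm n d * (adj Q * Q) * diagm n e) * adj Q"
    by (simp add: mult.assoc)
  then show ?thesis using assms by (simp add: funitary_def uid_right diagm_times)
qed

lemma conj_diag_adj: "adj (Q * diagm n d * adj Q) = Q * diagm n (\<lambda>i. cnj (d i)) * adj Q"
  by (simp add: adj_times adj_diagm mult.assoc)

lemma conj_diag_uid: "funitary n Q \<Longrightarrow> Q * diagm n (\<lambda>_. 1) * adj Q = uid n"
  by (simp add: funitary_def uid_right flip: uid_def)

lemma conj_diag_minus: "Q * diagm n d * adj Q - Q * diagm n e * adj Q = Q * diagm n (\<lambda>i. d i - e i) * adj Q"
  by (simp add: left_diff_distrib right_diff_distrib flip: diagm_minus)

lemma conj_diag_inject: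
  assumes "funitary n Q" "Q * diagm n d * adj Q = Q * diagm n e * adj Q" "i < n"
  shows "d i = e i"
proof -
  have "cs (d i) (Q * munit i) = cs (e i) (Q * munit i)"
    using conj_diag_munit[OF assms(1,3), of d] conj_diag_munit[OF assms(1,3), of e] assms(2) by simp
  then have "cs (d i - e i) (Q * munit i) = 0" by (simp add: cs_diff_left)
  then have "cmod (d i - e i) * norm (Q * munit i) = 0" by (metis norm_cs norm_zero)
  then show ?thesis using norm_funitary_munit[OF assms(1,3)] by simp
qed

lemma conj_diag_corner: "funitary n Q \<Longrightarrow> corner n (Q * diagm n d * adj Q)"
  by (auto simp: funitary_def intro!: corner_times)

lemma conj_diag_funitary:
  assumes "funitary n Q" "\<And>i. i < n \<Longrightarrow> cmod (d i) = 1"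
  shows "funitary n (Q * diagm n d * adj Q)"
proof -
  have e: "diagm n (\<lambda>i. cnj (d i) * d i) = diagm n (\<lambda>_. 1)" "diagm n (\<lambda>i. d i * cnj (d i)) = diagm n (\<lambda>_. 1)"
    using assms(2) by (auto intro!: fmat_eqI simp: ent_diagm mult.commute complex_norm_square[symmetric])
  show ?thesis
    unfolding funitary_def conj_diag_adj conj_diag_mult[OF assms(1)] e
    using assms(1) by (simp add: conj_diag_corner conj_diag_uid)
qed

lemma opn_conj_le:
  assumes "funitary n Q" shows "opn (Q * A * adj Q) \<le> opn A"
proof -
  have "opn (Q * A * adj Q) \<le> opn Q * opn A * opn (adj Q)"
    by (rule order_trans[OF opn_times]) (intro mult_right_mono opn_times opn_nonneg)
  also have "\<dots> \<le> 1 * opn A * 1"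
    using opn_funitary_le[OF assms] by (intro mult_mono) auto
  finally show ?thesis by simp
qed

text \<open>Moving a point \<open>t\<close> of the unit circle to the nearest point \<open>t'\<close> of the arc
  \<open>cmod (t' - 1) \<le> \<epsilon>\<close>. The quadratic bound holds uniformly in \<open>\<epsilon>\<close>, including \<open>\<epsilon> = 0\<close>.\<close>

lemma arc_retraction:
  fixes t :: complex
  assumes t: "cmod t = 1" and "0 \<le> \<epsilon>"
  shows "\<exists>t'. cmod t' = 1 \<and> cmod (t' - 1) \<le> \<epsilon> \<and> (cmod (t - t'))\<^sup>2 \<le> 2 * max 0 ((cmod (t - 1))\<^sup>2 - \<epsilon>\<^sup>2)"
proof (cases "cmod (t - 1) \<le> \<epsilon>")
  case True
  then show ?thesis using t by (intro exI[of _ t]) simp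
next
  case False
  obtain a b where ab: "t = Complex a b" by (cases t)
  have ab1: "a\<^sup>2 + b\<^sup>2 = 1" using t by (simp add: ab cmod_def)
  have d: "(cmod (t - 1))\<^sup>2 = 2 - 2 * a"
  proof -
    have "t - 1 = Complex (a - 1) b" by (simp add: ab complex_eq_iff)
    then have "(cmod (t - 1))\<^sup>2 = (a - 1)\<^sup>2 + b\<^sup>2" by (simp only: cmod_power2 complex.sel)
    then show ?thesis using ab1 by (simp add: power2_eq_square algebra_simps)
  qed
  have eps: "\<epsilon>\<^sup>2 < 2 - 2 * a" unfolding d[symmetric] using False assms(2) by (intro power_strict_mono) auto
  have "\<bar>a\<bar> \<le> 1" using ab1 by (metis abs_square_le_1 le_add_same_cancel1 zero_le_power2)
  then have a1: "- 1 \<le> a" "a \<le> 1" by auto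
  \<comment> \<open>The real part of the end points of the arc: a point of the unit circle with real
    part \<open>c\<close> has squared distance \<open>2 - 2 * c\<close> from
    \<open>1\<close>.\<close>
  define c where "c = 1 - \<epsilon>\<^sup>2 / 2"
  have c: "a < c" "c \<le> 1" using eps by (auto simp: c_def)
  then have "c\<^sup>2 \<le> 1" using a1 by (simp add: abs_square_le_1)
  \<comment> \<open>Of the two end points the one on the side of \<open>t\<close>. That
    \<open>b\<close> and \<open>e\<close> do not differ in sign is what bounds
    \<open>(e - b)\<^sup>2\<close> by \<open>\<bar>e\<^sup>2 - b\<^sup>2\<bar>\<close>.\<close>
  define e where "e = (if b \<ge> 0 then sqrt (1 - c\<^sup>2) else - sqrt (1 - c\<^sup>2))"
  have ce: "c\<^sup>2 + e\<^sup>2 = 1" using \<open>c\<^sup>2 \<le> 1\<close> by (auto simp: e_def)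
  have "0 \<le> b * e" using \<open>c\<^sup>2 \<le> 1\<close> by (auto simp: e_def mult_nonpos_nonneg)
  have "(e - b)\<^sup>2 \<le> 2 * (c - a)"
  proof -
    have "(e - b)\<^sup>2 \<le> \<bar>e\<^sup>2 - b\<^sup>2\<bar>"
    proof -
      have "\<bar>e - b\<bar> \<le> \<bar>e + b\<bar>" using \<open>0 \<le> b * e\<close> by (simp add: abs_le_square_iff power2_eq_square algebra_simps)
      then have "\<bar>e - b\<bar> * \<bar>e - b\<bar> \<le> \<bar>e - b\<bar> * \<bar>e + b\<bar>" by (intro mult_left_mono) auto
      then show ?thesis by (simp add: power2_eq_square algebra_simps flip: abs_mult)
    qed
    also have "e\<^sup>2 - b\<^sup>2 = (a - c) * (a + c)" using ab1 ce by (simp add: power2_eq_square algebra_simps)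
    also have "\<bar>(a - c) * (a + c)\<bar> \<le> (c - a) * 2"
      unfolding abs_mult using c a1 by (intro mult_mono) auto
    finally show ?thesis by simp
  qed
  moreover have "(c - a)\<^sup>2 \<le> 2 * (c - a)"
    using c a1 unfolding power2_eq_square by (intro mult_right_mono) auto
  ultimately have "(cmod (t - Complex c e))\<^sup>2 \<le> 4 * (c - a)"
    by (simp add: ab cmod_power2 power2_commute)
  also have "\<dots> = 2 * max 0 ((cmod (t - 1))\<^sup>2 - \<epsilon>\<^sup>2)"
    using eps by (simp add: d c_def max_def)
  finally have 1: "(cmod (t - Complex c e))\<^sup>2 \<le> 2 * max 0 ((cmod (t - 1))\<^sup>2 - \<epsilon>\<^sup>2)" .
  have "(cmod (Complex c e - 1))\<^sup>2 = \<epsilon>\<^sup>2"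
  proof -
    have "Complex c e - 1 = Complex (c - 1) e" by (simp add: complex_eq_iff)
    then have "(cmod (Complex c e - 1))\<^sup>2 = (c - 1)\<^sup>2 + e\<^sup>2" by (simp only: cmod_power2 complex.sel)
    also have "\<dots> = 2 - 2 * c" using ce by (simp add: power2_eq_square algebra_simps)
    finally show ?thesis by (simp add: c_def)
  qed
  then have "cmod (Complex c e - 1) = \<epsilon>" using assms(2) by (metis norm_ge_zero power2_eq_iff_nonneg)
  moreover have "cmod (Complex c e) = 1" using ce by (simp add: cmod_def)
  ultimately show ?thesis using 1 by (intro exI[of _ "Complex c e"]) auto
qed

text \<open>Instantiated by the Frobenius norm with weight \<open>1 / sqrt n\<close> along an
  ultrafilter, and by the operator norm with weight \<open>1\<close> along
  \<open>sequentially\<close>. \<open>nu_form\<close> and \<open>nu_diag\<close> turn pointwise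
  quadratic bounds into bounds for \<open>\<nu>\<close>; their right-hand side is what summing over
  unit columns and Cauchy-Schwarz give for the first norm, where \<open>\<nu> (uid n)\<close> is
  \<open>sqrt n\<close>. The weight is kept apart from \<open>\<nu>\<close> because matrices are
  compared in corners of different sizes, and \<open>w_antimono\<close> allows passing to a larger
  one.\<close>

locale ideal_norm =
  fixes \<nu> :: "fmat \<Rightarrow> real" and w :: "nat \<Rightarrow> real" and G :: "nat filter"
  assumes nu_nonneg [simp]: "0 \<le> \<nu> X"
    and nu_triangle: "\<nu> (X + Y) \<le> \<nu> X + \<nu> Y"
    and nu_left: "\<nu> (A * X) \<le> opn A * \<nu> X"
    and nu_right: "\<nu> (X * A) \<le> \<nu> X * opn A"
    and nu_adj: "\<nu> (adj X) = \<nu> X"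
    and nu_form: "\<lbrakk>0 < n; X * uid n = X; 0 \<le> c;
        \<And>Z. (norm (X * Z))\<^sup>2 \<le> c * (norm Z)\<^sup>2 + norm (E * Z) * norm Z\<rbrakk> \<Longrightarrow>
        (\<nu> X)\<^sup>2 \<le> \<nu> (uid n) * (c * \<nu> (uid n) + \<nu> E)"
    and nu_diag: "\<lbrakk>0 < n; 0 \<le> c; \<And>i. i < n \<Longrightarrow> (cmod (d i))\<^sup>2 \<le> c + norm (E * munit i)\<rbrakk> \<Longrightarrow>
        (\<nu> (diagm n d))\<^sup>2 \<le> \<nu> (uid n) * (c * \<nu> (uid n) + \<nu> E)"
    and w_nonneg [simp]: "0 \<le> w n"
    and w_antimono: "0 < m \<Longrightarrow> m \<le> n \<Longrightarrow> w n \<le> w m"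
    and w_uid: "0 < n \<Longrightarrow> w n * \<nu> (uid n) \<le> 1"
    and G_le: "G \<le> sequentially"
begin

lemma nu_zero [simp]: "\<nu> 0 = 0"
  using nu_left[of 0 0] nu_nonneg[of 0] by simp

lemma nu_left_contraction: "opn A \<le> 1 \<Longrightarrow> \<nu> (A * X) \<le> \<nu> X"
  using nu_left[of A X] mult_right_mono[of "opn A" 1 "\<nu> X"] by simp

lemma nu_right_contraction: "opn A \<le> 1 \<Longrightarrow> \<nu> (X * A) \<le> \<nu> X"
  using nu_right[of X A] mult_left_mono[of "opn A" 1 "\<nu> X"] by simp

lemma nu_cs: "\<nu> (cs c X) \<le> cmod c * \<nu> X"
proof -
  obtain n where n: "corner n X" using corner_ex by blast
  have "\<nu> (cs c X) = \<nu> (cs c (uid n) * X)" by (simp add: uid_left n)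
  also have "\<dots> \<le> opn (cs c (uid n)) * \<nu> X" by (rule nu_left)
  also have "\<dots> \<le> (cmod c * 1) * \<nu> X"
    unfolding opn_cs by (intro mult_right_mono mult_left_mono opn_uid_le) auto
  finally show ?thesis by simp
qed

lemma cs_minus_one: "cs (- 1) X = - X"
  by (rule fmat_eqI) (simp add: ent_cs ent_uminus)

lemma nu_minus: "\<nu> (X - Y) \<le> \<nu> X + \<nu> Y"
  using nu_triangle[of X "cs (-1) Y"] nu_cs[of "-1" Y] by (simp add: cs_minus_one)

lemma nu_sum: "\<nu> (\<Sum>x\<in>S. f x) \<le> (\<Sum>x\<in>S. \<nu> (f x))"
  by (induction S rule: infinite_finite_induct) (auto intro: order_trans[OF nu_triangle])

text \<open>\<open>nu_diag\<close> in an arbitrary orthonormal eigenbasis: the unitary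
  \<open>Q\<close> costs nothing on either side, and \<open>E\<close> is tested on the columns of
  \<open>Q\<close>.\<close>

lemma nu_conj_diag:
  assumes "0 < n" "funitary n Q" "0 \<le> c" "\<And>i. i < n \<Longrightarrow> (cmod (d i))\<^sup>2 \<le> c + norm (E * (Q * munit i))"
  shows "(\<nu> (Q * diagm n d * adj Q))\<^sup>2 \<le> \<nu> (uid n) * (c * \<nu> (uid n) + \<nu> E)"
proof -
  have Q: "opn Q \<le> 1" "opn (adj Q) \<le> 1" using opn_funitary_le[OF assms(2)] by auto
  have "\<nu> (Q * diagm n d * adj Q) \<le> \<nu> (diagm n d)"
    by (rule order_trans[OF nu_right_contraction[OF Q(2)] nu_left_contraction[OF Q(1)]])
  then have "(\<nu> (Q * diagm n d * adj Q))\<^sup>2 \<le> (\<nu> (diagm n d))\<^sup>2" by (intro power_mono) auto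
  also have "\<dots> \<le> \<nu> (uid n) * (c * \<nu> (uid n) + \<nu> (E * Q))"
    by (rule nu_diag[OF assms(1,3)]) (use assms(4) in \<open>simp add: mult.assoc\<close>)
  also have "\<dots> \<le> \<nu> (uid n) * (c * \<nu> (uid n) + \<nu> E)"
    by (intro mult_left_mono add_left_mono nu_right_contraction Q) auto
  finally show ?thesis .
qed

text \<open>Eigenvalues are rounded to \<open>0\<close> or \<open>1\<close>. The nearer of the two
  is at distance \<open>min \<bar>x\<bar> \<bar>1 - x\<bar>\<close>, whose square is at most
  \<open>\<bar>x * x - x\<bar>\<close>; this is the bound that \<open>nu_conj_diag\<close> takes
  with \<open>c = 0\<close>.\<close>

lemma round_projection:
  assumes "0 < n" "corner n X" "adj X = X"
  shows "\<exists>P. corner n P \<and> adj P = P \<and> P * P = P \<and> (\<nu> (P - X))\<^sup>2 \<le> \<nu> (uid n) * \<nu> (X * X - X)"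
proof -
  obtain Q d where Q: "funitary n Q" "X = Q * diagm n d * adj Q"
    using spectral_theorem[OF assms(2)] assms(3) by auto
  have "cnj (d i) = d i" if "i < n" for i
    using conj_diag_inject[OF Q(1) _ that, of "\<lambda>i. cnj (d i)" d] assms(3) by (simp add: Q(2) conj_diag_adj)
  then have re: "d i = of_real (Re (d i))" if "i < n" for i
    using that by (metis Reals_cnj_iff of_real_Re)
  define r where "r i = (if Re (d i) \<ge> 1/2 then 1 else 0 :: complex)" for i
  have rr: "(\<lambda>i. r i * r i) = r" "(\<lambda>i. cnj (r i)) = r" by (auto simp: r_def)
  define P where "P = Q * diagm n r * adj Q"
  have "(\<nu> (P - X))\<^sup>2 \<le> \<nu> (uid n) * (0 * \<nu> (uid n) + \<nu> (X * X - X))"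
    unfolding P_def Q(2) conj_diag_minus
  proof (rule nu_conj_diag[OF assms(1) Q(1)])
    fix i assume i: "i < n"
    define x where "x = Re (d i)"
    have x: "d i = of_real x" using re[OF i] by (simp add: x_def)
    have "norm ((X * X - X) * (Q * munit i)) = norm (cs (d i * d i - d i) (Q * munit i))"
      unfolding Q(2) conj_diag_mult[OF Q(1)] conj_diag_minus
      using conj_diag_munit[OF Q(1) i, of "\<lambda>i. d i * d i - d i"] by (simp add: mult.assoc)
    then have "norm ((X * X - X) * (Q * munit i)) = \<bar>x * x - x\<bar>"
      using norm_funitary_munit[OF Q(1) i] by (simp add: norm_cs x norm_of_real flip: of_real_mult of_real_diff)
    moreover have "(cmod (r i - d i))\<^sup>2 \<le> \<bar>x * x - x\<bar>"
    proof -
      have x2: "\<bar>x * x - x\<bar> = \<bar>x\<bar> * \<bar>1 - x\<bar>"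
        by (metis abs_minus_commute abs_mult mult.right_neutral right_diff_distrib)
      show ?thesis
      proof (cases "x \<ge> 1/2")
        case True
        then have "r i - d i = of_real (1 - x)" by (simp add: r_def x)
        then have "(cmod (r i - d i))\<^sup>2 = \<bar>1 - x\<bar> * \<bar>1 - x\<bar>" by (metis norm_of_real power2_eq_square)
        then show ?thesis unfolding x2 using True by (simp only:) (intro mult_right_mono, auto)
      next
        case False
        then have "(cmod (r i - d i))\<^sup>2 = \<bar>x\<bar> * \<bar>x\<bar>" by (simp add: r_def x power2_eq_square)
        then show ?thesis unfolding x2 using False by (simp only:) (intro mult_left_mono, auto)
      qed
    qed
    ultimately show "(cmod (r i - d i))\<^sup>2 \<le> 0 + norm ((Q * diagm n d * adj Q * (Q * diagm n d * adj Q) - Q * diagm n d * adj Q) * (Q * munit i))"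
      by (simp add: Q(2))
  qed simp
  moreover have "adj P = P" "P * P = P" "corner n P"
    by (simp_all add: P_def conj_diag_adj conj_diag_mult[OF Q(1)] rr conj_diag_corner[OF Q(1)])
  ultimately show ?thesis by auto
qed

text \<open>The characteristic polynomial has finitely many roots, so some arbitrarily small
  \<open>s\<close> avoids them. The aim is an injective matrix, whose polar decomposition has a
  unitary part without any completion of a partial isometry. Injectivity is phrased on
  columns.\<close>

lemma regular_perturbation:
  assumes X: "corner n X" and "0 < \<eta>"
  shows "\<exists>s>0. s < \<eta> \<and> (\<forall>q i. corner n q \<longrightarrow> q * munit i = q \<longrightarrow> (X + cs (of_real s) (uid n)) * q = 0 \<longrightarrow> q = 0)"
proof -
  let ?A = "tomat n n X"
  have A: "?A \<in> carrier_mat n n" by simp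
  have "char_poly ?A \<noteq> 0" using degree_monic_char_poly[OF A] by auto
  then have "finite {z. poly (char_poly ?A) z = 0}" by (rule poly_roots_finite)
  moreover have "inj_on (\<lambda>s. - complex_of_real s) {0<..<\<eta>}" by (auto simp: inj_on_def)
  ultimately have "\<not> (\<lambda>s. - complex_of_real s) ` {0<..<\<eta>} \<subseteq> {z. poly (char_poly ?A) z = 0}"
    using finite_imageD infinite_Ioo[OF assms(2)] by (metis finite_subset)
  then obtain s where "s \<in> {0<..<\<eta>}" "- complex_of_real s \<notin> {z. poly (char_poly ?A) z = 0}" by blast
  then have s: "0 < s" "s < \<eta>" "poly (char_poly ?A) (- of_real s) \<noteq> 0" by auto
  have "q = 0" if q: "corner n q" "q * munit i = q" "(X + cs (of_real s) (uid n)) * q = 0" for q i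
  proof (rule ccontr)
    assume "q \<noteq> 0"
    define v where "v = vec n (\<lambda>j. ent q j i)"
    have v: "v \<in> carrier_vec n" by (simp add: v_def)
    have qv: "q = colm i v"
    proof (rule fmat_eqI)
      fix a b
      have "ent q a b = (if b = i then ent q a i else 0)" using colm_times_munit[of q i a b] q(2) by simp
      then show "ent q a b = ent (colm i v) a b" using corner_zero[OF q(1), of a i] by (auto simp: ent_colm v_def)
    qed
    have "colm i (?A *\<^sub>v v) = X * q"
      unfolding emb_times_colm[OF A v, symmetric] emb_tomat[OF X] qv[symmetric] ..
    also have "\<dots> = cs (- of_real s) q"
    proof -
      have "X * q = - cs (of_real s) q"
        using q(3) by (simp add: distrib_right uid_left[OF q(1)] eq_neg_iff_add_eq_0)
      also have "\<dots> = cs (- of_real s) q" by (rule fmat_eqI) (simp add: ent_cs ent_uminus)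
      finally show ?thesis .
    qed
    also have "\<dots> = colm i ((- of_real s) \<cdot>\<^sub>v v)"
      unfolding qv by (rule fmat_eqI) (simp add: ent_cs ent_colm)
    finally have e: "ent (colm i (?A *\<^sub>v v)) a i = ent (colm i ((- of_real s) \<cdot>\<^sub>v v)) a i" for a by simp
    have "?A *\<^sub>v v = (- of_real s) \<cdot>\<^sub>v v"
    proof (rule eq_vecI)
      show "(?A *\<^sub>v v) $ a = ((- of_real s) \<cdot>\<^sub>v v) $ a" if "a < dim_vec ((- of_real s) \<cdot>\<^sub>v v)" for a
        using e[of a] that v by (simp add: ent_colm carrier_matD[OF A])
    qed (use v A in \<open>simp add: carrier_matD[OF A]\<close>)
    moreover have "v \<noteq> 0\<^sub>v n"
    proof
      assume "v = 0\<^sub>v n"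
      then have "q = 0" unfolding qv by (intro fmat_eqI) (simp add: ent_colm ent_zero)
      with \<open>q \<noteq> 0\<close> show False ..
    qed
    ultimately have "eigenvalue ?A (- of_real s)"
      using v unfolding eigenvalue_def eigenvector_def by (auto simp: carrier_matD[OF A])
    then show False using s(3) eigenvalue_root_char_poly[OF A] by simp
  qed
  then show ?thesis using s by blast
qed

text \<open>\<open>W\<close> is the unitary part of the polar decomposition of \<open>X\<close>. The
  distance is governed by \<open>(sqrt \<sigma> - 1)\<^sup>2 \<le> \<bar>\<sigma> - 1\<bar>\<close>
  for the eigenvalues \<open>\<sigma>\<close> of \<open>adj X * X\<close>.\<close>

lemma near_unitary:
  assumes "0 < n" and X: "corner n X"
    and inj: "\<And>q i. corner n q \<Longrightarrow> q * munit i = q \<Longrightarrow> X * q = 0 \<Longrightarrow> q = 0"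
  shows "\<exists>W. funitary n W \<and> (\<nu> (X - W))\<^sup>2 \<le> \<nu> (uid n) * \<nu> (adj X * X - uid n)"
proof -
  have cXX: "corner n (adj X * X)" using X by (simp add: corner_times)
  obtain Q d where Q: "funitary n Q" "adj X * X = Q * diagm n d * adj Q"
    using spectral_theorem[OF cXX] by (auto simp: adj_times)
  have cQ: "corner n Q" and QQ: "adj Q * Q = uid n" using Q(1) by (auto simp: funitary_def)
  \<comment> \<open>The eigenvalue is read off as a squared length, which shows that it is real and,
    \<open>X\<close> being injective, positive.\<close>
  define \<sigma> where "\<sigma> i = (norm (X * (Q * munit i)))\<^sup>2" for i
  have d: "d i = of_real (\<sigma> i)" and pos: "0 < \<sigma> i" if i: "i < n" for i
  proof -
    have "adj (X * (Q * munit i)) * (X * (Q * munit i)) = munit i * adj Q * ((adj X * X) * Q * munit i)"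
      by (simp add: adj_times mult.assoc)
    also have "\<dots> = cs (d i) (munit i * (adj Q * Q * munit i))"
      unfolding Q(2) conj_diag_munit[OF Q(1) i] by (simp add: mult.assoc)
    finally have 1: "adj (X * (Q * munit i)) * (X * (Q * munit i)) = cs (d i) (munit i)"
      unfolding QQ using i by (simp add: uid_left)
    have "adj (X * (Q * munit i)) * (X * (Q * munit i)) = cs (of_real (\<sigma> i)) (munit i)"
      unfolding \<sigma>_def by (rule column_gram) (simp add: mult.assoc)
    with 1 have "cs (d i) (munit i) = cs (of_real (\<sigma> i)) (munit i)" by simp
    from arg_cong[OF this, of "\<lambda>M. ent M i i"] show "d i = of_real (\<sigma> i)" by (simp add: ent_cs ent_munit)
    have "X * (Q * munit i) \<noteq> 0"
    proof
      assume "X * (Q * munit i) = 0"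
      then have "Q * munit i = 0"
        using i cQ by (intro inj[of "Q * munit i" i]) (simp_all add: corner_times mult.assoc)
      then show False using norm_funitary_munit[OF Q(1) i] by simp
    qed
    then show "0 < \<sigma> i" by (simp add: \<sigma>_def)
  qed
  \<comment> \<open>\<open>H\<close> is the inverse of the square root of
    \<open>adj X * X\<close>.\<close>
  define h where "h i = complex_of_real (1 / sqrt (\<sigma> i))" for i
  define H where "H = Q * diagm n h * adj Q"
  define W where "W = X * H"
  have cH: "corner n H" by (simp add: H_def conj_diag_corner[OF Q(1)])
  have cW: "corner n W" by (simp add: W_def corner_times X cH)
  have "(\<lambda>i. cnj (h i)) = h" by (simp add: h_def fun_eq_iff)
  then have adjH: "adj H = H" by (simp add: H_def conj_diag_adj)
  have "adj W * W = H * (adj X * X) * H" by (simp add: W_def adj_times adjH mult.assoc)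
  also have "\<dots> = Q * diagm n (\<lambda>i. h i * d i * h i) * adj Q"
    unfolding Q(2) by (simp add: H_def conj_diag_mult[OF Q(1)])
  also have "diagm n (\<lambda>i. h i * d i * h i) = diagm n (\<lambda>_. 1)"
  proof -
    have "h i * d i * h i = 1" if "i < n" for i
    proof -
      have "h i * d i * h i = of_real (1 / sqrt (\<sigma> i) * \<sigma> i * (1 / sqrt (\<sigma> i)))"
        by (simp only: h_def d[OF that] of_real_mult)
      also have "1 / sqrt (\<sigma> i) * \<sigma> i * (1 / sqrt (\<sigma> i)) = 1"
        using pos[OF that] by (simp add: field_simps)
      finally show ?thesis by simp
    qed
    then show ?thesis by (intro fmat_eqI) (simp add: ent_diagm)
  qed
  finally have WW: "adj W * W = uid n" by (simp add: conj_diag_uid[OF Q(1)])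
  have W: "funitary n W"
    unfolding funitary_def using WW cW left_inverse_right_inverse[OF _ cW WW] by simp
  \<comment> \<open>\<open>X\<close> is \<open>W\<close> times the square root of
    \<open>adj X * X\<close>, so \<open>X - W\<close> is \<open>W\<close> times that square root
    minus the unit.\<close>
  define g where "g i = complex_of_real (sqrt (\<sigma> i) - 1)" for i
  have XW: "X - W = W * (Q * diagm n g * adj Q)"
  proof -
    have "W * (Q * diagm n g * adj Q) = X * (Q * diagm n (\<lambda>i. h i * g i) * adj Q)"
      unfolding W_def H_def conj_diag_mult[OF Q(1), symmetric] by (simp add: mult.assoc)
    also have "diagm n (\<lambda>i. h i * g i) = diagm n (\<lambda>i. 1 - h i)"
    proof -
      have "h i * g i = 1 - h i" if "i < n" for i
        using pos[OF that] by (simp add: h_def g_def field_simps)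
      then show ?thesis by (intro fmat_eqI) (simp add: ent_diagm)
    qed
    also have "X * (Q * diagm n (\<lambda>i. 1 - h i) * adj Q) = X * uid n - X * H"
      unfolding conj_diag_minus[symmetric] by (simp add: right_diff_distrib conj_diag_uid[OF Q(1)] H_def)
    finally show ?thesis using X by (simp add: uid_right W_def)
  qed
  have "(\<nu> (X - W))\<^sup>2 \<le> (\<nu> (Q * diagm n g * adj Q))\<^sup>2"
    unfolding XW by (intro power_mono nu_left_contraction opn_funitary_le[OF W]) simp
  also have "\<dots> \<le> \<nu> (uid n) * (0 * \<nu> (uid n) + \<nu> (adj X * X - uid n))"
  proof (rule nu_conj_diag[OF assms(1) Q(1)])
    fix i assume i: "i < n"
    have "(adj X * X - uid n) * (Q * munit i) = cs (of_real (\<sigma> i) - 1) (Q * munit i)"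
      using conj_diag_munit[OF Q(1) i, of d] i cQ unfolding Q(2)
      by (simp add: left_diff_distrib mult.assoc d cs_diff_left uid_left corner_times)
    then have "norm ((adj X * X - uid n) * (Q * munit i)) = \<bar>\<sigma> i - 1\<bar>"
      using norm_funitary_munit[OF Q(1) i] by (simp add: norm_cs) (metis norm_of_real of_real_1 of_real_diff)
    moreover have "(cmod (g i))\<^sup>2 \<le> \<bar>\<sigma> i - 1\<bar>"
    proof -
      define x where "x = sqrt (\<sigma> i)"
      have x: "0 < x" "\<sigma> i = x * x" using pos[OF i] by (auto simp: x_def)
      have "\<bar>x - 1\<bar> * \<bar>x - 1\<bar> \<le> \<bar>x - 1\<bar> * \<bar>x + 1\<bar>" using x by (intro mult_left_mono) auto
      moreover have "\<bar>x - 1\<bar> * \<bar>x + 1\<bar> = \<bar>x * x - 1\<bar>"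
        unfolding abs_mult[symmetric] by (simp add: algebra_simps)
      moreover have "(cmod (g i))\<^sup>2 = \<bar>x - 1\<bar> * \<bar>x - 1\<bar>"
        unfolding g_def x_def by (simp only: norm_of_real power2_eq_square)
      ultimately show ?thesis using x(2) by simp
    qed
    ultimately show "(cmod (g i))\<^sup>2 \<le> 0 + norm ((adj X * X - uid n) * (Q * munit i))" by simp
  qed simp
  finally show ?thesis using W by auto
qed

text \<open>The eigenvalues of \<open>T\<close> are moved into the arc by
  \<open>arc_retraction\<close>. \<open>T'\<close> is fixed before \<open>c\<close>,
  \<open>B\<close> and \<open>E\<close> are quantified: the same \<open>T'\<close> has to be
  estimated with many constants, since the commutator is dominated only by those strictly above
  \<epsilon>.\<close>

lemma unitary_retraction:
  assumes "0 < n" and T: "funitary n T" and "0 \<le> \<epsilon>"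
  shows "\<exists>T'. funitary n T' \<and> opn (T' - uid n) \<le> \<epsilon> \<and>
    (\<forall>c B E. \<epsilon> \<le> c \<longrightarrow> posm B \<longrightarrow>
      adj (T - uid n) * (T - uid n) + B = cs (of_real (c\<^sup>2)) (uid n) + E \<longrightarrow>
      (\<nu> (T - T'))\<^sup>2 \<le> \<nu> (uid n) * (2 * (c\<^sup>2 - \<epsilon>\<^sup>2) * \<nu> (uid n) + 2 * \<nu> E))"
proof -
  have cT: "corner n T" and TT: "adj T * T = uid n" "adj T * T = T * adj T" using T by (auto simp: funitary_def)
  obtain Q t where Q: "funitary n Q" "T = Q * diagm n t * adj Q"
    using spectral_theorem[OF cT TT(2)] by auto
  have t1: "cmod (t i) = 1" if i: "i < n" for i
  proof -
    have "cnj (t i) * t i = 1"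
      using TT(1) conj_diag_inject[OF Q(1) _ i, of "\<lambda>i. cnj (t i) * t i" "\<lambda>_. 1"]
      by (simp add: Q(2) conj_diag_adj conj_diag_mult[OF Q(1)] conj_diag_uid[OF Q(1)])
    then have "of_real ((cmod (t i))\<^sup>2) = (1::complex)" unfolding complex_norm_square by (simp add: mult.commute)
    then have "(cmod (t i))\<^sup>2 = 1" by (metis of_real_eq_1_iff)
    then show ?thesis by (metis norm_ge_zero one_power2 power2_eq_iff_nonneg zero_le_one)
  qed
  obtain t' where t': "\<And>i. i < n \<Longrightarrow> cmod (t' i) = 1" "\<And>i. i < n \<Longrightarrow> cmod (t' i - 1) \<le> \<epsilon>"
    "\<And>i. i < n \<Longrightarrow> (cmod (t i - t' i))\<^sup>2 \<le> 2 * max 0 ((cmod (t i - 1))\<^sup>2 - \<epsilon>\<^sup>2)"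
    using arc_retraction[OF t1 assms(3)] by metis
  define T' where "T' = Q * diagm n t' * adj Q"
  have uT': "funitary n T'" unfolding T'_def by (rule conj_diag_funitary[OF Q(1) t'(1)])
  have "T' - uid n = Q * diagm n (\<lambda>i. t' i - 1) * adj Q"
    unfolding T'_def conj_diag_minus[symmetric] by (simp add: conj_diag_uid[OF Q(1)])
  then have "opn (T' - uid n) \<le> opn (diagm n (\<lambda>i. t' i - 1))" by (simp add: opn_conj_le[OF Q(1)])
  also have "\<dots> \<le> \<epsilon>" using t'(2) assms(3) by (rule opn_diagm_le)
  finally have 1: "opn (T' - uid n) \<le> \<epsilon>" .
  have "(\<nu> (T - T'))\<^sup>2 \<le> \<nu> (uid n) * (2 * (c\<^sup>2 - \<epsilon>\<^sup>2) * \<nu> (uid n) + 2 * \<nu> E)"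
    if c: "\<epsilon> \<le> c" and B: "posm B" and eq: "adj (T - uid n) * (T - uid n) + B = cs (of_real (c\<^sup>2)) (uid n) + E" for c B E
  proof -
    have c2: "0 \<le> c\<^sup>2 - \<epsilon>\<^sup>2" using c assms(3) by (simp add: power_mono)
    \<comment> \<open>The factor in \<open>cs 2 E\<close> is the \<open>2\<close> of
      \<open>arc_retraction\<close>.\<close>
    have "(\<nu> (T - T'))\<^sup>2 \<le> \<nu> (uid n) * (2 * (c\<^sup>2 - \<epsilon>\<^sup>2) * \<nu> (uid n) + \<nu> (cs 2 E))"
      unfolding T'_def Q(2) conj_diag_minus
    proof (rule nu_conj_diag[OF assms(1) Q(1)])
      fix i assume i: "i < n"
      let ?q = "Q * munit i"
      have q1: "norm ?q = 1" by (rule norm_funitary_munit[OF Q(1) i])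
      have uq: "uid n * ?q = ?q" using Q(1) i by (simp add: funitary_def uid_left corner_times)
      have "(T - uid n) * ?q = cs (t i - 1) ?q"
        using conj_diag_munit[OF Q(1) i, of t] unfolding Q(2)
        by (simp add: left_diff_distrib mult.assoc cs_diff_left uq)
      then have "(cmod (t i - 1))\<^sup>2 = (norm ((T - uid n) * ?q))\<^sup>2" by (simp add: norm_cs q1)
      also have "\<dots> = inner ?q ((adj (T - uid n) * (T - uid n)) * ?q)"
        by (simp add: norm_sq_fmat inner_times_left mult.assoc)
      \<comment> \<open>Tested on a unit eigenvector and with the positive summand \<open>B\<close>
        dropped, the relation bounds the distance of the eigenvalue from \<open>1\<close>.\<close>
      also have "adj (T - uid n) * (T - uid n) = cs (of_real (c\<^sup>2)) (uid n) + E - B" using eq by (simp add: eq_diff_eq)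
      also have "inner ?q ((cs (of_real (c\<^sup>2)) (uid n) + E - B) * ?q) =
          c\<^sup>2 * inner ?q ?q + inner ?q (E * ?q) - inner ?q (B * ?q)"
      proof -
        have "(cs (of_real (c\<^sup>2)) (uid n) + E - B) * ?q = scaleR (c\<^sup>2) ?q + E * ?q - B * ?q"
          by (simp add: distrib_right left_diff_distrib uq scaleR_cs)
        then show ?thesis by (simp only: inner_add_right inner_diff_right inner_scaleR_right)
      qed
      also have "\<dots> \<le> c\<^sup>2 + norm (E * ?q)"
      proof -
        have "0 \<le> inner ?q (B * ?q)" using B by (simp add: posm_def)
        moreover have "inner ?q (E * ?q) \<le> norm (E * ?q)"
          using norm_cauchy_schwarz[of ?q "E * ?q"] by (simp only: q1 mult_1)
        moreover have "inner ?q ?q = 1" unfolding norm_sq_fmat[symmetric] q1 by simp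
        ultimately show ?thesis by simp
      qed
      finally have "(cmod (t i - 1))\<^sup>2 \<le> c\<^sup>2 + norm (E * ?q)" .
      then have "(cmod (t i - t' i))\<^sup>2 \<le> 2 * (c\<^sup>2 - \<epsilon>\<^sup>2) + 2 * norm (E * ?q)"
        using t'(3)[OF i] c2 norm_ge_zero[of "E * ?q"] by (auto simp: max_def split: if_splits)
      then show "(cmod (t i - t' i))\<^sup>2 \<le> 2 * (c\<^sup>2 - \<epsilon>\<^sup>2) + norm (cs 2 E * ?q)"
        by (simp add: norm_cs)
    qed (use c2 in simp)
    also have "\<dots> \<le> \<nu> (uid n) * (2 * (c\<^sup>2 - \<epsilon>\<^sup>2) * \<nu> (uid n) + 2 * \<nu> E)"
      using nu_cs[of 2 E] by (intro mult_left_mono add_left_mono) auto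
    finally show ?thesis .
  qed
  then show ?thesis using uT' 1 by blast
qed

end

section \<open>Null sequences and lifting\<close>

text \<open>Sums, products and zero of sequences are the pointwise ones on functions, so sequences
  already form a ring; adjoints, scalars and units are added here.\<close>

definition sadj :: "(nat \<Rightarrow> fmat) \<Rightarrow> nat \<Rightarrow> fmat" where "sadj X = (\<lambda>n. adj (X n))"
definition scs :: "complex \<Rightarrow> (nat \<Rightarrow> fmat) \<Rightarrow> nat \<Rightarrow> fmat" where "scs c X = (\<lambda>n. cs c (X n))"
definition suid :: "(nat \<Rightarrow> nat) \<Rightarrow> nat \<Rightarrow> fmat" where "suid k = (\<lambda>n. uid (k n))"

lemma seq_sel:
  "(X + Y) n = X n + Y n" "(X - Y) n = X n - Y n" "(X * Y) n = X n * Y n" "(- X) n = - X n" "(0 :: nat \<Rightarrow> fmat) n = 0"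
  "sadj X n = adj (X n)" "scs c X n = cs c (X n)" "suid k n = uid (k n)"
  by (simp_all add: sadj_def scs_def suid_def)

lemma sadj_simps [simp]:
  "sadj (X + Y) = sadj X + sadj Y" "sadj (X - Y) = sadj X - sadj Y" "sadj (X * Y) = sadj Y * sadj X"
  "sadj (sadj X) = X" "sadj (scs c X) = scs (cnj c) (sadj X)" "sadj (suid k) = suid k"
  by (auto simp: fun_eq_iff seq_sel adj_simps)

lemma scs_simps [simp]:
  "scs c X * Y = scs c (X * Y)" "X * scs c Y = scs c (X * Y)" "scs c (scs d X) = scs (c * d) X" "scs 1 X = X"
  by (auto simp: fun_eq_iff seq_sel)

lemma scs_add: "scs c (X + Y) = scs c X + scs c Y"
  by (auto simp: fun_eq_iff seq_sel cs_add)
lemma scs_diff: "scs c (X - Y) = scs c X - scs c Y"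
  by (auto simp: fun_eq_iff seq_sel cs_diff)
lemma scs_minus_one: "scs (- 1) X = - X"
  by (auto simp: fun_eq_iff seq_sel intro!: fmat_eqI simp: ent_cs ent_uminus)

definition scorner :: "(nat \<Rightarrow> nat) \<Rightarrow> (nat \<Rightarrow> fmat) \<Rightarrow> bool" where
  "scorner k X \<longleftrightarrow> (\<forall>n. corner (k n) (X n))"
definition sunitary :: "(nat \<Rightarrow> nat) \<Rightarrow> (nat \<Rightarrow> fmat) \<Rightarrow> bool" where
  "sunitary k X \<longleftrightarrow> (\<forall>n. funitary (k n) (X n))"
definition bdd :: "(nat \<Rightarrow> fmat) \<Rightarrow> bool" where
  "bdd X \<longleftrightarrow> (\<exists>c. \<forall>n. opn (X n) \<le> c)"

lemma suid_left: "scorner k X \<Longrightarrow> suid k * X = X" and suid_right: "scorner k X \<Longrightarrow> X * suid k = X"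
  by (auto simp: scorner_def fun_eq_iff seq_sel uid_left uid_right)

lemma scorner_intros [intro]:
  "scorner k X \<Longrightarrow> scorner k Y \<Longrightarrow> scorner k (X + Y)"
  "scorner k X \<Longrightarrow> scorner k Y \<Longrightarrow> scorner k (X - Y)"
  "scorner k X \<Longrightarrow> scorner k Y \<Longrightarrow> scorner k (X * Y)"
  "scorner k X \<Longrightarrow> scorner k (sadj X)" "scorner k X \<Longrightarrow> scorner k (scs c X)" "scorner k (suid k)"
  by (auto simp: scorner_def seq_sel corner_plus corner_minus corner_times corner_cs)

lemma sunitaryD:
  assumes "sunitary k X"
  shows "scorner k X" "sadj X * X = suid k" "X * sadj X = suid k" "bdd X" "bdd (sadj X)"
proof -
  show "scorner k X" "sadj X * X = suid k" "X * sadj X = suid k"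
    using assms by (auto simp: sunitary_def scorner_def fun_eq_iff seq_sel funitary_def)
  show "bdd X" "bdd (sadj X)"
    using assms by (auto simp: sunitary_def bdd_def seq_sel intro!: exI[of _ 1] opn_funitary_le)
qed

lemma sunitary_times: "sunitary k X \<Longrightarrow> sunitary k Y \<Longrightarrow> sunitary k (X * Y)"
  by (simp add: sunitary_def seq_sel funitary_times)
lemma sunitary_sadj: "sunitary k X \<Longrightarrow> sunitary k (sadj X)"
  by (simp add: sunitary_def seq_sel funitary_adj)

lemma bdd_intros [intro]:
  assumes "bdd X" "bdd Y"
  shows "bdd (X + Y)" "bdd (X - Y)" "bdd (X * Y)"
proof -
  obtain c d where c: "\<And>n. opn (X n) \<le> c" and d: "\<And>n. opn (Y n) \<le> d"
    using assms unfolding bdd_def by blast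
  show "bdd (X + Y)" unfolding bdd_def seq_sel
    by (intro exI[of _ "c + d"] allI order_trans[OF opn_triangle] add_mono c d)
  show "bdd (X - Y)" unfolding bdd_def seq_sel
    by (intro exI[of _ "c + d"] allI order_trans[OF opn_minus] add_mono c d)
  have "0 \<le> c" using c order_trans opn_nonneg by blast
  then show "bdd (X * Y)" unfolding bdd_def seq_sel
    by (intro exI[of _ "c * d"] allI order_trans[OF opn_times] mult_mono c d) auto
qed

lemma bdd_sadj [intro]: "bdd X \<Longrightarrow> bdd (sadj X)"
  by (simp add: bdd_def seq_sel)
lemma bdd_scs [intro]: "bdd X \<Longrightarrow> bdd (scs c X)"
  unfolding bdd_def seq_sel opn_cs by (meson mult_left_mono norm_ge_zero)
lemma bdd_suid [intro]: "bdd (suid k)"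
  unfolding bdd_def seq_sel by (auto intro!: exI[of _ 1] opn_uid_le)

section \<open>Null sequences and closeness modulo them\<close>

context ideal_norm
begin

text \<open>The weight is taken at \<open>k\<close>, not at the size of \<open>X n\<close>. The
  relation is also used for matrices with \<open>k n\<close> columns and possibly many more rows,
  such as \<open>U' * J - J * U\<close>, and only the size of the source enters their
  estimates.\<close>

definition null :: "(nat \<Rightarrow> nat) \<Rightarrow> (nat \<Rightarrow> fmat) \<Rightarrow> bool" where
  "null k X \<longleftrightarrow> ((\<lambda>n. w (k n) * \<nu> (X n)) \<longlongrightarrow> 0) G"

lemma null_sandwich:
  assumes "\<And>n. w (k n) * \<nu> (X n) \<le> f n" "(f \<longlongrightarrow> 0) G"
  shows "null k X"
  unfolding null_def
  by (rule tendsto_sandwich[of "\<lambda>_. 0" _ _ f]) (use assms in auto)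

lemma null_bound:
  assumes "null k Y" "\<And>n. \<nu> (X n) \<le> c * \<nu> (Y n)"
  shows "null k X"
proof (rule null_sandwich)
  show "w (k n) * \<nu> (X n) \<le> c * (w (k n) * \<nu> (Y n))" for n
    using mult_left_mono[OF assms(2)[of n] w_nonneg[of "k n"]] by (simp add: mult_ac)
  show "((\<lambda>n. c * (w (k n) * \<nu> (Y n))) \<longlongrightarrow> 0) G"
    using tendsto_mult_right_zero[OF assms(1)[unfolded null_def]] .
qed

lemma null_zero [simp]: "null k 0"
  by (simp add: null_def)

lemma null_add: "null k X \<Longrightarrow> null k Y \<Longrightarrow> null k (X + Y)"
proof -
  assume "null k X" "null k Y"
  then have "((\<lambda>n. w (k n) * \<nu> (X n) + w (k n) * \<nu> (Y n)) \<longlongrightarrow> 0) G"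
    unfolding null_def by (rule tendsto_add_zero)
  then show ?thesis
    by (rule null_sandwich[rotated]) (auto simp: seq_sel simp flip: distrib_left intro!: mult_left_mono nu_triangle)
qed

lemma null_scs: "null k X \<Longrightarrow> null k (scs c X)"
  by (rule null_bound[where c = "cmod c"]) (auto simp: seq_sel nu_cs)

lemma null_uminus: "null k X \<Longrightarrow> null k (- X)"
  using null_scs[of k X "-1"] by (simp add: scs_minus_one)

lemma null_diff: "null k X \<Longrightarrow> null k Y \<Longrightarrow> null k (X - Y)"
  using null_add[of k X "- Y"] null_uminus[of k Y] by simp

lemma null_left: "bdd A \<Longrightarrow> null k X \<Longrightarrow> null k (A * X)"
proof -
  assume "bdd A" "null k X"
  then obtain c where c: "\<And>n. opn (A n) \<le> c" unfolding bdd_def by blast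
  show ?thesis using \<open>null k X\<close>
    by (rule null_bound[where c = c])
       (auto simp: seq_sel intro!: order_trans[OF nu_left] mult_right_mono c)
qed

lemma null_right: "bdd A \<Longrightarrow> null k X \<Longrightarrow> null k (X * A)"
proof -
  assume "bdd A" "null k X"
  then obtain c where c: "\<And>n. opn (A n) \<le> c" unfolding bdd_def by blast
  show ?thesis using \<open>null k X\<close>
    by (rule null_bound[where c = c])
       (auto simp: seq_sel mult.commute[of c] intro!: order_trans[OF nu_right] mult_left_mono c)
qed

lemma null_sadj: "null k X \<Longrightarrow> null k (sadj X)"
  by (simp add: null_def seq_sel nu_adj)

text \<open>Weights decrease with the size, so an error that is negligible at size \<open>k\<close>
  stays negligible inside a larger block matrix. This is what permits arbitrarily large
  complements.\<close>

lemma null_antimono: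
  assumes "null k X" "\<And>n. 0 < k n" "\<And>n. k n \<le> m n"
  shows "null m X"
  by (rule null_sandwich[OF _ assms(1)[unfolded null_def]]) (intro mult_right_mono w_antimono assms nu_nonneg)

lemma null_small:
  assumes "\<And>\<delta>. 0 < \<delta> \<Longrightarrow> \<forall>\<^sub>F n in G. w (k n) * \<nu> (X n) \<le> \<delta>"
  shows "null k X"
  unfolding null_def
proof (rule tendstoI)
  fix e :: real assume "0 < e"
  then have "\<forall>\<^sub>F n in G. w (k n) * \<nu> (X n) \<le> e/2" using assms[of "e/2"] by simp
  then show "\<forall>\<^sub>F n in G. dist (w (k n) * \<nu> (X n)) 0 < e"
    using \<open>0 < e\<close> by (elim eventually_mono) (auto simp: abs_of_nonneg)
qed

lemma null_smallD:
  assumes "null k X" "0 < \<delta>"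
  shows "\<forall>\<^sub>F n in G. w (k n) * \<nu> (X n) < \<delta>"
  using order_tendstoD(2)[OF assms(1)[unfolded null_def] assms(2)] .

text \<open>The shape of the bounds delivered by functional calculus. After multiplication by the
  squared weight, the factors \<open>\<nu> (uid (k n))\<close> are absorbed by \<open>w_uid\<close>.
  \<open>E\<close> may depend on \<delta>, as it does in \<open>retraction_lift\<close>.\<close>

lemma null_sqrtI:
  assumes k: "\<And>n. 0 < k n"
    and "\<And>\<delta>. 0 < \<delta> \<Longrightarrow> \<exists>E. null k E \<and> (\<forall>n. (\<nu> (X n))\<^sup>2 \<le> \<nu> (uid (k n)) * (\<delta> * \<nu> (uid (k n)) + 2 * \<nu> (E n)))"
  shows "null k X"
proof (rule null_small)
  fix \<delta> :: real assume "0 < \<delta>"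
  \<comment> \<open>Half of \<open>\<delta>\<^sup>2\<close> goes to the constant term, the other
    half to twice the error.\<close>
  then have "0 < \<delta>\<^sup>2 / 2" by simp
  then obtain E where E: "null k E" "\<And>n. (\<nu> (X n))\<^sup>2 \<le> \<nu> (uid (k n)) * (\<delta>\<^sup>2 / 2 * \<nu> (uid (k n)) + 2 * \<nu> (E n))"
    using assms(2) by blast
  have *: "(w (k n) * \<nu> (X n))\<^sup>2 \<le> \<delta>\<^sup>2 / 2 + 2 * (w (k n) * \<nu> (E n))" for n
  proof -
    let ?o = "w (k n) * \<nu> (uid (k n))"
    have o: "0 \<le> ?o" "?o \<le> 1" using w_uid[OF k] by auto
    have "(w (k n) * \<nu> (X n))\<^sup>2 \<le> (w (k n))\<^sup>2 * (\<nu> (uid (k n)) * (\<delta>\<^sup>2 / 2 * \<nu> (uid (k n)) + 2 * \<nu> (E n)))"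
      unfolding power_mult_distrib by (intro mult_left_mono E) simp
    also have "\<dots> = ?o * (\<delta>\<^sup>2 / 2 * ?o + 2 * (w (k n) * \<nu> (E n)))"
      by (simp add: power2_eq_square algebra_simps)
    also have "\<dots> \<le> 1 * (\<delta>\<^sup>2 / 2 * 1 + 2 * (w (k n) * \<nu> (E n)))"
      using o by (intro mult_mono add_mono mult_left_mono) auto
    finally show ?thesis by simp
  qed
  have "\<forall>\<^sub>F n in G. w (k n) * \<nu> (E n) < \<delta>\<^sup>2 / 4" using null_smallD[OF E(1), of "\<delta>\<^sup>2 / 4"] \<open>0 < \<delta>\<close> by simp
  then show "\<forall>\<^sub>F n in G. w (k n) * \<nu> (X n) \<le> \<delta>"
  proof (rule eventually_mono)
    fix n assume "w (k n) * \<nu> (E n) < \<delta>\<^sup>2 / 4"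
    then have "(w (k n) * \<nu> (X n))\<^sup>2 \<le> \<delta>\<^sup>2" using *[of n] by simp
    then show "w (k n) * \<nu> (X n) \<le> \<delta>" by (rule power2_le_imp_le) (use \<open>0 < \<delta>\<close> in simp)
  qed
qed

definition close :: "(nat \<Rightarrow> nat) \<Rightarrow> (nat \<Rightarrow> fmat) \<Rightarrow> (nat \<Rightarrow> fmat) \<Rightarrow> bool" where
  "close k X Y \<longleftrightarrow> null k (X - Y)"

lemma close_refl [simp, intro]: "close k X X"
  by (simp add: close_def)
lemma close_sym: "close k X Y \<Longrightarrow> close k Y X"
  unfolding close_def using null_uminus by fastforce
lemma close_trans [trans]: "close k X Y \<Longrightarrow> close k Y Z \<Longrightarrow> close k X Z"
  unfolding close_def using null_add[of k "X - Y" "Y - Z"] by simp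
lemma close_add: "close k X X' \<Longrightarrow> close k Y Y' \<Longrightarrow> close k (X + Y) (X' + Y')"
  unfolding close_def using null_add[of k "X - X'" "Y - Y'"] by (simp add: algebra_simps)
lemma close_diff: "close k X X' \<Longrightarrow> close k Y Y' \<Longrightarrow> close k (X - Y) (X' - Y')"
  unfolding close_def using null_diff[of k "X - X'" "Y - Y'"] by (simp add: algebra_simps)
lemma close_left: "bdd A \<Longrightarrow> close k X Y \<Longrightarrow> close k (A * X) (A * Y)"
  unfolding close_def using null_left[of A k "X - Y"] by (simp add: right_diff_distrib)
lemma close_right: "bdd A \<Longrightarrow> close k X Y \<Longrightarrow> close k (X * A) (Y * A)"
  unfolding close_def using null_right[of A k "X - Y"] by (simp add: left_diff_distrib)
lemma close_mult: "close k X X' \<Longrightarrow> close k Y Y' \<Longrightarrow> bdd Y \<Longrightarrow> bdd X' \<Longrightarrow> close k (X * Y) (X' * Y')"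
  by (rule close_trans[OF close_right close_left])
lemma close_sadj: "close k X Y \<Longrightarrow> close k (sadj X) (sadj Y)"
  unfolding close_def using null_sadj by fastforce
lemma close_scs: "close k X Y \<Longrightarrow> close k (scs c X) (scs c Y)"
  unfolding close_def using null_scs[of k "X - Y" c] by (simp add: scs_diff)

section \<open>Lifting unitaries, projections and norm bounds\<close>

lemma null_sqrtI':
  assumes "\<And>n. 0 < k n" "null k E" "\<And>n. (\<nu> (X n))\<^sup>2 \<le> \<nu> (uid (k n)) * \<nu> (E n)"
  shows "null k X"
proof (rule null_sqrtI[OF assms(1)], intro exI[of _ E] conjI allI assms(2))
  fix \<delta> :: real and n assume "0 < \<delta>"
  then show "(\<nu> (X n))\<^sup>2 \<le> \<nu> (uid (k n)) * (\<delta> * \<nu> (uid (k n)) + 2 * \<nu> (E n))"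
    by (intro order_trans[OF assms(3)] mult_left_mono) auto
qed

text \<open>A null multiple of the unit makes each \<open>X n\<close> injective; the unitary part of
  the polar decomposition is then close, because \<open>X\<close> is isometric up to a null
  sequence.\<close>

lemma unitary_lift:
  assumes k: "\<And>n. 0 < k n" and X: "scorner k X" "bdd X" "close k (sadj X * X) (suid k)"
  shows "\<exists>U. sunitary k U \<and> close k U X"
proof -
  \<comment> \<open>The bound \<open>1 / Suc n\<close> makes the shifts tend to \<open>0\<close>
    along \<open>G\<close>, which is finer than \<open>sequentially\<close>.\<close>
  have "\<exists>s>0. s < 1 / Suc n \<and> (\<forall>q i. corner (k n) q \<longrightarrow> q * munit i = q \<longrightarrow>
      (X n + cs (of_real s) (uid (k n))) * q = 0 \<longrightarrow> q = 0)" for n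
    using X(1) by (intro regular_perturbation) (auto simp: scorner_def)
  then obtain s where s: "\<And>n. 0 < s n" "\<And>n. s n < 1 / Suc n"
    "\<And>n q i. corner (k n) q \<Longrightarrow> q * munit i = q \<Longrightarrow> (X n + cs (of_real (s n)) (uid (k n))) * q = 0 \<Longrightarrow> q = 0"
    by metis
  define S where "S = (\<lambda>n. cs (of_real (s n)) (uid (k n)))"
  define Y where "Y = X + S"
  have cS: "scorner k S" by (simp add: scorner_def S_def corner_cs)
  have s1: "s n \<le> 1" for n
  proof -
    have "1 / Suc n \<le> (1 :: real)" by simp
    then show ?thesis using s(2)[of n] by linarith
  qed
  have "opn (S n) \<le> 1" for n
    using mult_mono[of "s n" 1 "opn (uid (k n))" 1] s1[of n] s(1)[of n] opn_uid_le
    by (simp add: S_def opn_cs abs_of_pos)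
  then have bS: "bdd S" unfolding bdd_def by blast
  have nS: "null k S"
  proof (rule null_sandwich)
    fix n
    have "w (k n) * \<nu> (S n) \<le> w (k n) * (s n * \<nu> (uid (k n)))"
      using nu_cs[of "of_real (s n)" "uid (k n)"] s(1)[of n] by (intro mult_left_mono) (auto simp: S_def)
    also have "\<dots> = s n * (w (k n) * \<nu> (uid (k n)))" by simp
    also have "\<dots> \<le> s n * 1" using s(1)[of n] w_uid[OF k[of n]] by (intro mult_left_mono) auto
    finally show "w (k n) * \<nu> (S n) \<le> 1 / Suc n" using s(2)[of n] by linarith
    show "((\<lambda>n. 1 / real (Suc n)) \<longlongrightarrow> 0) G"
      using tendsto_mono[OF G_le LIMSEQ_inverse_real_of_nat] by (simp add: inverse_eq_divide)
  qed
  have YX: "close k Y X" using nS by (simp add: close_def Y_def)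
  have bY: "bdd Y" unfolding Y_def by (intro bdd_intros X bS)
  have "close k (sadj Y * Y) (sadj X * X)"
    by (intro close_mult close_sadj YX bY bdd_sadj X)
  then have YY: "close k (sadj Y * Y) (suid k)" using X(3) by (rule close_trans)
  have "\<exists>W. funitary (k n) W \<and> (\<nu> (Y n - W))\<^sup>2 \<le> \<nu> (uid (k n)) * \<nu> (adj (Y n) * Y n - uid (k n))" for n
  proof (rule near_unitary[OF k])
    show "corner (k n) (Y n)" using X(1) cS by (simp add: Y_def seq_sel scorner_def corner_plus)
    show "q = 0" if "corner (k n) q" "q * munit i = q" "Y n * q = 0" for q i
      using s(3)[OF that(1,2)] that(3) by (simp add: Y_def seq_sel S_def)
  qed
  then obtain U where U: "\<And>n. funitary (k n) (U n)"
    "\<And>n. (\<nu> (Y n - U n))\<^sup>2 \<le> \<nu> (uid (k n)) * \<nu> (adj (Y n) * Y n - uid (k n))" by metis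
  have "null k (Y - U)"
    by (rule null_sqrtI'[OF k YY[unfolded close_def]]) (simp add: seq_sel U)
  then have "close k U Y" by (simp add: close_def[symmetric] close_sym)
  then have "close k U X" using YX by (rule close_trans)
  then show ?thesis using U(1) by (intro exI[of _ U]) (simp add: sunitary_def)
qed

text \<open>Averaging with the adjoint makes \<open>X\<close> exactly self-adjoint at the cost of a
  null sequence; then \<open>round_projection\<close> applies.\<close>

lemma projection_lift:
  assumes k: "\<And>n. 0 < k n" and X: "scorner k X" "bdd X" "close k (sadj X) X" "close k (X * X) X"
  shows "\<exists>P. scorner k P \<and> sadj P = P \<and> P * P = P \<and> close k P X"
proof -
  define Y where "Y = scs (1/2) (X + sadj X)"
  have half: "scs (1/2) (X + X) = X"
    by (simp add: fun_eq_iff seq_sel cs_add flip: cs_add_left)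
  have YX: "close k Y X"
    using close_scs[OF close_add[OF close_refl X(3)], of "1/2" X] unfolding half Y_def .
  have Y: "scorner k Y" "bdd Y" unfolding Y_def using X by auto
  have sY: "sadj Y = Y" by (simp add: Y_def add.commute)
  have "close k (Y * Y) (X * X)" by (intro close_mult YX Y X)
  then have "close k (Y * Y) Y" by (rule close_trans[OF close_trans[OF _ X(4)] close_sym[OF YX]])
  then have nE: "null k (Y * Y - Y)" by (simp add: close_def)
  have "\<exists>P. corner (k n) P \<and> adj P = P \<and> P * P = P \<and> (\<nu> (P - Y n))\<^sup>2 \<le> \<nu> (uid (k n)) * \<nu> (Y n * Y n - Y n)" for n
    using Y(1) fun_cong[OF sY, of n] by (intro round_projection k) (auto simp: scorner_def seq_sel)
  then obtain P where P: "\<And>n. corner (k n) (P n) \<and> adj (P n) = P n \<and> P n * P n = P n"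
    "\<And>n. (\<nu> (P n - Y n))\<^sup>2 \<le> \<nu> (uid (k n)) * \<nu> (Y n * Y n - Y n)" by metis
  have "null k (P - Y)"
    by (rule null_sqrtI'[OF k nE]) (simp add: seq_sel P)
  then have "close k P X" unfolding close_def[symmetric] by (rule close_trans[OF _ YX])
  then show ?thesis using P(1) by (intro exI[of _ P]) (auto simp: scorner_def fun_eq_iff seq_sel)
qed

text \<open>The inequality \<open>adj X * X \<le> c\<^sup>2\<close> modulo null sequences, witnessed
  by the positive difference \<open>B\<close>. It stands in for a norm bound on the class of
  \<open>X\<close> in the quotient and asserts nothing about the operator norms of the single
  \<open>X n\<close>.\<close>

definition dominated :: "(nat \<Rightarrow> nat) \<Rightarrow> real \<Rightarrow> (nat \<Rightarrow> fmat) \<Rightarrow> bool" where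
  "dominated k c X \<longleftrightarrow> (\<exists>B. (\<forall>n. posm (B n)) \<and> close k (sadj X * X + B) (scs (of_real (c\<^sup>2)) (suid k)))"

lemma dominated_close:
  assumes "dominated k c X" "close k Y X" "bdd X" "bdd Y"
  shows "dominated k c Y"
proof -
  obtain B where B: "\<forall>n. posm (B n)" "close k (sadj X * X + B) (scs (of_real (c\<^sup>2)) (suid k))"
    using assms(1) unfolding dominated_def by blast
  have "close k (sadj Y * Y + B) (sadj X * X + B)"
    by (intro close_add close_mult close_sadj assms bdd_sadj close_refl)
  then have "close k (sadj Y * Y + B) (scs (of_real (c\<^sup>2)) (suid k))" using B(2) by (rule close_trans)
  then show ?thesis using B(1) unfolding dominated_def by blast
qed

lemma dominated_uminus: "dominated k c (- X) \<longleftrightarrow> dominated k c X"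
proof -
  have "sadj (- X) * (- X) = sadj X * X"
    by (simp flip: scs_minus_one)
  then show ?thesis unfolding dominated_def by simp
qed

text \<open>\<open>sadj U * U\<close> cancels inside, and \<open>V\<close> conjugates the whole
  relation together with its witness.\<close>

lemma dominated_conj:
  assumes "dominated k c X" "sunitary k U" "sunitary k V" "scorner k X"
  shows "dominated k c (U * X * V)"
proof -
  obtain B where B: "\<forall>n. posm (B n)" "close k (sadj X * X + B) (scs (of_real (c\<^sup>2)) (suid k))"
    using assms(1) unfolding dominated_def by blast
  note U = sunitaryD[OF assms(2)] and V = sunitaryD[OF assms(3)]
  have "sadj (U * X * V) * (U * X * V) = sadj V * (sadj X * ((sadj U * U) * X)) * V"
    by (simp add: mult.assoc)
  also have "\<dots> = sadj V * (sadj X * X) * V" unfolding U(2) suid_left[OF assms(4)] ..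
  finally have e: "sadj (U * X * V) * (U * X * V) + sadj V * B * V = sadj V * (sadj X * X + B) * V"
    by (simp add: distrib_left distrib_right)
  have "close k (sadj V * (sadj X * X + B) * V) (sadj V * scs (of_real (c\<^sup>2)) (suid k) * V)"
    by (intro close_right close_left V B)
  also have "sadj V * scs (of_real (c\<^sup>2)) (suid k) * V = scs (of_real (c\<^sup>2)) (suid k)"
    using V(1,2) by (simp add: mult.assoc suid_left)
  finally have "close k (sadj (U * X * V) * (U * X * V) + sadj V * B * V) (scs (of_real (c\<^sup>2)) (suid k))"
    unfolding e .
  moreover have "\<forall>n. posm ((sadj V * B * V) n)" using B(1) by (simp add: seq_sel posm_conj)
  ultimately show ?thesis unfolding dominated_def by blast
qed

text \<open>For a fixed \<open>c\<close> the bound of \<open>unitary_retraction\<close> keeps a term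
  \<open>c\<^sup>2 - \<epsilon>\<^sup>2\<close> that does not tend to \<open>0\<close>. As
  \<open>T'\<close> does not depend on \<open>c\<close>, the latter can be taken as near to
  \<epsilon> as each \<delta> demands.\<close>

lemma retraction_lift:
  assumes k: "\<And>n. 0 < k n" and T: "sunitary k T" and "0 \<le> \<epsilon>"
    and dom: "\<And>c. \<epsilon> < c \<Longrightarrow> dominated k c (T - suid k)"
  shows "\<exists>T'. sunitary k T' \<and> (\<forall>n. opn (T' n - uid (k n)) \<le> \<epsilon>) \<and> close k T' T"
proof -
  have "\<exists>T'. funitary (k n) T' \<and> opn (T' - uid (k n)) \<le> \<epsilon> \<and>
    (\<forall>c B E. \<epsilon> \<le> c \<longrightarrow> posm B \<longrightarrow>
      adj (T n - uid (k n)) * (T n - uid (k n)) + B = cs (of_real (c\<^sup>2)) (uid (k n)) + E \<longrightarrow>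
      (\<nu> (T n - T'))\<^sup>2 \<le> \<nu> (uid (k n)) * (2 * (c\<^sup>2 - \<epsilon>\<^sup>2) * \<nu> (uid (k n)) + 2 * \<nu> E))" for n
    using T by (intro unitary_retraction k assms(3)) (simp add: sunitary_def)
  then obtain T' where T': "\<And>n. funitary (k n) (T' n)" "\<And>n. opn (T' n - uid (k n)) \<le> \<epsilon>"
    "\<And>n c B E. \<epsilon> \<le> c \<Longrightarrow> posm B \<Longrightarrow>
      adj (T n - uid (k n)) * (T n - uid (k n)) + B = cs (of_real (c\<^sup>2)) (uid (k n)) + E \<Longrightarrow>
      (\<nu> (T n - T' n))\<^sup>2 \<le> \<nu> (uid (k n)) * (2 * (c\<^sup>2 - \<epsilon>\<^sup>2) * \<nu> (uid (k n)) + 2 * \<nu> E)" by metis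
  have "null k (T - T')"
  proof (rule null_sqrtI[OF k])
    fix \<delta> :: real assume \<delta>: "0 < \<delta>"
    \<comment> \<open>Chosen to make \<open>2 * (c\<^sup>2 - \<epsilon>\<^sup>2)\<close> equal to
      \<delta>, also for \<open>\<epsilon> = 0\<close>.\<close>
    define c where "c = sqrt (\<epsilon>\<^sup>2 + \<delta> / 2)"
    have "sqrt (\<epsilon>\<^sup>2) < c" unfolding c_def using \<delta> by (intro real_sqrt_less_mono) simp
    then have c: "\<epsilon> < c" using assms(3) by simp
    have c2: "c\<^sup>2 = \<epsilon>\<^sup>2 + \<delta> / 2" using \<delta> by (simp add: c_def)
    obtain B where B: "\<forall>n. posm (B n)"
      "close k (sadj (T - suid k) * (T - suid k) + B) (scs (of_real (c\<^sup>2)) (suid k))"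
      using dom[OF c] unfolding dominated_def by blast
    define E where "E = (sadj (T - suid k) * (T - suid k) + B) - scs (of_real (c\<^sup>2)) (suid k)"
    have "(\<nu> ((T - T') n))\<^sup>2 \<le> \<nu> (uid (k n)) * (\<delta> * \<nu> (uid (k n)) + 2 * \<nu> (E n))" for n
    proof -
      have "adj (T n - uid (k n)) * (T n - uid (k n)) + B n = cs (of_real (c\<^sup>2)) (uid (k n)) + E n"
        by (simp add: E_def seq_sel adj_minus)
      from T'(3)[OF less_imp_le[OF c] _ this] B(1)
      show ?thesis by (simp add: c2 seq_sel)
    qed
    then show "\<exists>E. null k E \<and> (\<forall>n. (\<nu> ((T - T') n))\<^sup>2 \<le> \<nu> (uid (k n)) * (\<delta> * \<nu> (uid (k n)) + 2 * \<nu> (E n)))"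
      using B(2) unfolding close_def E_def[symmetric] by blast
  qed
  then have "close k T' T" by (simp add: close_def[symmetric] close_sym)
  then show ?thesis using T'(1,2) by (intro exI[of _ T']) (simp add: sunitary_def)
qed

primrec conj_orbit :: "(nat \<Rightarrow> fmat) \<Rightarrow> (nat \<Rightarrow> fmat) \<Rightarrow> nat \<Rightarrow> nat \<Rightarrow> fmat" where
  "conj_orbit U V 0 = U"
| "conj_orbit U V (Suc j) = V * conj_orbit U V j * sadj V"

lemma sunitary_conj_orbit: "sunitary k U \<Longrightarrow> sunitary k V \<Longrightarrow> sunitary k (conj_orbit U V j)"
  by (induction j) (auto intro: sunitary_times sunitary_sadj)

text \<open>The first difference is, up to sign, the commutator times a unitary; each further
  difference is the conjugate of the previous one by \<open>V\<close>.\<close>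

lemma conj_orbit_step:
  assumes U: "sunitary k U" and V: "sunitary k V"
    and dom: "dominated k c (U * V - V * U)"
  shows "dominated k c (conj_orbit U V (Suc j) - conj_orbit U V j)"
proof (induction j)
  case 0
  have "conj_orbit U V (Suc 0) - conj_orbit U V 0 = V * U * sadj V - U * suid k"
    using sunitaryD(1)[OF U] by (simp add: suid_right)
  \<comment> \<open>The unit on the left brings the term into the shape of
    \<open>dominated_conj\<close>.\<close>
  also have "\<dots> = suid k * (V * U - U * V) * sadj V"
    using sunitaryD[OF U] sunitaryD[OF V]
    by (simp add: left_diff_distrib right_diff_distrib mult.assoc)
      (simp add: suid_left flip: mult.assoc)
  finally have e: "conj_orbit U V (Suc 0) - conj_orbit U V 0 = suid k * (V * U - U * V) * sadj V" .
  have "dominated k c (V * U - U * V)"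
    using dom dominated_uminus[of k c "U * V - V * U"] by simp
  then show ?case unfolding e
    by (rule dominated_conj)
       (use sunitaryD(1)[OF U] sunitaryD(1)[OF V] sunitary_sadj[OF V] in
         \<open>auto simp: sunitary_def seq_sel funitary_uid intro!: scorner_intros\<close>)
next
  case (Suc j)
  have e: "conj_orbit U V (Suc (Suc j)) - conj_orbit U V (Suc j) =
      V * (conj_orbit U V (Suc j) - conj_orbit U V j) * sadj V"
    by (simp add: left_diff_distrib right_diff_distrib)
  show ?case unfolding e
    by (rule dominated_conj[OF Suc V sunitary_sadj[OF V]])
       (intro scorner_intros sunitaryD(1)[OF sunitary_conj_orbit[OF U V]])
qed

text \<open>Given \<open>W j\<close>, let \<open>T\<close> be the unitary that carries it to the
  next point of the orbit. \<open>T - suid k\<close> is dominated by every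
  \<open>c > \<epsilon>\<close>, so \<open>T\<close> can be retracted, and the retracted unitary
  applied to \<open>W j\<close> makes a step of at most \<epsilon>. Each \<open>W j\<close> has to
  be close to the orbit only up to a null sequence, without uniformity in \<open>j\<close>; hence
  the induction loses nothing.\<close>

lemma orbit_lift:
  assumes k: "\<And>n. 0 < k n" and U: "sunitary k U" and V: "sunitary k V" and "0 \<le> \<epsilon>"
    and dom: "\<And>c. \<epsilon> < c \<Longrightarrow> dominated k c (U * V - V * U)"
  shows "\<exists>W. \<forall>j. sunitary k (W j) \<and> close k (W j) (conj_orbit U V j) \<and> (\<forall>n. opn (W (Suc j) n - W j n) \<le> \<epsilon>)"
proof -
  let ?Y = "conj_orbit U V"
  note uY = sunitary_conj_orbit[OF U V]
  have step: "\<exists>W'. (sunitary k W' \<and> close k W' (?Y (Suc j))) \<and> (\<forall>n. opn (W' n - W n) \<le> \<epsilon>)"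
    if W: "sunitary k W \<and> close k W (?Y j)" for W j
  proof -
    have uW: "sunitary k W" and cW: "close k W (?Y j)" using W by auto
    note W' = sunitaryD[OF uW]
    define T where "T = ?Y (Suc j) * sadj W"
    have uT: "sunitary k T" unfolding T_def by (intro sunitary_times uY sunitary_sadj uW)
    have TW: "T * W = ?Y (Suc j)"
      unfolding T_def mult.assoc W'(2) by (rule suid_right[OF sunitaryD(1)[OF uY]])
    have "dominated k c (T - suid k)" if "\<epsilon> < c" for c
    proof -
      let ?D = "?Y (Suc j) - ?Y j"
      have sc: "scorner k ?D" by (intro scorner_intros sunitaryD(1)[OF uY])
      have "dominated k c (suid k * ?D * sadj W)"
        by (rule dominated_conj[OF conj_orbit_step[OF U V dom[OF that]] _ sunitary_sadj[OF uW] sc])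
           (simp add: sunitary_def seq_sel funitary_uid)
      then have d: "dominated k c (?D * sadj W)" unfolding suid_left[OF sc] .
      have "T - suid k = (?Y (Suc j) - W) * sadj W"
        unfolding T_def left_diff_distrib W'(3) ..
      moreover have "close k ((?Y (Suc j) - W) * sadj W) (?D * sadj W)"
        by (intro close_right W' close_diff close_refl cW)
      ultimately show ?thesis
        using dominated_close[OF d] sunitaryD(4)[OF uY] W' by (metis bdd_intros(2,3))
    qed
    from retraction_lift[OF k uT assms(4) this] obtain T' where
      T': "sunitary k T'" "\<And>n. opn (T' n - uid (k n)) \<le> \<epsilon>" "close k T' T" by blast
    have "close k (T' * W) (T * W)" by (rule close_right[OF W'(4) T'(3)])
    moreover have "opn ((T' * W) n - W n) \<le> \<epsilon>" for n
    proof -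
      have "uid (k n) * W n = W n" using W'(1) by (simp add: scorner_def uid_left)
      then have "(T' * W) n - W n = (T' n - uid (k n)) * W n" by (simp add: seq_sel left_diff_distrib)
      then have "opn ((T' * W) n - W n) \<le> opn (T' n - uid (k n)) * opn (W n)" by (simp add: opn_times)
      also have "\<dots> \<le> \<epsilon> * 1"
        using T'(2) uW opn_funitary_le assms(4) by (intro mult_mono) (auto simp: sunitary_def)
      finally show ?thesis by simp
    qed
    ultimately show ?thesis unfolding TW using sunitary_times[OF T'(1) uW] by blast
  qed
  have "\<exists>W. \<forall>j. (sunitary k (W j) \<and> close k (W j) (?Y j)) \<and> (\<forall>n. opn (W (Suc j) n - W j n) \<le> \<epsilon>)"
    by (rule dependent_nat_choice[where P = "\<lambda>j W. sunitary k W \<and> close k W (?Y j)"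
          and Q = "\<lambda>j W W'. \<forall>n. opn (W' n - W n) \<le> \<epsilon>"])
       (use U step in \<open>auto intro: exI[of _ U]\<close>)
  then show ?thesis by blast
qed

end

section \<open>Homomorphisms modulo null sequences\<close>

context ideal_norm
begin

text \<open>A homomorphism into the quotient, written through an arbitrary choice of bounded
  representatives: it respects the operations only modulo null sequences.\<close>

definition hom_mod :: "(nat \<Rightarrow> nat) \<Rightarrow> 'a star_algebra \<Rightarrow> ('a \<Rightarrow> nat \<Rightarrow> fmat) \<Rightarrow> bool" where
  "hom_mod k A \<Phi> \<longleftrightarrow> (\<forall>x\<in>carrier A. scorner k (\<Phi> x) \<and> bdd (\<Phi> x)) \<and>
    (\<forall>x\<in>carrier A. \<forall>y\<in>carrier A. close k (\<Phi> (x \<oplus>\<^bsub>A\<^esub> y)) (\<Phi> x + \<Phi> y)) \<and>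
    (\<forall>x\<in>carrier A. \<forall>y\<in>carrier A. close k (\<Phi> (x \<otimes>\<^bsub>A\<^esub> y)) (\<Phi> x * \<Phi> y)) \<and>
    (\<forall>c. \<forall>x\<in>carrier A. close k (\<Phi> (cscale A c x)) (scs c (\<Phi> x))) \<and>
    (\<forall>x\<in>carrier A. close k (\<Phi> (star A x)) (sadj (\<Phi> x)))"

lemma hom_modD:
  assumes "hom_mod k A \<Phi>" "x \<in> carrier A"
  shows "scorner k (\<Phi> x)" "bdd (\<Phi> x)" "close k (\<Phi> (cscale A c x)) (scs c (\<Phi> x))"
    "close k (\<Phi> (star A x)) (sadj (\<Phi> x))"
    "y \<in> carrier A \<Longrightarrow> close k (\<Phi> (x \<oplus>\<^bsub>A\<^esub> y)) (\<Phi> x + \<Phi> y)"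
    "y \<in> carrier A \<Longrightarrow> close k (\<Phi> (x \<otimes>\<^bsub>A\<^esub> y)) (\<Phi> x * \<Phi> y)"
  using assms unfolding hom_mod_def by auto

lemma hom_mod_gram:
  assumes "cstar_algebra A" "hom_mod k A \<Phi>" "x \<in> carrier A"
  shows "close k (\<Phi> (star A x \<otimes>\<^bsub>A\<^esub> x)) (sadj (\<Phi> x) * \<Phi> x)"
proof -
  interpret cstar_algebra A by fact
  note h = hom_modD[OF assms(2)]
  have "close k (\<Phi> (star A x \<otimes>\<^bsub>A\<^esub> x)) (\<Phi> (star A x) * \<Phi> x)"
    using assms(3) star_closed by (intro h) auto
  also have "close k (\<Phi> (star A x) * \<Phi> x) (sadj (\<Phi> x) * \<Phi> x)"
    using assms(3) by (intro close_right h)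
  finally show ?thesis .
qed

text \<open>This replaces the contractivity of homomorphisms of C*-algebras, and makes it
  unnecessary to show that the quotient is a C*-algebra.\<close>

lemma hom_mod_dominated:
  assumes "cstar_algebra A" "hom_mod k A \<Phi>" "a \<in> carrier A" "cnorm A a < c"
  shows "\<exists>B. (\<forall>n. posm (B n)) \<and> close k (sadj (\<Phi> a) * \<Phi> a + B) (scs (of_real (c\<^sup>2)) (\<Phi> \<one>\<^bsub>A\<^esub>))"
proof -
  interpret cstar_algebra A by fact
  note h = hom_modD[OF assms(2)]
  have c: "0 < c" using norm_nonneg[OF assms(3)] assms(4) by simp
  define a' where "a' = cscale A (of_real (1 / c)) a"
  have a': "a' \<in> carrier A" using assms(3) by (simp add: a'_def scale_closed)
  have "cnorm A a' < 1" using assms(3,4) c by (simp add: a'_def norm_scale norm_divide)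
  then obtain b where b: "b \<in> carrier A" "star A b \<otimes>\<^bsub>A\<^esub> b \<oplus>\<^bsub>A\<^esub> star A a' \<otimes>\<^bsub>A\<^esub> a' = \<one>\<^bsub>A\<^esub>"
    using contraction_complement[OF a'] by blast
  define b' where "b' = cscale A (of_real c) b"
  have b': "b' \<in> carrier A" using b by (simp add: b'_def scale_closed)
  have g: "star A (cscale A (of_real c) x) \<otimes>\<^bsub>A\<^esub> cscale A (of_real c) x = cscale A (of_real (c\<^sup>2)) (star A x \<otimes>\<^bsub>A\<^esub> x)"
    if "x \<in> carrier A" for x
    using that by (simp add: star_scale scale_mult_left scale_mult_right scale_closed star_closed scale_scale power2_eq_square)
  have "a = cscale A (of_real c) a'"
    using assms(3) c by (simp add: a'_def scale_scale scale_one flip: of_real_mult)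
  then have "star A a \<otimes>\<^bsub>A\<^esub> a = cscale A (of_real (c\<^sup>2)) (star A a' \<otimes>\<^bsub>A\<^esub> a')" using g[OF a'] by simp
  then have eq: "star A a \<otimes>\<^bsub>A\<^esub> a \<oplus>\<^bsub>A\<^esub> star A b' \<otimes>\<^bsub>A\<^esub> b' = cscale A (of_real (c\<^sup>2)) \<one>\<^bsub>A\<^esub>"
    using g[OF b(1)] a' b star_closed by (simp add: b'_def flip: scale_add_right b(2)) (simp add: scale_add_right a_comm scale_closed)
  have "close k (sadj (\<Phi> a) * \<Phi> a + sadj (\<Phi> b') * \<Phi> b') (\<Phi> (star A a \<otimes>\<^bsub>A\<^esub> a) + \<Phi> (star A b' \<otimes>\<^bsub>A\<^esub> b'))"
    by (intro close_add close_sym[OF hom_mod_gram[OF assms(1,2)]] assms b')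
  also have "close k (\<Phi> (star A a \<otimes>\<^bsub>A\<^esub> a) + \<Phi> (star A b' \<otimes>\<^bsub>A\<^esub> b')) (\<Phi> (star A a \<otimes>\<^bsub>A\<^esub> a \<oplus>\<^bsub>A\<^esub> star A b' \<otimes>\<^bsub>A\<^esub> b'))"
    using assms(3) b' star_closed by (intro close_sym[OF h(5)]) auto
  also have "close k (\<Phi> (star A a \<otimes>\<^bsub>A\<^esub> a \<oplus>\<^bsub>A\<^esub> star A b' \<otimes>\<^bsub>A\<^esub> b')) (scs (of_real (c\<^sup>2)) (\<Phi> \<one>\<^bsub>A\<^esub>))"
    unfolding eq by (rule h) simp
  finally show ?thesis
    by (intro exI[of _ "sadj (\<Phi> b') * \<Phi> b'"]) (simp add: seq_sel posm_adj_times)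
qed

text \<open>Continuity of the homomorphism with respect to \<open>\<nu>\<close>, for passing to
  limits in \<open>A\<close>. Domination by a multiple of \<open>\<Phi> \<one>\<close> becomes
  domination by a multiple of the unit once \<open>\<Phi> \<one>\<close> is replaced by a genuine
  projection. The factor \<open>2\<close> is slack over the \<open>sqrt 2\<close> that the estimate
  gives.\<close>

lemma hom_mod_small:
  assumes k: "\<And>n. 0 < k n" and "cstar_algebra A" "hom_mod k A \<Phi>" "a \<in> carrier A" "cnorm A a < c"
  shows "\<forall>\<^sub>F n in G. w (k n) * \<nu> (\<Phi> a n) \<le> 2 * c"
proof -
  interpret cstar_algebra A by fact
  note h = hom_modD[OF assms(3)]
  have c: "0 < c" using norm_nonneg[OF assms(4)] assms(5) by simp
  have one: "close k (\<Phi> \<one>\<^bsub>A\<^esub> * \<Phi> \<one>\<^bsub>A\<^esub>) (\<Phi> \<one>\<^bsub>A\<^esub>)" "close k (sadj (\<Phi> \<one>\<^bsub>A\<^esub>)) (\<Phi> \<one>\<^bsub>A\<^esub>)"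
    using close_sym[OF h(6)[of "\<one>\<^bsub>A\<^esub>" "\<one>\<^bsub>A\<^esub>"]] close_sym[OF h(4)[of "\<one>\<^bsub>A\<^esub>"]] star_one by auto
  obtain P where P: "scorner k P" "sadj P = P" "P * P = P" "close k P (\<Phi> \<one>\<^bsub>A\<^esub>)"
    using projection_lift[OF k h(1,2) one(2,1)] by auto
  obtain B where B: "\<forall>n. posm (B n)" "close k (sadj (\<Phi> a) * \<Phi> a + B) (scs (of_real (c\<^sup>2)) (\<Phi> \<one>\<^bsub>A\<^esub>))"
    using hom_mod_dominated[OF assms(2-5)] by blast
  have cP: "close k (sadj (\<Phi> a) * \<Phi> a + B) (scs (of_real (c\<^sup>2)) P)"
    by (rule close_trans[OF B(2) close_scs[OF close_sym[OF P(4)]]])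
  define E where "E = sadj (\<Phi> a) * \<Phi> a + B - scs (of_real (c\<^sup>2)) P"
  have nE: "null k E" using cP by (simp add: close_def E_def)
  have bound: "(\<nu> (\<Phi> a n))\<^sup>2 \<le> \<nu> (uid (k n)) * (c\<^sup>2 * \<nu> (uid (k n)) + \<nu> (E n))" for n
  proof (rule nu_form[OF k])
    show "\<Phi> a n * uid (k n) = \<Phi> a n" using h(1)[OF assms(4)] by (simp add: scorner_def uid_right)
    fix Z
    have eq: "adj (\<Phi> a n) * \<Phi> a n = cs (of_real (c\<^sup>2)) (P n) + E n - B n"
      by (simp add: E_def seq_sel)
    have "(norm (\<Phi> a n * Z))\<^sup>2 = inner Z ((adj (\<Phi> a n) * \<Phi> a n) * Z)"
      by (simp add: norm_sq_fmat inner_times_left mult.assoc)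
    also have "(adj (\<Phi> a n) * \<Phi> a n) * Z = scaleR (c\<^sup>2) (P n * Z) + E n * Z - B n * Z"
      unfolding eq by (simp add: distrib_right left_diff_distrib scaleR_cs)
    also have "inner Z (scaleR (c\<^sup>2) (P n * Z) + E n * Z - B n * Z) =
        c\<^sup>2 * inner Z (P n * Z) + inner Z (E n * Z) - inner Z (B n * Z)"
      by (simp only: inner_add_right inner_diff_right inner_scaleR_right)
    also have "\<dots> \<le> c\<^sup>2 * (norm Z)\<^sup>2 + norm (E n * Z) * norm Z"
    proof -
      have PP: "adj (P n) = P n" "P n * P n = P n" using fun_cong[OF P(2), of n] fun_cong[OF P(3), of n] by (auto simp: seq_sel)
      have "inner Z (P n * Z) = (norm (P n * Z))\<^sup>2"
        using PP by (simp add: norm_sq_fmat inner_times_left) (simp add: PP flip: mult.assoc)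
      moreover have "norm (P n * Z) \<le> 1 * norm Z"
      proof (rule order_trans[OF norm_le_opn], intro mult_right_mono)
        have "(opn (P n))\<^sup>2 = opn (P n)" using opn_cstar[of "P n"] PP by simp
        then show "opn (P n) \<le> 1" by (auto simp: power2_eq_square)
      qed simp
      ultimately have "inner Z (P n * Z) \<le> (norm Z)\<^sup>2" by (simp add: power_mono)
      moreover have "0 \<le> inner Z (B n * Z)" using B(1) by (simp add: posm_def)
      moreover have "inner Z (E n * Z) \<le> norm (E n * Z) * norm Z"
        using norm_cauchy_schwarz[of Z "E n * Z"] by (simp add: mult.commute)
      ultimately show ?thesis by (smt (verit, best) mult_left_mono zero_le_power2)
    qed
    finally show "(norm (\<Phi> a n * Z))\<^sup>2 \<le> c\<^sup>2 * (norm Z)\<^sup>2 + norm (E n * Z) * norm Z" .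
  qed simp
  have "\<forall>\<^sub>F n in G. w (k n) * \<nu> (E n) < c\<^sup>2" using null_smallD[OF nE, of "c\<^sup>2"] c by simp
  then show ?thesis
  proof (rule eventually_mono)
    fix n assume n: "w (k n) * \<nu> (E n) < c\<^sup>2"
    let ?o = "w (k n) * \<nu> (uid (k n))"
    have o: "0 \<le> ?o" "?o \<le> 1" using w_uid[OF k] by auto
    have "(w (k n) * \<nu> (\<Phi> a n))\<^sup>2 \<le> (w (k n))\<^sup>2 * (\<nu> (uid (k n)) * (c\<^sup>2 * \<nu> (uid (k n)) + \<nu> (E n)))"
      unfolding power_mult_distrib by (intro mult_left_mono bound) simp
    also have "\<dots> = ?o * (c\<^sup>2 * ?o + w (k n) * \<nu> (E n))"
      by (simp add: power2_eq_square algebra_simps)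
    also have "\<dots> \<le> 1 * (c\<^sup>2 * 1 + c\<^sup>2)"
      using o n by (intro mult_mono add_mono mult_left_mono) auto
    also have "\<dots> \<le> (2 * c)\<^sup>2" by (simp add: power_mult_distrib)
    finally show "w (k n) * \<nu> (\<Phi> a n) \<le> 2 * c" by (rule power2_le_imp_le) (use c in simp)
  qed
qed

text \<open>\<open>\<Phi>\<close> need not be unital. Adding \<open>q\<close> lets every element act
  as the unit on the complementary corner. This keeps products, because \<open>q\<close> and the
  values of \<open>\<Phi>\<close> annihilate each other up to null sequences, and it turns unitaries
  of \<open>A\<close> into unitaries modulo null sequences.\<close>

lemma unital_mult:
  assumes "cstar_algebra A" "hom_mod k A \<Phi>" "x \<in> carrier A" "y \<in> carrier A"
  defines "q \<equiv> suid k - \<Phi> \<one>\<^bsub>A\<^esub>"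
  shows "close k ((\<Phi> x + q) * (\<Phi> y + q)) (\<Phi> (x \<otimes>\<^bsub>A\<^esub> y) + q)"
proof -
  interpret cstar_algebra A by fact
  note h = hom_modD[OF assms(2)]
  note nn = h(6)[unfolded close_def]
  let ?e = "\<Phi> \<one>\<^bsub>A\<^esub>"
  note s = h(1)[OF assms(3)] h(1)[OF assms(4)] h(1)[OF one_closed]
  \<comment> \<open>The error is exactly a combination of four defects of multiplicativity, three of
    them with the unit of \<open>A\<close> as a factor.\<close>
  have "(\<Phi> x + q) * (\<Phi> y + q) - (\<Phi> (x \<otimes>\<^bsub>A\<^esub> y) + q) =
     (\<Phi> (x \<otimes>\<^bsub>A\<^esub> \<one>\<^bsub>A\<^esub>) - \<Phi> x * ?e) + (\<Phi> (\<one>\<^bsub>A\<^esub> \<otimes>\<^bsub>A\<^esub> y) - ?e * \<Phi> y)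
      - (\<Phi> (x \<otimes>\<^bsub>A\<^esub> y) - \<Phi> x * \<Phi> y) - (\<Phi> (\<one>\<^bsub>A\<^esub> \<otimes>\<^bsub>A\<^esub> \<one>\<^bsub>A\<^esub>) - ?e * ?e)"
    using assms(3,4) s unfolding q_def
    by (simp add: distrib_left distrib_right left_diff_distrib right_diff_distrib suid_left suid_right
        scorner_intros)
  moreover have "null k \<dots>" using assms(3,4) by (intro null_diff null_add nn) auto
  ultimately show ?thesis unfolding close_def by (simp only:)
qed

lemma unitary_elem_lift:
  assumes k: "\<And>n. 0 < k n" and "cstar_algebra A" "hom_mod k A \<Phi>" "unitary_elem A x"
  shows "\<exists>U. sunitary k U \<and> close k U (\<Phi> x + (suid k - \<Phi> \<one>\<^bsub>A\<^esub>))"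
proof (rule unitary_lift[OF k])
  interpret cstar_algebra A by fact
  note h = hom_modD[OF assms(3)]
  have x: "x \<in> carrier A" "star A x \<otimes>\<^bsub>A\<^esub> x = \<one>\<^bsub>A\<^esub>" using assms(4) by (auto simp: unitary_elem_def)
  let ?q = "suid k - \<Phi> \<one>\<^bsub>A\<^esub>"
  show s: "scorner k (\<Phi> x + ?q)" using x h by (intro scorner_intros) auto
  show b: "bdd (\<Phi> x + ?q)" using x h by (intro bdd_intros bdd_suid) auto
  have e1: "close k (sadj (\<Phi> \<one>\<^bsub>A\<^esub>)) (\<Phi> \<one>\<^bsub>A\<^esub>)" using close_sym[OF h(4)[OF one_closed]] star_one by simp
  have "close k (sadj (\<Phi> x + ?q)) (\<Phi> (star A x) + ?q)"
    unfolding sadj_simps by (intro close_add close_diff close_refl close_sym[OF h(4)] x e1)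
  then have "close k (sadj (\<Phi> x + ?q) * (\<Phi> x + ?q)) ((\<Phi> (star A x) + ?q) * (\<Phi> x + ?q))"
    by (rule close_right[OF b])
  also have "close k ((\<Phi> (star A x) + ?q) * (\<Phi> x + ?q)) (\<Phi> \<one>\<^bsub>A\<^esub> + ?q)"
    using unital_mult[OF assms(2,3) star_closed[OF x(1)] x(1)] x(2) by simp
  finally show "close k (sadj (\<Phi> x + ?q) * (\<Phi> x + ?q)) (suid k)" by simp
qed

text \<open>On the complement of \<open>\<Phi> \<one>\<close> both lifts act as the unit and
  commute, so their commutator is close to \<open>\<Phi> a\<close> for \<open>a\<close> the
  commutator of \<open>u\<close> and \<open>v\<close>. The bound from
  \<open>hom_mod_dominated\<close> is by \<open>c\<^sup>2\<close> times
  \<open>\<Phi> \<one>\<close>; the part that is missing to \<open>c\<^sup>2\<close> times the unit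
  is itself positive and joins the witness.\<close>

lemma commutator_dominated:
  assumes k: "\<And>n. 0 < k n" and "cstar_algebra A" "hom_mod k A \<Phi>" "soft_pair \<epsilon> A u v"
    and U: "sunitary k U" "close k U (\<Phi> u + (suid k - \<Phi> \<one>\<^bsub>A\<^esub>))"
    and V: "sunitary k V" "close k V (\<Phi> v + (suid k - \<Phi> \<one>\<^bsub>A\<^esub>))"
    and P: "scorner k P" "sadj P = P" "P * P = P" "close k P (\<Phi> \<one>\<^bsub>A\<^esub>)"
    and "\<epsilon> < c"
  shows "dominated k c (U * V - V * U)"
proof -
  interpret cstar_algebra A by fact
  note h = hom_modD[OF assms(3)]
  let ?q = "suid k - \<Phi> \<one>\<^bsub>A\<^esub>"
  have uv: "u \<in> carrier A" "v \<in> carrier A" using assms(4) by (auto simp: soft_pair_def unitary_elem_def)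
  define a where "a = u \<otimes>\<^bsub>A\<^esub> v \<ominus>\<^bsub>A\<^esub> v \<otimes>\<^bsub>A\<^esub> u"
  have a: "a \<in> carrier A" "cnorm A a < c" using assms(4) \<open>\<epsilon> < c\<close> uv by (auto simp: a_def soft_pair_def)
  have bq: "bdd (\<Phi> x + ?q)" if "x \<in> carrier A" for x using that h by (intro bdd_intros bdd_suid) auto
  have 1: "close k (X * Y) (\<Phi> (x \<otimes>\<^bsub>A\<^esub> y) + ?q)"
    if "close k X (\<Phi> x + ?q)" "close k Y (\<Phi> y + ?q)" "bdd Y" "x \<in> carrier A" "y \<in> carrier A" for X Y x y
    by (rule close_trans[OF close_mult[OF that(1-3) bq[OF that(4)]] unital_mult[OF assms(2,3) that(4,5)]])
  have "close k (U * V - V * U) ((\<Phi> (u \<otimes>\<^bsub>A\<^esub> v) + ?q) - (\<Phi> (v \<otimes>\<^bsub>A\<^esub> u) + ?q))"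
    by (intro close_diff 1 U V uv sunitaryD(4)[OF U(1)] sunitaryD(4)[OF V(1)])
  also have "(\<Phi> (u \<otimes>\<^bsub>A\<^esub> v) + ?q) - (\<Phi> (v \<otimes>\<^bsub>A\<^esub> u) + ?q) = \<Phi> (u \<otimes>\<^bsub>A\<^esub> v) + scs (-1) (\<Phi> (v \<otimes>\<^bsub>A\<^esub> u))"
    by (simp add: scs_minus_one)
  also have "close k (\<Phi> (u \<otimes>\<^bsub>A\<^esub> v) + scs (-1) (\<Phi> (v \<otimes>\<^bsub>A\<^esub> u))) (\<Phi> (u \<otimes>\<^bsub>A\<^esub> v) + \<Phi> (cscale A (-1) (v \<otimes>\<^bsub>A\<^esub> u)))"
    using uv by (intro close_add close_refl close_sym[OF h(3)]) auto
  also have "close k (\<Phi> (u \<otimes>\<^bsub>A\<^esub> v) + \<Phi> (cscale A (-1) (v \<otimes>\<^bsub>A\<^esub> u))) (\<Phi> a)"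
    using uv unfolding a_def minus_eq a_inv_scale[OF m_closed[OF uv(2,1)]]
    by (intro close_sym[OF h(5)] scale_closed) auto
  finally have comm: "close k (U * V - V * U) (\<Phi> a)" .
  obtain B where B: "\<forall>n. posm (B n)" "close k (sadj (\<Phi> a) * \<Phi> a + B) (scs (of_real (c\<^sup>2)) (\<Phi> \<one>\<^bsub>A\<^esub>))"
    using hom_mod_dominated[OF assms(2,3) a] by blast
  \<comment> \<open>A square root of the missing summand, by which it is positive. It is formed with
    \<open>P\<close>, since \<open>\<Phi> \<one>\<close> is a projection only up to a null
    sequence.\<close>
  let ?Q = "scs (of_real c) (suid k - P)"
  have PP: "(suid k - P) * (suid k - P) = suid k - P"
    using P(1,3) by (simp add: left_diff_distrib right_diff_distrib suid_left suid_right scorner_intros(6))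
  have "sadj ?Q = ?Q" by (simp add: P(2))
  then have "sadj ?Q * ?Q = scs (of_real (c\<^sup>2)) ((suid k - P) * (suid k - P))"
    by (simp only: scs_simps power2_eq_square of_real_mult)
  then have "sadj ?Q * ?Q = scs (of_real (c\<^sup>2)) (suid k - P)" unfolding PP .
  moreover have "close k (sadj (\<Phi> a) * \<Phi> a + B + scs (of_real (c\<^sup>2)) (suid k - P))
      (scs (of_real (c\<^sup>2)) P + scs (of_real (c\<^sup>2)) (suid k - P))"
    by (intro close_add close_refl close_trans[OF B(2)] close_scs close_sym[OF P(4)])
  ultimately have "close k (sadj (\<Phi> a) * \<Phi> a + (B + sadj ?Q * ?Q)) (scs (of_real (c\<^sup>2)) (suid k))"
    by (simp add: add.assoc flip: scs_add)
  moreover have "\<forall>n. posm ((B + sadj ?Q * ?Q) n)"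
    using B(1) by (auto simp only: seq_sel intro!: posm_add posm_adj_times)
  ultimately have "dominated k c (\<Phi> a)" unfolding dominated_def by blast
  then show ?thesis
    by (rule dominated_close[OF _ comm h(2)[OF a(1)]]) (intro bdd_intros sunitaryD(4)[OF U(1)] sunitaryD(4)[OF V(1)])
qed

end

section \<open>Dilation to pairs with small commutator\<close>

abbreviation blk :: "nat \<Rightarrow> nat \<Rightarrow> fmat" where "blk k a \<equiv> shift (a * k) k"

text \<open>Row \<open>a\<close> has the single block \<open>f a\<close>, in column \<open>p a\<close>.\<close>

definition monomial_blocks :: "nat \<Rightarrow> nat \<Rightarrow> (nat \<Rightarrow> fmat) \<Rightarrow> (nat \<Rightarrow> nat) \<Rightarrow> fmat" where
  "monomial_blocks k L f p = (\<Sum>a<L. blk k a * f a * adj (blk k (p a)))"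

text \<open>A stack of \<open>L\<close> blocks: the rows of \<open>X a\<close> move to block
  position \<open>a\<close>, the columns stay. Isometries from one copy into \<open>L\<close> copies
  have this form.\<close>

definition block_column :: "nat \<Rightarrow> nat \<Rightarrow> (nat \<Rightarrow> fmat) \<Rightarrow> fmat" where
  "block_column k L X = (\<Sum>a<L. blk k a * X a)"

lemma blk_orth: "adj (blk k a) * blk k b = (if a = b then uid k else 0)"
proof (cases a b rule: linorder_cases)
  case less
  then have "a * k + k \<le> b * k" by (metis Suc_leI add.commute mult_Suc mult_le_mono1)
  then show ?thesis using less by (simp add: shift_disjoint)
next
  case greater
  then have "b * k + k \<le> a * k" by (metis Suc_leI add.commute mult_Suc mult_le_mono1)
  then show ?thesis using greater by (simp add: shift_disjoint')
qed simp

lemma blk_orth_times: "adj (blk k a) * (blk k b * X) = (if a = b then uid k * X else 0)"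
  by (simp add: blk_orth flip: mult.assoc)

lemma monomial_blocks_cong:
  "(\<And>a. a < L \<Longrightarrow> f a = g a) \<Longrightarrow> (\<And>a. a < L \<Longrightarrow> p a = q a) \<Longrightarrow> monomial_blocks k L f p = monomial_blocks k L g q"
  unfolding monomial_blocks_def by (intro sum.cong) auto

lemma monomial_blocks_column:
  assumes "\<And>a. a < L \<Longrightarrow> p a < L" "\<And>a. a < L \<Longrightarrow> corner k (f a)"
  shows "monomial_blocks k L f p * block_column k L X = block_column k L (\<lambda>a. f a * X (p a))"
proof -
  have "monomial_blocks k L f p * block_column k L X = (\<Sum>a<L. \<Sum>b<L. blk k a * f a * (adj (blk k (p a)) * (blk k b * X b)))"
    unfolding monomial_blocks_def block_column_def sum_product by (simp add: mult.assoc)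
  also have "\<dots> = (\<Sum>a<L. \<Sum>b<L. if p a = b then blk k a * f a * (uid k * X (p a)) else 0)"
    by (intro sum.cong) (auto simp: blk_orth_times)
  also have "\<dots> = (\<Sum>a<L. blk k a * (f a * X (p a)))"
    using assms by (intro sum.cong) (auto simp: uid_right mult.assoc simp flip: mult.assoc[of _ "uid k"])
  finally show ?thesis unfolding block_column_def .
qed

lemma monomial_blocks_mult:
  assumes "\<And>a. a < L \<Longrightarrow> p a < L" "\<And>a. a < L \<Longrightarrow> corner k (f a)"
  shows "monomial_blocks k L f p * monomial_blocks k L g q = monomial_blocks k L (\<lambda>a. f a * g (p a)) (\<lambda>a. q (p a))"
  using monomial_blocks_column[where X = "\<lambda>b. g b * adj (blk k (q b))", OF assms]
  by (simp add: monomial_blocks_def block_column_def mult.assoc)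

text \<open>Taking adjoints exchanges row and column positions, so the permutation is inverted;
  \<open>q\<close> is the inverse of \<open>p\<close>.\<close>

lemma monomial_blocks_adj:
  assumes "bij_betw p {..<L} {..<L}" "\<And>a. a < L \<Longrightarrow> q (p a) = a"
  shows "adj (monomial_blocks k L f p) = monomial_blocks k L (\<lambda>b. adj (f (q b))) q"
proof -
  have "monomial_blocks k L (\<lambda>b. adj (f (q b))) q = (\<Sum>a<L. blk k (p a) * adj (f (q (p a))) * adj (blk k (q (p a))))"
    unfolding monomial_blocks_def by (rule sum.reindex_bij_betw[OF assms(1), symmetric])
  also have "\<dots> = (\<Sum>a<L. blk k (p a) * adj (f a) * adj (blk k a))"
    using assms(2) by (intro sum.cong) auto
  finally show ?thesis unfolding monomial_blocks_def by (simp add: adj_sum adj_times mult.assoc)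
qed

lemma monomial_blocks_uid: "monomial_blocks k L (\<lambda>_. uid k) (\<lambda>a. a) = uid (L * k)"
  by (simp add: monomial_blocks_def shift_blocks)

lemma corner_blk: "a < L \<Longrightarrow> corner (L * k) (blk k a)"
  by (rule corner_shift) (metis Suc_leI add.commute mult_Suc mult_le_mono1)

lemma corner_monomial_blocks:
  assumes "\<And>a. a < L \<Longrightarrow> p a < L" "\<And>a. a < L \<Longrightarrow> corner k (f a)" "0 < L"
  shows "corner (L * k) (monomial_blocks k L f p)"
proof -
  have "k \<le> L * k" using assms(3) by simp
  then have "corner (L * k) (f a)" if "a < L" for a using corner_mono[OF assms(2)[OF that]] by blast
  then show ?thesis unfolding monomial_blocks_def
    using assms by (intro corner_sum corner_times) (auto simp: corner_blk)
qed

lemma block_column_corner: "\<And>a. a < L \<Longrightarrow> uid (L * k) * block_column k L X = block_column k L X"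
  unfolding block_column_def sum_distrib_left
  by (intro sum.cong refl) (simp add: uid_left corner_blk flip: mult.assoc)

lemma uid_contraction: "norm (uid n * Z) \<le> norm Z"
  using norm_le_opn[of "uid n" Z] mult_right_mono[OF opn_uid_le, of "norm Z" n] by simp

text \<open>Different blocks have orthogonal ranges and act on orthogonal parts of \<open>Z\<close>,
  so Pythagoras applies on both sides.\<close>

lemma opn_block_diagonal:
  assumes f: "\<And>a. a < L \<Longrightarrow> corner k (f a)" "\<And>a. a < L \<Longrightarrow> opn (f a) \<le> M" and "0 \<le> M"
  shows "opn (monomial_blocks k L f (\<lambda>a. a)) \<le> M"
proof (rule opn_least_sq[OF assms(3)])
  fix Z
  let ?x = "\<lambda>a. f a * (adj (blk k a) * Z)"
  have "(norm (monomial_blocks k L f (\<lambda>a. a) * Z))\<^sup>2 = (\<Sum>a<L. \<Sum>b<L. inner (blk k b * ?x b) (blk k a * ?x a))"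
    unfolding norm_sq_fmat monomial_blocks_def sum_distrib_right inner_sum_left inner_sum_right
    by (simp add: mult.assoc)
  also have "\<dots> = (\<Sum>a<L. \<Sum>b<L. if b = a then (norm (?x a))\<^sup>2 else 0)"
  proof (intro sum.cong refl)
    fix a b assume "a \<in> {..<L}" "b \<in> {..<L}"
    then have u: "uid k * ?x a = ?x a" using f(1) by (simp add: uid_left flip: mult.assoc)
    have "inner (blk k b * ?x b) (blk k a * ?x a) = inner (?x b) (adj (blk k b) * (blk k a * ?x a))"
      by (rule inner_times_left)
    then show "inner (blk k b * ?x b) (blk k a * ?x a) = (if b = a then (norm (?x a))\<^sup>2 else 0)"
      unfolding blk_orth_times u by (auto simp: norm_sq_fmat)
  qed
  also have "\<dots> = (\<Sum>a<L. (norm (?x a))\<^sup>2)" by simp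
  also have "\<dots> \<le> (\<Sum>a<L. M\<^sup>2 * (norm (adj (blk k a) * Z))\<^sup>2)"
    unfolding power_mult_distrib[symmetric]
    by (intro sum_mono power_mono order_trans[OF norm_le_opn] mult_right_mono) (auto intro: f(2))
  also have "\<dots> = M\<^sup>2 * (norm (uid (L * k) * Z))\<^sup>2"
  proof -
    have "(\<Sum>a<L. (norm (adj (blk k a) * Z))\<^sup>2) = inner Z (\<Sum>a<L. blk k a * adj (blk k a) * Z)"
      by (simp add: norm_sq_fmat inner_times_left inner_sum_right mult.assoc)
    also have "\<dots> = inner Z (uid (L * k) * (uid (L * k) * Z))"
      by (simp add: shift_blocks flip: sum_distrib_right) (simp flip: mult.assoc)
    finally show ?thesis by (simp add: sum_distrib_left[symmetric] norm_sq_fmat inner_times_left)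
  qed
  also have "\<dots> \<le> M\<^sup>2 * (norm Z)\<^sup>2"
    by (intro mult_left_mono power_mono uid_contraction) auto
  finally show "(norm (monomial_blocks k L f (\<lambda>a. a) * Z))\<^sup>2 \<le> M\<^sup>2 * (norm Z)\<^sup>2" .
qed

text \<open>The ring has no unit, so the zeroth power is the unit of the corner.\<close>

primrec upow :: "nat \<Rightarrow> fmat \<Rightarrow> nat \<Rightarrow> fmat" where
  "upow k V 0 = uid k"
| "upow k V (Suc a) = V * upow k V a"

lemma funitary_upow: "funitary k V \<Longrightarrow> funitary k (upow k V a)"
  by (induction a) (auto intro: funitary_uid funitary_times)

lemma upow_commute: "funitary k V \<Longrightarrow> upow k V a * V = V * upow k V a"
  by (induction a) (auto simp: funitary_def uid_left uid_right mult.assoc)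

section \<open>The cyclic dilation and the choice of its length\<close>

context ideal_norm
begin

text \<open>The triangle inequality is enough: for \<open>V\<close> at most two blocks differ from
  \<open>0\<close>, and for \<open>U\<close> the number \<open>N\<close> of blocks stays fixed while
  the errors tend to \<open>0\<close>.\<close>

lemma nu_block_column: "\<nu> (block_column k L X) \<le> (\<Sum>a<L. \<nu> (X a))"
  unfolding block_column_def
  by (rule order_trans[OF nu_sum]) (intro sum_mono nu_left_contraction opn_isometry_le[OF shift_adj_shift])

text \<open>The palindrome \<open>W 0, \<dots>, W (N - 1), W (N - 1), \<dots>, W 0\<close> closes up to a cycle in which
  neighbours are still within \<open>\<epsilon>\<close>.\<close>

lemma dilation:
  assumes N: "0 < N" and U: "funitary k U" and V: "funitary k V"
    and W: "\<And>a. funitary k (W a)" "\<And>a. opn (W (Suc a) - W a) \<le> \<epsilon>" and "0 \<le> \<epsilon>"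
  shows "\<exists>s U' V' J. funitary s U' \<and> funitary s V' \<and> opn (U' * V' - V' * U') \<le> \<epsilon> \<and>
    adj J * J = uid k \<and> uid s * J = J \<and> J * uid k = J \<and>
    \<nu> (V' * J - J * V) \<le> 2 / sqrt N * \<nu> (uid k) \<and>
    \<nu> (U' * J - J * U) \<le> (\<Sum>a<N. \<nu> (W a - upow k V a * U * adj (upow k V a)))"
proof -
  define L where "L = 2 * N"
  have L: "0 < L" "N < L" "Suc (N - 1) = N" "Suc (L - 1) = L" using N by (auto simp: L_def)
  \<comment> \<open>\<open>\<sigma>\<close> is the cyclic successor, \<open>\<rho>\<close> its
    inverse, and \<open>\<tau>\<close> gives the index of the unitary that the palindrome has at
    position \<open>a\<close>.\<close>
  define \<sigma> where "\<sigma> a = (if Suc a < L then Suc a else 0)" for a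
  define \<rho> where "\<rho> a = (if a = 0 then L - 1 else a - 1)" for a
  define \<tau> where "\<tau> a = (if a < N then a else L - 1 - a)" for a
  define s where "s = L * k"
  define U' where "U' = monomial_blocks k L (\<lambda>a. W (\<tau> a)) (\<lambda>a. a)"
  define V' where "V' = monomial_blocks k L (\<lambda>_. uid k) \<sigma>"
  have cW: "corner k (W a)" for a using W(1)[of a] by (simp add: funitary_def)
  have \<sigma>L: "\<sigma> a < L" if "a < L" for a using that L by (auto simp: \<sigma>_def)
  have \<rho>L: "\<rho> a < L" if "a < L" for a using that L by (auto simp: \<rho>_def)
  have \<rho>\<sigma>: "\<rho> (\<sigma> a) = a" if "a < L" for a using that L by (auto simp: \<sigma>_def \<rho>_def)
  have \<sigma>\<rho>: "\<sigma> (\<rho> a) = a" if "a < L" for a using that L by (auto simp: \<sigma>_def \<rho>_def)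
  have bij: "bij_betw \<sigma> {..<L} {..<L}"
    by (rule bij_betwI[where g = \<rho>]) (auto simp: \<sigma>L \<rho>L \<rho>\<sigma> \<sigma>\<rho>)
  have adjU: "adj U' = monomial_blocks k L (\<lambda>a. adj (W (\<tau> a))) (\<lambda>a. a)"
    unfolding U'_def by (rule monomial_blocks_adj) (auto simp: bij_betw_def)
  have adjV: "adj V' = monomial_blocks k L (\<lambda>_. uid k) \<rho>"
    unfolding V'_def by (subst monomial_blocks_adj[OF bij \<rho>\<sigma>]) simp_all
  have "adj U' * U' = uid s" "U' * adj U' = uid s"
    unfolding adjU unfolding U'_def s_def monomial_blocks_uid[symmetric]
    by (subst monomial_blocks_mult; use W(1) cW in \<open>auto intro!: monomial_blocks_cong simp: funitary_def\<close>)+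
  moreover have "corner s U'" unfolding U'_def s_def by (rule corner_monomial_blocks) (auto simp: cW L)
  ultimately have uU: "funitary s U'" by (simp add: funitary_def)
  have "adj V' * V' = uid s" "V' * adj V' = uid s"
    unfolding adjV unfolding V'_def s_def monomial_blocks_uid[symmetric]
    by (subst monomial_blocks_mult; use \<sigma>L \<rho>L in \<open>auto intro!: monomial_blocks_cong simp: \<rho>\<sigma> \<sigma>\<rho>\<close>)+
  moreover have "corner s V'" unfolding V'_def s_def by (rule corner_monomial_blocks) (auto simp: \<sigma>L L)
  ultimately have uV: "funitary s V'" by (simp add: funitary_def)
  have "U' * V' = monomial_blocks k L (\<lambda>a. W (\<tau> a)) \<sigma>"
    unfolding U'_def V'_def by (subst monomial_blocks_mult) (auto simp: cW uid_right)
  moreover have "V' * U' = monomial_blocks k L (\<lambda>a. W (\<tau> (\<sigma> a))) \<sigma>"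
    unfolding U'_def V'_def by (subst monomial_blocks_mult) (auto simp: cW uid_left \<sigma>L)
  ultimately have "U' * V' - V' * U' = monomial_blocks k L (\<lambda>a. W (\<tau> a) - W (\<tau> (\<sigma> a))) \<sigma>"
    by (simp add: monomial_blocks_def left_diff_distrib right_diff_distrib sum_subtractf)
  \<comment> \<open>Splitting off the shift leaves a block diagonal matrix of differences of
    neighbours.\<close>
  also have "\<dots> = monomial_blocks k L (\<lambda>a. W (\<tau> a) - W (\<tau> (\<sigma> a))) (\<lambda>a. a) * V'"
    unfolding V'_def by (subst monomial_blocks_mult) (auto simp: cW corner_minus uid_right)
  finally have "opn (U' * V' - V' * U') \<le> opn (monomial_blocks k L (\<lambda>a. W (\<tau> a) - W (\<tau> (\<sigma> a))) (\<lambda>a. a)) * opn V'"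
    by (simp add: opn_times)
  also have "\<dots> \<le> \<epsilon> * 1"
  proof (intro mult_mono opn_funitary_le[OF uV] opn_block_diagonal)
    fix a assume a: "a < L"
    show "corner k (W (\<tau> a) - W (\<tau> (\<sigma> a)))" by (intro corner_minus cW)
    \<comment> \<open>The upward half, the downward half, and the turning points
      \<open>a = N - 1\<close> and \<open>a = L - 1\<close>, where the same unitary occurs twice in
      a row.\<close>
    consider "\<tau> (\<sigma> a) = Suc (\<tau> a)" | "\<tau> a = Suc (\<tau> (\<sigma> a))" | "\<tau> a = \<tau> (\<sigma> a)"
    proof -
      consider "Suc a < N" | "Suc a = N" | "N \<le> a" "Suc a < L" | "Suc a = L" using a by linarith
      then show thesis
      proof cases
        case 1 then show thesis using that(1) L by (simp add: \<tau>_def \<sigma>_def)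
      next
        case 2 then show thesis using that(3) L by (simp add: \<tau>_def \<sigma>_def L_def)
      next
        case 3 then show thesis using that(2) L by (simp add: \<tau>_def \<sigma>_def L_def)
      next
        case 4 then show thesis using that(3) L by (simp add: \<tau>_def \<sigma>_def)
      qed
    qed
    then show "opn (W (\<tau> a) - W (\<tau> (\<sigma> a))) \<le> \<epsilon>"
    proof cases
      case 1 then show ?thesis using W(2)[of "\<tau> a"] by (simp add: opn_minus_commute)
    next
      case 2 then show ?thesis using W(2)[of "\<tau> (\<sigma> a)"] by simp
    next
      case 3 then show ?thesis using \<open>0 \<le> \<epsilon>\<close> by simp
    qed
  qed (use \<open>0 \<le> \<epsilon>\<close> in auto)
  finally have comm: "opn (U' * V' - V' * U') \<le> \<epsilon>" by simp
  let ?P = "upow k V"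
  have uP: "funitary k (?P a)" for a by (rule funitary_upow[OF V])
  have cP: "corner k (?P a)" for a using uP[of a] by (simp add: funitary_def)
  \<comment> \<open>The normalisation that makes \<open>N\<close> stacked unitaries an
    isometry.\<close>
  define r where "r = complex_of_real (1 / sqrt N)"
  have r: "cmod r = 1 / sqrt N" "cnj r * r = 1 / of_nat N" "cmod r \<le> 1"
  proof -
    show "cmod r = 1 / sqrt N" unfolding r_def norm_of_real by simp
    have "cnj r * r = of_real (1 / sqrt N * (1 / sqrt N))" by (simp only: r_def complex_cnj_complex_of_real of_real_mult)
    also have "1 / sqrt N * (1 / sqrt N) = 1 / real N" by simp
    finally show "cnj r * r = 1 / of_nat N" by simp
    show "cmod r \<le> 1" unfolding r_def norm_of_real using N by simp
  qed
  define X where "X a = (if a < N then cs r (?P a) else 0)" for a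
  define J where "J = block_column k L X"
  have Xu: "X a * uid k = X a" "uid k * X a = X a" for a using cP by (auto simp: X_def uid_left uid_right)
  have JB: "J * B = block_column k L (\<lambda>a. X a * B)" for B
    by (simp add: J_def block_column_def sum_distrib_right mult.assoc)
  have JJ: "adj J * J = uid k"
  proof -
    have "adj J * J = (\<Sum>a<L. \<Sum>b<L. adj (X a) * (adj (blk k a) * (blk k b * X b)))"
      by (simp add: J_def block_column_def adj_sum sum_product adj_times mult.assoc)
    also have "\<dots> = (\<Sum>a<L. \<Sum>b<L. if a = b then adj (X a) * X a else 0)"
      by (intro sum.cong) (auto simp: blk_orth_times Xu)
    also have "\<dots> = (\<Sum>a<L. adj (X a) * X a)" by simp
    also have "\<dots> = (\<Sum>a<N. adj (X a) * X a)"
      by (rule sum_extend_zero[symmetric]) (use L in \<open>auto simp: X_def\<close>)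
    also have "\<dots> = (\<Sum>a<N. cs (1 / of_nat N) (uid k))"
      using uP by (intro sum.cong) (auto simp: X_def adj_cs funitary_def r(2) mult.commute[of r])
    also have "\<dots> = uid k" using N by (intro fmat_eqI) (simp add: ent_sum ent_cs)
    finally show ?thesis .
  qed
  have "uid s * J = J" unfolding J_def s_def by (rule block_column_corner[OF L(1)])
  moreover have "J * uid k = J" unfolding JB Xu by (simp add: J_def)
  moreover have "\<nu> (V' * J - J * V) \<le> 2 / sqrt N * \<nu> (uid k)"
  proof -
    have "V' * J = block_column k L (\<lambda>a. X (\<sigma> a))"
      unfolding V'_def J_def by (subst monomial_blocks_column) (auto simp: \<sigma>L Xu)
    then have "V' * J - J * V = block_column k L (\<lambda>a. X (\<sigma> a) - X a * V)"
      unfolding JB by (simp add: block_column_def right_diff_distrib sum_subtractf)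
    then have "\<nu> (V' * J - J * V) \<le> (\<Sum>a<L. \<nu> (X (\<sigma> a) - X a * V))" by (simp add: nu_block_column)
    \<comment> \<open>Blocks shift correctly except at \<open>a = N - 1\<close>, where the powers of
      \<open>V\<close> stop, and at \<open>a = L - 1\<close>, where the shift wraps around to the
      zeroth power. Each exception costs one block of size \<open>1 / sqrt N\<close>.\<close>
    also have "\<dots> \<le> (\<Sum>a<L. (if a = N - 1 then \<nu> (uid k) / sqrt N else 0) + (if a = L - 1 then \<nu> (uid k) / sqrt N else 0))"
    proof (intro sum_mono)
      fix a assume "a \<in> {..<L}"
      then consider "Suc a < N" | "a = N - 1" "Suc a = N" | "N \<le> a" "Suc a < L" | "a = L - 1" "Suc a = L" by fastforce
      then show "\<nu> (X (\<sigma> a) - X a * V) \<le> (if a = N - 1 then \<nu> (uid k) / sqrt N else 0) + (if a = L - 1 then \<nu> (uid k) / sqrt N else 0)"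
      proof cases
        case 1
        then have "X (\<sigma> a) - X a * V = 0" using L by (simp add: X_def \<sigma>_def upow_commute[OF V])
        then show ?thesis by simp
      next
        case 2
        have "X (\<sigma> a) = 0" using 2 L by (simp add: X_def \<sigma>_def)
        moreover have "a < N" using 2(2) by simp
        then have "X a * V = cs r (?P (Suc a))" by (simp add: X_def upow_commute[OF V])
        ultimately have "X (\<sigma> a) - X a * V = cs (- r) (?P (Suc a) * uid k)"
          unfolding uid_right[OF cP] by (simp only:) (rule fmat_eqI, simp only: ent_minus ent_zero ent_cs, simp)
        also have "\<nu> \<dots> \<le> cmod (- r) * \<nu> (?P (Suc a) * uid k)" by (rule nu_cs)
        also have "\<dots> \<le> cmod r * \<nu> (uid k)"
          unfolding norm_minus_cancel by (intro mult_left_mono nu_left_contraction opn_funitary_le[OF uP]) simp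
        finally have "\<nu> (X (\<sigma> a) - X a * V) \<le> \<nu> (uid k) / sqrt N" by (simp add: r)
        moreover have "a \<noteq> L - 1" using 2 L by linarith
        ultimately show ?thesis using 2(1) by simp
      next
        case 3
        then have "X (\<sigma> a) - X a * V = 0" using L by (simp add: X_def \<sigma>_def)
        then show ?thesis by simp
      next
        case 4
        then have "\<not> a < N" using L by linarith
        then have "X (\<sigma> a) - X a * V = cs r (uid k)" using 4 N by (simp add: X_def \<sigma>_def)
        then have "\<nu> (X (\<sigma> a) - X a * V) \<le> \<nu> (uid k) / sqrt N" using nu_cs[of r "uid k"] by (simp add: r)
        moreover have "a \<noteq> N - 1" using 4 L by linarith
        ultimately show ?thesis using 4(1) by simp
      qed
    qed
    also have "\<dots> = 2 / sqrt N * \<nu> (uid k)" using L by (simp add: sum.distrib)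
    finally show ?thesis .
  qed
  moreover have "\<nu> (U' * J - J * U) \<le> (\<Sum>a<N. \<nu> (W a - ?P a * U * adj (?P a)))"
  proof -
    have "U' * J = block_column k L (\<lambda>a. W (\<tau> a) * X a)"
      unfolding U'_def J_def by (subst monomial_blocks_column) (auto simp: cW)
    then have "U' * J - J * U = block_column k L (\<lambda>a. W (\<tau> a) * X a - X a * U)"
      unfolding JB by (simp add: block_column_def right_diff_distrib sum_subtractf)
    then have "\<nu> (U' * J - J * U) \<le> (\<Sum>a<L. \<nu> (W (\<tau> a) * X a - X a * U))" by (simp add: nu_block_column)
    also have "\<dots> = (\<Sum>a<N. \<nu> (W (\<tau> a) * X a - X a * U))"
      by (rule sum_extend_zero[symmetric]) (use L in \<open>auto simp: X_def\<close>)
    also have "\<dots> \<le> (\<Sum>a<N. \<nu> (W a - ?P a * U * adj (?P a)))"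
    proof (intro sum_mono)
      fix a assume "a \<in> {..<N}"
      then have a: "a < N" by simp
      \<comment> \<open>Moved to the left of the power, \<open>U\<close> in block \<open>a\<close>
        of \<open>J * U\<close> becomes its conjugate, which is what \<open>W a\<close>
        approximates.\<close>
      have "?P a * U * adj (?P a) * ?P a = ?P a * U"
        using uP[of a] U by (simp add: funitary_def mult.assoc uid_right)
      then have "W (\<tau> a) * X a - X a * U = cs r ((W a - ?P a * U * adj (?P a)) * ?P a)"
        using a by (simp add: \<tau>_def X_def left_diff_distrib cs_diff)
      also have "\<nu> \<dots> \<le> cmod r * \<nu> ((W a - ?P a * U * adj (?P a)) * ?P a)" by (rule nu_cs)
      also have "\<dots> \<le> 1 * \<nu> (W a - ?P a * U * adj (?P a))"
        by (intro mult_mono r nu_right_contraction opn_funitary_le[OF uP]) auto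
      finally show "\<nu> (W (\<tau> a) * X a - X a * U) \<le> \<nu> (W a - ?P a * U * adj (?P a))" by simp
    qed
    finally show ?thesis .
  qed
  ultimately show ?thesis using uU uV comm JJ by blast
qed

lemma conj_orbit_upow:
  assumes "sunitary k U" "sunitary k V"
  shows "conj_orbit U V a n = upow (k n) (V n) a * U n * adj (upow (k n) (V n) a)"
proof (induction a)
  case 0
  have "corner (k n) (U n)" using assms(1) by (simp add: sunitary_def funitary_def)
  then show ?case by (simp add: uid_left uid_right)
next
  case (Suc a)
  then show ?case by (simp add: seq_sel adj_times mult.assoc)
qed

text \<open>The growing length \<open>N\<close> is never constructed. For each \<open>n\<close> an
  admissible datum within \<open>1 / Suc n\<close> of the infimal error is taken; up to that margin
  it is as good as the data of any fixed \<open>N\<close>, along any filter finer than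
  \<open>sequentially\<close>.\<close>

lemma select_almost_optimal:
  fixes e :: "nat \<Rightarrow> 'd \<Rightarrow> real"
  assumes "\<And>n. \<exists>d. Q n d" "\<And>n d. 0 \<le> e n d"
    and "\<And>\<delta>. 0 < \<delta> \<Longrightarrow> \<forall>\<^sub>F n in G. \<exists>d. Q n d \<and> e n d \<le> \<delta>"
  shows "\<exists>D. (\<forall>n. Q n (D n)) \<and> ((\<lambda>n. e n (D n)) \<longlongrightarrow> 0) G"
proof -
  define m where "m n = Inf {e n d | d. Q n d}" for n
  have ne: "{e n d | d. Q n d} \<noteq> {}" and bb: "bdd_below {e n d | d. Q n d}" for n
    using assms(1)[of n] assms(2) by (auto intro: bdd_belowI[of _ 0])
  have "\<exists>d. Q n d \<and> e n d < m n + 1 / Suc n" for n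
  proof -
    have "Inf {e n d | d. Q n d} < m n + 1 / Suc n" by (simp add: m_def)
    then show ?thesis unfolding cInf_less_iff[OF ne bb] by auto
  qed
  then obtain D where D: "\<And>n. Q n (D n)" "\<And>n. e n (D n) < m n + 1 / Suc n" by metis
  have "((\<lambda>n. e n (D n)) \<longlongrightarrow> 0) G"
  proof (rule tendstoI)
    fix x :: real assume "0 < x"
    have "\<forall>\<^sub>F n in G. \<exists>d. Q n d \<and> e n d \<le> x / 2" using assms(3)[of "x/2"] \<open>0 < x\<close> by simp
    moreover have "\<forall>\<^sub>F n in G. 1 / real (Suc n) < x / 2"
    proof -
      have "(\<lambda>n. 1 / real (Suc n)) \<longlonglongrightarrow> 0" using LIMSEQ_inverse_real_of_nat by (simp add: inverse_eq_divide)
      from order_tendstoD(2)[OF tendsto_mono[OF G_le this], of "x/2"] show ?thesis using \<open>0 < x\<close> by simp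
    qed
    ultimately show "\<forall>\<^sub>F n in G. dist (e n (D n)) 0 < x"
    proof eventually_elim
      case (elim n)
      then obtain d where d: "Q n d" "e n d \<le> x / 2" by blast
      then have "m n \<le> x / 2" unfolding m_def by (intro cInf_lower2[OF _ _ bb]) auto
      then show ?case using D(2)[of n] elim(2) assms(2)[of n "D n"] by simp
    qed
  qed
  then show ?thesis using D(1) by blast
qed

lemma dilation_seq:
  assumes k: "\<And>n. 0 < k n" and U: "sunitary k U" and V: "sunitary k V" and "0 \<le> \<epsilon>"
    and dom: "\<And>c. \<epsilon> < c \<Longrightarrow> dominated k c (U * V - V * U)"
  shows "\<exists>s U' V' J. sunitary s U' \<and> sunitary s V' \<and> (\<forall>n. opn (U' n * V' n - V' n * U' n) \<le> \<epsilon>) \<and>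
    sadj J * J = suid k \<and> suid s * J = J \<and> J * suid k = J \<and> close k (U' * J) (J * U) \<and> close k (V' * J) (J * V)"
proof -
  obtain W where W: "\<And>j. sunitary k (W j)" "\<And>j. close k (W j) (conj_orbit U V j)"
    "\<And>j n. opn (W (Suc j) n - W j n) \<le> \<epsilon>"
    using orbit_lift[OF k U V assms(4) dom] by blast
  \<comment> \<open>\<open>Q n\<close> collects what must hold exactly for every \<open>n\<close>;
    \<open>e n\<close> is the error that has to tend to \<open>0\<close>.\<close>
  define Q where "Q n = (\<lambda>(s, U', V', J). funitary s U' \<and> funitary s V' \<and> opn (U' * V' - V' * U') \<le> \<epsilon> \<and>
    adj J * J = uid (k n) \<and> uid s * J = J \<and> J * uid (k n) = J)" for n
  define e where "e n = (\<lambda>(s :: nat, U', V', J). w (k n) * (\<nu> (V' * J - J * V n) + \<nu> (U' * J - J * U n)))" for n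
  have dil: "\<exists>d. Q n d \<and> e n d \<le> 2 / sqrt N + (\<Sum>a<N. w (k n) * \<nu> (W a n - conj_orbit U V a n))" if N0: "0 < N" for N n :: nat
  proof -
    obtain s U' V' J where d: "Q n (s, U', V', J)" "\<nu> (V' * J - J * V n) \<le> 2 / sqrt N * \<nu> (uid (k n))"
      "\<nu> (U' * J - J * U n) \<le> (\<Sum>a<N. \<nu> (W a n - conj_orbit U V a n))"
      using dilation[OF N0, of "k n" "U n" "V n" "\<lambda>a. W a n" \<epsilon>] U V W(1,3) assms(4)
      unfolding Q_def case_prod_conv conj_orbit_upow[OF U V] by (auto simp: sunitary_def)
    have "e n (s, U', V', J) \<le> w (k n) * (2 / sqrt N * \<nu> (uid (k n)) + (\<Sum>a<N. \<nu> (W a n - conj_orbit U V a n)))"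
      unfolding e_def case_prod_conv by (intro mult_left_mono add_mono d) simp
    also have "\<dots> = 2 / sqrt N * (w (k n) * \<nu> (uid (k n))) + (\<Sum>a<N. w (k n) * \<nu> (W a n - conj_orbit U V a n))"
      by (simp add: algebra_simps sum_distrib_left)
    also have "\<dots> \<le> 2 / sqrt N * 1 + (\<Sum>a<N. w (k n) * \<nu> (W a n - conj_orbit U V a n))"
      by (intro add_right_mono mult_left_mono w_uid[OF k]) simp
    finally show ?thesis using d(1) by auto
  qed
  have "\<exists>D. (\<forall>n. Q n (D n)) \<and> ((\<lambda>n. e n (D n)) \<longlongrightarrow> 0) G"
  proof (rule select_almost_optimal)
    show "\<exists>d. Q n d" for n using dil[of 1 n] by auto
    show "0 \<le> e n d" for n d by (cases d) (simp add: e_def)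
    fix \<delta> :: real assume "0 < \<delta>"
    \<comment> \<open>\<open>N\<close> is determined by \<delta> first; only then are the
      \<open>N\<close> distances to the orbit made small.\<close>
    obtain N where N: "0 < N" "2 / sqrt (real N) \<le> \<delta> / 2"
    proof -
      obtain N where N: "(4 / \<delta>)\<^sup>2 < real N" using reals_Archimedean2 by blast
      have "0 < real N" using N by (rule le_less_trans[rotated]) simp
      have "4 / \<delta> < sqrt (real N)" using N \<open>0 < \<delta>\<close> by (intro real_less_rsqrt) auto
      then have "2 / sqrt (real N) \<le> \<delta> / 2" using \<open>0 < \<delta>\<close> \<open>0 < real N\<close> by (simp add: field_simps)
      then show thesis using that[of N] \<open>0 < real N\<close> by simp
    qed
    have "((\<lambda>n. \<Sum>a<N. w (k n) * \<nu> (W a n - conj_orbit U V a n)) \<longlongrightarrow> (\<Sum>a<N. 0)) G"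
      using W(2) by (intro tendsto_sum) (simp add: close_def null_def seq_sel)
    then have "\<forall>\<^sub>F n in G. (\<Sum>a<N. w (k n) * \<nu> (W a n - conj_orbit U V a n)) < \<delta> / 2"
      using \<open>0 < \<delta>\<close> by (intro order_tendstoD(2)) auto
    then show "\<forall>\<^sub>F n in G. \<exists>d. Q n d \<and> e n d \<le> \<delta>"
    proof (rule eventually_mono)
      fix n assume n: "(\<Sum>a<N. w (k n) * \<nu> (W a n - conj_orbit U V a n)) < \<delta> / 2"
      show "\<exists>d. Q n d \<and> e n d \<le> \<delta>" using dil[OF N(1), of n] N(2) n by force
    qed
  qed
  then obtain D where D: "\<And>n. Q n (D n)" "((\<lambda>n. e n (D n)) \<longlongrightarrow> 0) G" by blast
  define s where "s n = fst (D n)" for n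
  define U' where "U' n = fst (snd (D n))" for n
  define V' where "V' n = fst (snd (snd (D n)))" for n
  define J where "J n = snd (snd (snd (D n)))" for n
  have Deq: "D n = (s n, U' n, V' n, J n)" for n by (simp add: s_def U'_def V'_def J_def)
  have QD: "funitary (s n) (U' n)" "funitary (s n) (V' n)" "opn (U' n * V' n - V' n * U' n) \<le> \<epsilon>"
    "adj (J n) * J n = uid (k n)" "uid (s n) * J n = J n" "J n * uid (k n) = J n" for n
    using D(1)[of n] unfolding Q_def Deq by auto
  have lim: "((\<lambda>n. w (k n) * (\<nu> (V' n * J n - J n * V n) + \<nu> (U' n * J n - J n * U n))) \<longlongrightarrow> 0) G"
    using D(2) unfolding e_def Deq by simp
  have "close k (U' * J) (J * U)" "close k (V' * J) (J * V)"
    unfolding close_def by (rule null_sandwich[OF _ lim], simp add: seq_sel mult_left_mono)+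
  then show ?thesis using QD
    by (intro exI[of _ s] exI[of _ U'] exI[of _ V'] exI[of _ J]) (auto simp: sunitary_def fun_eq_iff seq_sel)
qed

end

section \<open>Representations of the soft torus\<close>

lemma star_homD:
  assumes "h \<in> star_hom A B" "x \<in> carrier A"
  shows "h x \<in> carrier B" "h (cscale A c x) = cscale B c (h x)" "h (star A x) = star B (h x)"
    "y \<in> carrier A \<Longrightarrow> h (x \<oplus>\<^bsub>A\<^esub> y) = h x \<oplus>\<^bsub>B\<^esub> h y"
    "y \<in> carrier A \<Longrightarrow> h (x \<otimes>\<^bsub>A\<^esub> y) = h x \<otimes>\<^bsub>B\<^esub> h y"
  using assms unfolding star_hom_def by auto

definition semb :: "(nat \<Rightarrow> complex mat) \<Rightarrow> nat \<Rightarrow> fmat" where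
  "semb x = (\<lambda>n. emb (x n))"
definition smat :: "(nat \<Rightarrow> nat) \<Rightarrow> (nat \<Rightarrow> fmat) \<Rightarrow> nat \<Rightarrow> complex mat" where
  "smat k X = (\<lambda>n. tomat (k n) (k n) (X n))"

lemma semb_smat: "scorner k X \<Longrightarrow> semb (smat k X) = X"
  by (auto simp: semb_def smat_def scorner_def emb_tomat)

lemma mat_prod_carrier_iff:
  "x \<in> carrier (mat_prod k) \<longleftrightarrow> (\<forall>n. x n \<in> carrier_mat (k n) (k n)) \<and> bdd (semb x)"
  unfolding mat_prod_carrier bdd_def semb_def ..

lemma scorner_semb: "x \<in> carrier (mat_prod k) \<Longrightarrow> scorner k (semb x)"
  by (simp add: mat_prod_carrier_iff scorner_def semb_def corner_emb)
lemma bdd_semb: "x \<in> carrier (mat_prod k) \<Longrightarrow> bdd (semb x)"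
  by (simp add: mat_prod_carrier_iff)

lemma smat_carrier: "scorner k X \<Longrightarrow> bdd X \<Longrightarrow> smat k X \<in> carrier (mat_prod k)"
  by (simp add: mat_prod_carrier_iff semb_smat) (simp add: smat_def)

lemma semb_inj:
  assumes "x \<in> carrier (mat_prod k)" "y \<in> carrier (mat_prod k)" "semb x = semb y" shows "x = y"
proof
  fix n
  have "emb (x n) = emb (y n)" using fun_cong[OF assms(3), of n] unfolding semb_def .
  then show "x n = y n"
    using assms(1,2) by (intro emb_inj[of "x n" "k n" "k n"]) (auto simp: mat_prod_carrier_iff)
qed

lemma semb_sel:
  assumes "x \<in> carrier (mat_prod k)"
  shows "semb (cscale (mat_prod k) c x) = scs c (semb x)"
    "semb (star (mat_prod k) x) = sadj (semb x)"
    "y \<in> carrier (mat_prod k) \<Longrightarrow> semb (x \<oplus>\<^bsub>mat_prod k\<^esub> y) = semb x + semb y"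
    "y \<in> carrier (mat_prod k) \<Longrightarrow> semb (x \<otimes>\<^bsub>mat_prod k\<^esub> y) = semb x * semb y"
    "y \<in> carrier (mat_prod k) \<Longrightarrow> semb (x \<ominus>\<^bsub>mat_prod k\<^esub> y) = semb x - semb y"
proof -
  have xc: "x n \<in> carrier_mat (k n) (k n)" for n using assms by (simp add: mat_prod_carrier_iff)
  show "semb (cscale (mat_prod k) c x) = scs c (semb x)"
    by (simp add: fun_eq_iff semb_def seq_sel mat_prod_sel emb_smult)
  show "semb (star (mat_prod k) x) = sadj (semb x)"
    by (simp add: fun_eq_iff semb_def seq_sel mat_prod_sel emb_adjoint)
  assume y: "y \<in> carrier (mat_prod k)"
  then have yc: "y n \<in> carrier_mat (k n) (k n)" for n by (simp add: mat_prod_carrier_iff)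
  show "semb (x \<oplus>\<^bsub>mat_prod k\<^esub> y) = semb x + semb y"
    by (simp add: fun_eq_iff semb_def seq_sel mat_prod_sel emb_add[OF xc yc])
  show "semb (x \<otimes>\<^bsub>mat_prod k\<^esub> y) = semb x * semb y"
    by (simp add: fun_eq_iff semb_def seq_sel mat_prod_sel emb_mult carrier_matD[OF xc] carrier_matD[OF yc])
  show "semb (x \<ominus>\<^bsub>mat_prod k\<^esub> y) = semb x - semb y"
    by (simp add: fun_eq_iff semb_def seq_sel mat_prod_minus[OF assms y])
qed

lemma semb_one: "semb \<one>\<^bsub>mat_prod k\<^esub> = suid k"
  by (simp add: fun_eq_iff semb_def seq_sel mat_prod_sel emb_one)
lemma semb_zero: "semb \<zero>\<^bsub>mat_prod k\<^esub> = 0"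
  by (simp add: fun_eq_iff semb_def seq_sel mat_prod_sel emb_zero)

lemma smat_ops:
  assumes "scorner k X" "bdd X"
  shows "smat k (scs c X) = cscale (mat_prod k) c (smat k X)"
    "smat k (sadj X) = star (mat_prod k) (smat k X)"
    "scorner k Y \<Longrightarrow> bdd Y \<Longrightarrow> smat k (X + Y) = smat k X \<oplus>\<^bsub>mat_prod k\<^esub> smat k Y"
    "scorner k Y \<Longrightarrow> bdd Y \<Longrightarrow> smat k (X * Y) = smat k X \<otimes>\<^bsub>mat_prod k\<^esub> smat k Y"
proof -
  interpret M: cstar_algebra "mat_prod k" by (rule mat_prod_cstar)
  note c = smat_carrier[OF assms]
  show "smat k (scs c X) = cscale (mat_prod k) c (smat k X)"
    using assms c by (intro semb_inj[of _ k] smat_carrier M.scale_closed)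
      (auto simp: semb_sel semb_smat scorner_intros bdd_scs)
  show "smat k (sadj X) = star (mat_prod k) (smat k X)"
    using assms c by (intro semb_inj[of _ k] smat_carrier M.star_closed)
      (auto simp: semb_sel semb_smat scorner_intros bdd_sadj)
  assume Y: "scorner k Y" "bdd Y"
  note d = smat_carrier[OF Y]
  show "smat k (X + Y) = smat k X \<oplus>\<^bsub>mat_prod k\<^esub> smat k Y"
    using assms Y c d by (intro semb_inj[of _ k] smat_carrier M.a_closed)
      (auto simp: semb_sel semb_smat scorner_intros bdd_intros)
  show "smat k (X * Y) = smat k X \<otimes>\<^bsub>mat_prod k\<^esub> smat k Y"
    using assms Y c d by (intro semb_inj[of _ k] smat_carrier M.m_closed)
      (auto simp: semb_sel semb_smat scorner_intros bdd_intros)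
qed

lemma smat_star_hom:
  assumes "\<And>x. x \<in> carrier A \<Longrightarrow> scorner k (\<Psi> x)" "\<And>x. x \<in> carrier A \<Longrightarrow> bdd (\<Psi> x)"
    and "\<And>x y. x \<in> carrier A \<Longrightarrow> y \<in> carrier A \<Longrightarrow> \<Psi> (x \<oplus>\<^bsub>A\<^esub> y) = \<Psi> x + \<Psi> y"
    and "\<And>x y. x \<in> carrier A \<Longrightarrow> y \<in> carrier A \<Longrightarrow> \<Psi> (x \<otimes>\<^bsub>A\<^esub> y) = \<Psi> x * \<Psi> y"
    and "\<And>c x. x \<in> carrier A \<Longrightarrow> \<Psi> (cscale A c x) = scs c (\<Psi> x)"
    and "\<And>x. x \<in> carrier A \<Longrightarrow> \<Psi> (star A x) = sadj (\<Psi> x)"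
  shows "(\<lambda>x. smat k (\<Psi> x)) \<in> star_hom A (mat_prod k)"
  unfolding star_hom_def using assms by (simp add: smat_carrier smat_ops)

text \<open>The homomorphism carries the equation of \<open>contraction_complement\<close> into the
  matrices, where the quadratic form gives operator norm at most \<open>1\<close>. The strict bound
  by \<open>c\<close> allows rescaling \<open>a\<close> to norm below \<open>1\<close>.\<close>

lemma unital_hom_contractive:
  assumes "cstar_algebra A" "h \<in> star_hom A (mat_prod s)" "h \<one>\<^bsub>A\<^esub> = \<one>\<^bsub>mat_prod s\<^esub>"
    and a: "a \<in> carrier A" "cnorm A a < c"
  shows "opn (semb (h a) n) \<le> c"
proof -
  interpret cstar_algebra A by fact
  note h = star_homD[OF assms(2)]
  have c: "0 < c" using norm_nonneg[OF a(1)] a(2) by simp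
  define a' where "a' = cscale A (of_real (1 / c)) a"
  have a': "a' \<in> carrier A" using a(1) by (simp add: a'_def scale_closed)
  have "cnorm A a' < 1" using a c by (simp add: a'_def norm_scale norm_divide)
  then obtain b where b: "b \<in> carrier A" "star A b \<otimes>\<^bsub>A\<^esub> b \<oplus>\<^bsub>A\<^esub> star A a' \<otimes>\<^bsub>A\<^esub> a' = \<one>\<^bsub>A\<^esub>"
    using contraction_complement[OF a'] by blast
  let ?a = "semb (h a')" and ?b = "semb (h b)"
  interpret M: cstar_algebra "mat_prod s" by (rule mat_prod_cstar)
  note hc = h(1)[OF a'] h(1)[OF b(1)]
  have "sadj ?b * ?b + sadj ?a * ?a = semb (h (star A b \<otimes>\<^bsub>A\<^esub> b \<oplus>\<^bsub>A\<^esub> star A a' \<otimes>\<^bsub>A\<^esub> a'))"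
    using a' b(1) hc by (simp add: h star_closed semb_sel M.star_closed)
  also have "\<dots> = suid s" unfolding b(2) assms(3) by (rule semb_one)
  finally have eq: "adj (?b n) * ?b n + adj (?a n) * ?a n = uid (s n)"
    by (metis seq_sel(1,3,6,8))
  have "opn (?a n) \<le> 1"
  proof (rule opn_least_sq)
    fix Z
    have n: "(norm (X * Z))\<^sup>2 = inner Z (adj X * X * Z)" for X
      by (simp add: norm_sq_fmat inner_times_left mult.assoc)
    have "(norm (?a n * Z))\<^sup>2 \<le> (norm (?b n * Z))\<^sup>2 + (norm (?a n * Z))\<^sup>2" by simp
    also have "\<dots> = inner Z ((adj (?b n) * ?b n + adj (?a n) * ?a n) * Z)"
      unfolding n by (simp add: distrib_right inner_add_right)
    also have "\<dots> \<le> norm Z * norm (uid (s n) * Z)" unfolding eq by (rule norm_cauchy_schwarz)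
    also have "\<dots> \<le> norm Z * norm Z" by (intro mult_left_mono uid_contraction) simp
    finally show "(norm (?a n * Z))\<^sup>2 \<le> 1\<^sup>2 * (norm Z)\<^sup>2" by (simp add: power2_eq_square)
  qed simp
  moreover have "semb (h a) = scs (of_real c) ?a"
  proof -
    have "a = cscale A (of_real c) a'"
      using a(1) c by (simp add: a'_def scale_scale scale_one flip: of_real_mult)
    then show ?thesis using h(2)[OF a', of "of_real c"] semb_sel(1)[OF hc(1)] by metis
  qed
  ultimately show ?thesis using c by (simp add: seq_sel opn_cs)
qed

section \<open>The asymptotic intertwiner\<close>

context ideal_norm
begin

lemma close_eq: "X = Y \<Longrightarrow> close k X Y"
  by simp

text \<open>Cutting \<open>J\<close> down by \<open>P\<close> removes the corner on which the lift
  \<open>U\<close> was declared to be the unit: \<open>U * P\<close> is close to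
  \<open>\<Phi> x\<close> and hence to \<open>P * \<Phi> x\<close>.\<close>

lemma compressed_intertwiner:
  assumes "cstar_algebra A" "hom_mod k A \<Phi>" and x: "x \<in> carrier A"
    and U: "bdd U" "close k U (\<Phi> x + (suid k - \<Phi> \<one>\<^bsub>A\<^esub>))"
    and P: "bdd P" "close k P (\<Phi> \<one>\<^bsub>A\<^esub>)" and J: "bdd J" "close k (U' * J) (J * U)"
  shows "close k (U' * (J * P)) (J * P * \<Phi> x)"
proof -
  interpret cstar_algebra A by fact
  note h = hom_modD[OF assms(2)]
  let ?e = "\<Phi> \<one>\<^bsub>A\<^esub>"
  have b: "bdd (\<Phi> x + (suid k - ?e))" "bdd ?e" using h x by (auto intro!: bdd_intros bdd_suid)
  have x1: "close k (\<Phi> x * ?e) (\<Phi> x)" using close_sym[OF h(6)[OF x one_closed]] x by simp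
  have ee: "close k (?e * ?e) ?e" using close_sym[OF h(6)[OF one_closed one_closed]] by simp
  have ex: "close k (\<Phi> x) (?e * \<Phi> x)" using h(6)[OF one_closed x] x by simp
  have "close k (U * P) ((\<Phi> x + (suid k - ?e)) * ?e)" by (intro close_mult U P b)
  also have "(\<Phi> x + (suid k - ?e)) * ?e = \<Phi> x * ?e + (?e - ?e * ?e)"
    using suid_left[OF h(1)[OF one_closed]] by (simp add: distrib_right left_diff_distrib)
  also have "close k (\<Phi> x * ?e + (?e - ?e * ?e)) (\<Phi> x + (?e - ?e))"
    by (intro close_add close_diff close_refl x1 ee)
  also have "\<Phi> x + (?e - ?e) = \<Phi> x" by simp
  also have "close k (\<Phi> x) (?e * \<Phi> x)" by (rule ex)
  also have "close k (?e * \<Phi> x) (P * \<Phi> x)" by (intro close_right h x close_sym[OF P(2)])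
  finally have 1: "close k (U * P) (P * \<Phi> x)" .
  have "close k (U' * J * P) (J * U * P)" by (rule close_right[OF P(1) J(2)])
  then have 2: "close k (U' * (J * P)) (J * (U * P))" unfolding mult.assoc .
  have 3: "close k (J * (U * P)) (J * (P * \<Phi> x))" by (rule close_left[OF J(1) 1])
  show ?thesis unfolding mult.assoc by (rule close_trans[OF 2 3])
qed

text \<open>The dilated pair satisfies the relations exactly, so the universal property yields
  \<open>\<pi>\<close>. The intertwining relation holds for the generators and spreads to
  \<open>A\<close>, because the elements that satisfy it together with their adjoints form a
  C*-subalgebra.\<close>

lemma soft_torus_dilation:
  assumes k: "\<And>n. 0 < k n" and "0 \<le> \<epsilon>" and torus: "is_soft_torus \<epsilon> A u v" and hom: "hom_mod k A \<Phi>"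
  shows "\<exists>s \<pi> \<Gamma>. \<pi> \<in> star_hom A (mat_prod s) \<and> \<pi> \<one>\<^bsub>A\<^esub> = \<one>\<^bsub>mat_prod s\<^esub> \<and>
    \<Gamma> * sadj \<Gamma> * \<Gamma> = \<Gamma> \<and> suid s * \<Gamma> = \<Gamma> \<and> \<Gamma> * suid k = \<Gamma> \<and> bdd \<Gamma> \<and>
    close k (sadj \<Gamma> * \<Gamma>) (\<Phi> \<one>\<^bsub>A\<^esub>) \<and> (\<forall>a\<in>carrier A. close k (semb (\<pi> a) * \<Gamma>) (\<Gamma> * \<Phi> a))"
proof -
  have cA: "cstar_algebra A" and pair: "soft_pair \<epsilon> A u v" and gen: "cstar_generated A {u, v} = carrier A"
    using torus by (auto simp: is_soft_torus_def)
  interpret A: cstar_algebra A by (rule cA)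
  note h = hom_modD[OF hom]
  let ?e = "\<Phi> \<one>\<^bsub>A\<^esub>"
  have uv: "unitary_elem A u" "unitary_elem A v" "u \<in> carrier A" "v \<in> carrier A"
    using pair by (auto simp: soft_pair_def unitary_elem_def)
  have ee: "close k (?e * ?e) ?e" "close k (sadj ?e) ?e"
    using close_sym[OF h(6)[OF A.one_closed A.one_closed]] close_sym[OF h(4)[OF A.one_closed]] A.star_one by auto
  obtain P where P: "scorner k P" "sadj P = P" "P * P = P" "close k P ?e"
    using projection_lift[OF k h(1,2)[OF A.one_closed] ee(2,1)] by auto
  obtain U where U: "sunitary k U" "close k U (\<Phi> u + (suid k - ?e))"
    using unitary_elem_lift[OF k cA hom uv(1)] by blast
  obtain V where V: "sunitary k V" "close k V (\<Phi> v + (suid k - ?e))"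
    using unitary_elem_lift[OF k cA hom uv(2)] by blast
  obtain s U' V' J where D: "sunitary s U'" "sunitary s V'" "\<And>n. opn (U' n * V' n - V' n * U' n) \<le> \<epsilon>"
    "sadj J * J = suid k" "suid s * J = J" "J * suid k = J" "close k (U' * J) (J * U)" "close k (V' * J) (J * V)"
    using dilation_seq[OF k U(1) V(1) assms(2) commutator_dominated[OF k cA hom pair U V P]] by blast
  have bP: "bdd P"
  proof -
    have "opn (P n) \<le> 1" for n
    proof -
      have "adj (P n) * P n = P n" using fun_cong[OF P(2), of n] fun_cong[OF P(3), of n] by (simp add: seq_sel)
      then have "(opn (P n))\<^sup>2 = opn (P n)" using opn_cstar[of "P n"] by simp
      then show ?thesis by (auto simp: power2_eq_square)
    qed
    then show ?thesis unfolding bdd_def by blast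
  qed
  have bJ: "bdd J"
  proof -
    have "opn (J n) \<le> 1" for n
      using fun_cong[OF D(4), of n] by (intro opn_isometry_le[of _ "k n"]) (simp add: seq_sel)
    then show ?thesis unfolding bdd_def by blast
  qed
  \<comment> \<open>A partial isometry with initial projection \<open>P\<close>, matching the
    possibly non-unital \<open>\<Phi>\<close>.\<close>
  define \<Gamma> where "\<Gamma> = J * P"
  have b\<Gamma>: "bdd \<Gamma>" unfolding \<Gamma>_def by (intro bdd_intros bJ bP)
  have \<Gamma>\<Gamma>: "sadj \<Gamma> * \<Gamma> = P"
  proof -
    have "sadj \<Gamma> * \<Gamma> = P * (sadj J * J) * P" by (simp add: \<Gamma>_def P(2) mult.assoc)
    then show ?thesis unfolding D(4) using P(1,3) by (simp add: suid_right)
  qed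
  have \<Gamma>: "\<Gamma> * sadj \<Gamma> * \<Gamma> = \<Gamma>" "suid s * \<Gamma> = \<Gamma>" "\<Gamma> * suid k = \<Gamma>"
    using \<Gamma>\<Gamma> P(1,3) D(5) by (simp_all add: mult.assoc suid_right) (simp_all add: \<Gamma>_def mult.assoc suid_right P(3) flip: mult.assoc[of "suid s"])
  have pair': "soft_pair \<epsilon> (mat_prod s) (smat s U') (smat s V')"
  proof -
    interpret M: cstar_algebra "mat_prod s" by (rule mat_prod_cstar)
    have c: "smat s X \<in> carrier (mat_prod s)" if "sunitary s X" for X
      using sunitaryD[OF that] by (simp add: smat_carrier)
    have un: "unitary_elem (mat_prod s) (smat s X)" if "sunitary s X" for X
      unfolding unitary_elem_def using sunitaryD[OF that] c[OF that]
      by (auto intro!: semb_inj[of _ s] simp: M.star_closed semb_sel semb_one semb_smat)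
    have "cnorm (mat_prod s) (smat s U' \<otimes>\<^bsub>mat_prod s\<^esub> smat s V' \<ominus>\<^bsub>mat_prod s\<^esub> smat s V' \<otimes>\<^bsub>mat_prod s\<^esub> smat s U') \<le> \<epsilon>"
      (is "cnorm _ ?x \<le> \<epsilon>")
    proof -
      have x: "?x \<in> carrier (mat_prod s)" using c D(1,2) by simp
      have "semb ?x = U' * V' - V' * U'"
        using c D(1,2) sunitaryD(1)[OF D(1)] sunitaryD(1)[OF D(2)] by (simp add: semb_sel semb_smat)
      then have "opn (semb ?x n) \<le> \<epsilon>" for n using D(3)[of n] by (simp only: seq_sel)
      then have "opn (emb (?x n)) \<le> \<epsilon>" for n unfolding semb_def .
      then have "mat_op_norm (?x n) \<le> \<epsilon>" for n
        using x by (simp add: mat_prod_carrier_iff mat_op_norm_emb[of _ "s n"])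
      then show ?thesis
        unfolding mat_prod_def by (intro bounded_prod_norm_least[OF mat_algebra_cstar]) simp
    qed
    then show ?thesis using un D(1,2) by (simp add: soft_pair_def)
  qed
  obtain \<pi> where \<pi>: "\<pi> \<in> star_hom A (mat_prod s)" "\<pi> \<one>\<^bsub>A\<^esub> = \<one>\<^bsub>mat_prod s\<^esub>" "\<pi> u = smat s U'" "\<pi> v = smat s V'"
    using torus pair' mat_prod_cstar[of s] unfolding is_soft_torus_def by blast
  note hp = star_homD[OF \<pi>(1)]
  define T where "T a \<longleftrightarrow> close k (semb (\<pi> a) * \<Gamma>) (\<Gamma> * \<Phi> a)" for a
  \<comment> \<open>Taking adjoints in \<open>T a\<close> gives a relation for
    \<open>sadj \<Gamma>\<close> on the other side, not \<open>T (star A a)\<close>; so both are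
    demanded.\<close>
  define S where "S = {a \<in> carrier A. T a \<and> T (star A a)}"
  have T_add: "T (x \<oplus>\<^bsub>A\<^esub> y)" if "x \<in> carrier A" "y \<in> carrier A" "T x" "T y" for x y
  proof -
    have "close k (semb (\<pi> (x \<oplus>\<^bsub>A\<^esub> y)) * \<Gamma>) (semb (\<pi> x) * \<Gamma> + semb (\<pi> y) * \<Gamma>)"
      using that hp by (intro close_eq) (simp add: semb_sel distrib_right)
    also have "close k (semb (\<pi> x) * \<Gamma> + semb (\<pi> y) * \<Gamma>) (\<Gamma> * \<Phi> x + \<Gamma> * \<Phi> y)"
      using that by (intro close_add) (auto simp: T_def)
    also have "close k (\<Gamma> * \<Phi> x + \<Gamma> * \<Phi> y) (\<Gamma> * (\<Phi> x + \<Phi> y))" by (rule close_eq) (simp add: distrib_left)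
    also have "close k (\<Gamma> * (\<Phi> x + \<Phi> y)) (\<Gamma> * \<Phi> (x \<oplus>\<^bsub>A\<^esub> y))"
      using that by (intro close_left b\<Gamma> close_sym[OF h(5)])
    finally show ?thesis by (simp add: T_def)
  qed
  have T_mult: "T (x \<otimes>\<^bsub>A\<^esub> y)" if "x \<in> carrier A" "y \<in> carrier A" "T x" "T y" for x y
  proof -
    have "close k (semb (\<pi> (x \<otimes>\<^bsub>A\<^esub> y)) * \<Gamma>) (semb (\<pi> x) * (semb (\<pi> y) * \<Gamma>))"
      using that hp by (intro close_eq) (simp add: semb_sel mult.assoc)
    also have "close k (semb (\<pi> x) * (semb (\<pi> y) * \<Gamma>)) (semb (\<pi> x) * (\<Gamma> * \<Phi> y))"
      using that hp by (intro close_left bdd_semb[of _ s]) (auto simp: T_def)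
    also have "close k (semb (\<pi> x) * (\<Gamma> * \<Phi> y)) (semb (\<pi> x) * \<Gamma> * \<Phi> y)" by (rule close_eq) (simp add: mult.assoc)
    also have "close k (semb (\<pi> x) * \<Gamma> * \<Phi> y) (\<Gamma> * \<Phi> x * \<Phi> y)"
      using that h by (intro close_right) (auto simp: T_def)
    also have "close k (\<Gamma> * \<Phi> x * \<Phi> y) (\<Gamma> * (\<Phi> x * \<Phi> y))" by (rule close_eq) (rule mult.assoc)
    also have "close k (\<Gamma> * (\<Phi> x * \<Phi> y)) (\<Gamma> * \<Phi> (x \<otimes>\<^bsub>A\<^esub> y))"
      using that by (intro close_left b\<Gamma> close_sym[OF h(6)])
    finally show ?thesis by (simp add: T_def)
  qed
  have T_scale: "T (cscale A c x)" if "x \<in> carrier A" "T x" for c x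
  proof -
    have "close k (semb (\<pi> (cscale A c x)) * \<Gamma>) (scs c (semb (\<pi> x) * \<Gamma>))"
      using that hp by (intro close_eq) (simp add: semb_sel)
    also have "close k (scs c (semb (\<pi> x) * \<Gamma>)) (scs c (\<Gamma> * \<Phi> x))"
      using that by (intro close_scs) (auto simp: T_def)
    also have "close k (scs c (\<Gamma> * \<Phi> x)) (\<Gamma> * scs c (\<Phi> x))" by (rule close_eq) simp
    also have "close k (\<Gamma> * scs c (\<Phi> x)) (\<Gamma> * \<Phi> (cscale A c x))"
      using that by (intro close_left b\<Gamma> close_sym[OF h(3)])
    finally show ?thesis by (simp add: T_def)
  qed
  have T_one: "T \<one>\<^bsub>A\<^esub>"
  proof -
    have "\<Gamma> = \<Gamma> * P" by (simp add: \<Gamma>_def mult.assoc P(3))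
    moreover have "close k (\<Gamma> * P) (\<Gamma> * ?e)" by (rule close_left[OF b\<Gamma> P(4)])
    ultimately have "close k \<Gamma> (\<Gamma> * ?e)" by simp
    then show ?thesis by (simp add: T_def \<pi>(2) semb_one \<Gamma>(2))
  qed
  have T_gen: "T x \<and> T (star A x)"
    if x: "x \<in> carrier A" and X: "sunitary k X" "close k X (\<Phi> x + (suid k - ?e))"
      and X': "sunitary s X'" "close k (X' * J) (J * X)" and \<pi>x: "\<pi> x = smat s X'" for x X X'
  proof
    note u = sunitaryD[OF X(1)] and u' = sunitaryD[OF X'(1)]
    have e: "semb (\<pi> x) = X'" using u'(1) by (simp add: \<pi>x semb_smat)
    show "T x" unfolding T_def e \<Gamma>_def
      by (rule compressed_intertwiner[OF cA hom x u(4) X(2) bP P(4) bJ X'(2)])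
    have "close k (sadj X) (\<Phi> (star A x) + (suid k - ?e))"
    proof -
      have "close k (sadj X) (sadj (\<Phi> x + (suid k - ?e)))" by (rule close_sadj[OF X(2)])
      also have "close k (sadj (\<Phi> x + (suid k - ?e))) (\<Phi> (star A x) + (suid k - ?e))"
        unfolding sadj_simps by (intro close_add close_diff close_refl close_sym[OF h(4)] x ee)
      finally show ?thesis .
    qed
    moreover have "close k (sadj X' * J) (J * sadj X)"
    proof -
      \<comment> \<open>For unitaries the relation for the adjoints follows by multiplying with
        \<open>sadj X'\<close> on the left and \<open>sadj X\<close> on the right.\<close>
      have "close k (sadj X' * (J * X) * sadj X) (sadj X' * (X' * J) * sadj X)"
        by (intro close_right close_left u u' close_sym[OF X'(2)])
      moreover have "sadj X' * (J * X) * sadj X = sadj X' * (J * (X * sadj X))" by (simp add: mult.assoc)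
      moreover have "sadj X' * (X' * J) * sadj X = (sadj X' * X') * J * sadj X" by (simp add: mult.assoc)
      ultimately show ?thesis unfolding u(3) u'(2) D(5,6) by simp
    qed
    moreover have "semb (\<pi> (star A x)) = sadj X'" using hp x e by (simp add: semb_sel)
    ultimately show "T (star A x)" unfolding T_def \<Gamma>_def
      using compressed_intertwiner[OF cA hom A.star_closed[OF x] u(5) _ bP P(4) bJ] by simp
  qed
  have T_limit: "T L"
    if X: "\<And>i. X i \<in> carrier A" "\<And>i. T (X i)" and L: "L \<in> carrier A"
    and lim: "(\<lambda>i :: nat. cnorm A (X i \<ominus>\<^bsub>A\<^esub> L)) \<longlonglongrightarrow> 0" for X L
  proof -
    have "null k (semb (\<pi> L) * \<Gamma> - \<Gamma> * \<Phi> L)"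
    proof (rule null_small)
      fix \<delta> :: real assume \<delta>: "0 < \<delta>"
      obtain C where C: "\<And>n. opn (\<Gamma> n) \<le> C" using b\<Gamma> unfolding bdd_def by blast
      have C0: "0 \<le> C" using C order_trans opn_nonneg by blast
      \<comment> \<open>The errors are \<open>\<delta> / 4\<close> from \<open>R\<close>,
        \<open>\<eta> * C\<close> from \<open>\<pi> d\<close> and \<open>2 * \<eta> * C\<close> from
        \<open>\<Phi> d\<close>, at most \<delta> together; \<open>C + 1\<close> keeps the
        denominator positive.\<close>
      define \<eta> where "\<eta> = \<delta> / (4 * (C + 1))"
      have \<eta>: "0 < \<eta>" "\<eta> * C \<le> \<delta> / 4"
        using \<delta> C0 by (auto simp: \<eta>_def field_simps)
      obtain i where i: "cnorm A (X i \<ominus>\<^bsub>A\<^esub> L) < \<eta>"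
        using order_tendstoD(2)[OF lim \<eta>(1)] unfolding eventually_sequentially by blast
      define d where "d = L \<ominus>\<^bsub>A\<^esub> X i"
      have d: "d \<in> carrier A" "cnorm A d < \<eta>" using i X L A.norm_minus_commute by (auto simp: d_def)
      have Ld: "L = X i \<oplus>\<^bsub>A\<^esub> d" using X(1)[of i] L A.minus_add_cancel[of L "X i"] by (simp add: d_def A.a_comm)
      \<comment> \<open>\<open>R\<close> collects the null errors at the fixed index
        \<open>i\<close>, including the additivity defect of \<open>\<Phi>\<close> on the sum of
        \<open>X i\<close> and \<open>d\<close>; the rest is small because \<open>d\<close>
        is.\<close>
      define R where "R = (semb (\<pi> (X i)) * \<Gamma> - \<Gamma> * \<Phi> (X i)) - \<Gamma> * (\<Phi> L - (\<Phi> (X i) + \<Phi> d))"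
      have nR: "null k R" unfolding R_def
      proof (rule null_diff[OF _ null_left[OF b\<Gamma>]])
        show "null k (semb (\<pi> (X i)) * \<Gamma> - \<Gamma> * \<Phi> (X i))" using X(2) unfolding T_def close_def .
        show "null k (\<Phi> L - (\<Phi> (X i) + \<Phi> d))"
          using h(5)[OF X(1) d(1), of i] unfolding close_def Ld[symmetric] .
      qed
      have eq: "semb (\<pi> L) * \<Gamma> - \<Gamma> * \<Phi> L = R + (semb (\<pi> d) * \<Gamma> - \<Gamma> * \<Phi> d)"
      proof -
        have "semb (\<pi> L) = semb (\<pi> (X i)) + semb (\<pi> d)"
          using X(1)[of i] d(1) hp by (subst Ld) (simp add: semb_sel)
        then show ?thesis by (simp add: R_def algebra_simps)
      qed
      have "\<forall>\<^sub>F n in G. w (k n) * \<nu> (\<Phi> d n) \<le> 2 * \<eta>" by (rule hom_mod_small[OF k cA hom d])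
      moreover have "\<forall>\<^sub>F n in G. w (k n) * \<nu> (R n) < \<delta> / 4" using null_smallD[OF nR, of "\<delta> / 4"] \<delta> by simp
      ultimately show "\<forall>\<^sub>F n in G. w (k n) * \<nu> ((semb (\<pi> L) * \<Gamma> - \<Gamma> * \<Phi> L) n) \<le> \<delta>"
      proof eventually_elim
        case (elim n)
        have "w (k n) * \<nu> (semb (\<pi> d) n * \<Gamma> n) \<le> \<eta> * C"
        proof -
          have gn: "\<Gamma> n = \<Gamma> n * uid (k n)" using fun_cong[OF \<Gamma>(3), of n] by (simp add: seq_sel)
          have "\<nu> (semb (\<pi> d) n * \<Gamma> n) \<le> opn (semb (\<pi> d) n) * \<nu> (\<Gamma> n * uid (k n))"
            unfolding gn[symmetric] by (rule nu_left)
          also have "\<dots> \<le> \<eta> * (C * \<nu> (uid (k n)))"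
            using \<eta>(1) C[of n] unital_hom_contractive[OF cA \<pi>(1,2) d]
            by (intro mult_mono order_trans[OF nu_left] mult_right_mono) auto
          finally have "w (k n) * \<nu> (semb (\<pi> d) n * \<Gamma> n) \<le> w (k n) * (\<eta> * (C * \<nu> (uid (k n))))"
            by (rule mult_left_mono) simp
          also have "\<dots> = \<eta> * C * (w (k n) * \<nu> (uid (k n)))" by simp
          also have "\<dots> \<le> \<eta> * C * 1" using \<eta>(1) C0 by (intro mult_left_mono w_uid k) auto
          finally show ?thesis by simp
        qed
        moreover have "w (k n) * \<nu> (\<Gamma> n * \<Phi> d n) \<le> 2 * (\<eta> * C)"
        proof -
          have "w (k n) * \<nu> (\<Gamma> n * \<Phi> d n) \<le> w (k n) * (C * \<nu> (\<Phi> d n))"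
            using C[of n] by (intro mult_left_mono order_trans[OF nu_left] mult_right_mono) auto
          also have "\<dots> = C * (w (k n) * \<nu> (\<Phi> d n))" by simp
          also have "\<dots> \<le> C * (2 * \<eta>)" using elim(1) C0 by (intro mult_left_mono) auto
          finally show ?thesis by (simp add: mult_ac)
        qed
        moreover have "\<nu> ((semb (\<pi> L) * \<Gamma> - \<Gamma> * \<Phi> L) n) \<le> \<nu> (R n) + (\<nu> (semb (\<pi> d) n * \<Gamma> n) + \<nu> (\<Gamma> n * \<Phi> d n))"
          unfolding eq seq_sel by (rule order_trans[OF nu_triangle]) (intro add_left_mono nu_minus)
        then have "w (k n) * \<nu> ((semb (\<pi> L) * \<Gamma> - \<Gamma> * \<Phi> L) n) \<le>
            w (k n) * (\<nu> (R n) + (\<nu> (semb (\<pi> d) n * \<Gamma> n) + \<nu> (\<Gamma> n * \<Phi> d n)))"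
          by (rule mult_left_mono) simp
        ultimately show ?case using elim(2) \<eta>(2) by (simp add: distrib_left)
      qed
    qed
    then show ?thesis unfolding T_def close_def .
  qed
  have "cstar_subalgebra A S"
    unfolding cstar_subalgebra_def
  proof (intro conjI ballI allI impI)
    show "S \<subseteq> carrier A" by (auto simp: S_def)
    show "\<one>\<^bsub>A\<^esub> \<in> S" using T_one by (simp add: S_def A.star_one)
    fix x assume "x \<in> S"
    then have x: "x \<in> carrier A" "T x" "T (star A x)" by (auto simp: S_def)
    show "star A x \<in> S" using x by (simp add: S_def A.star_closed A.star_star)
    show "cscale A c x \<in> S" for c
      using x by (simp add: S_def A.star_closed A.star_scale A.scale_closed T_scale)
    fix y assume "y \<in> S"
    then have y: "y \<in> carrier A" "T y" "T (star A y)" by (auto simp: S_def)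
    show "x \<oplus>\<^bsub>A\<^esub> y \<in> S" using x y by (simp add: S_def A.star_closed A.star_add T_add)
    show "x \<otimes>\<^bsub>A\<^esub> y \<in> S" using x y by (simp add: S_def A.star_closed A.star_mult T_mult)
  next
    fix X L assume asm: "(\<forall>n::nat. X n \<in> S) \<and> L \<in> carrier A \<and> (\<lambda>n. cnorm A (X n \<ominus>\<^bsub>A\<^esub> L)) \<longlonglongrightarrow> 0"
    then have X: "X n \<in> carrier A" "T (X n)" "T (star A (X n))" for n by (auto simp: S_def)
    have L: "L \<in> carrier A" "(\<lambda>n. cnorm A (X n \<ominus>\<^bsub>A\<^esub> L)) \<longlonglongrightarrow> 0" using asm by auto
    have "cnorm A (star A (X n) \<ominus>\<^bsub>A\<^esub> star A L) = cnorm A (X n \<ominus>\<^bsub>A\<^esub> L)" for n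
      using A.norm_star[of "X n \<ominus>\<^bsub>A\<^esub> L"] X(1)[of n] L(1) by (simp add: A.star_minus)
    then have "(\<lambda>n. cnorm A (star A (X n) \<ominus>\<^bsub>A\<^esub> star A L)) \<longlonglongrightarrow> 0" using L(2) by simp
    then have "T (star A L)"
      by (rule T_limit[of "\<lambda>n. star A (X n)", OF A.star_closed[OF X(1)] X(3) A.star_closed[OF L(1)]])
    then show "L \<in> S" using T_limit[OF X(1,2) L] L(1) by (simp add: S_def)
  qed
  moreover have "{u, v} \<subseteq> S"
    using T_gen[OF uv(3) U D(1) D(7) \<pi>(3)] T_gen[OF uv(4) V D(2) D(8) \<pi>(4)] uv by (simp add: S_def)
  ultimately have "carrier A \<subseteq> S" using gen unfolding cstar_generated_def by blast
  then have "\<forall>a\<in>carrier A. T a" by (auto simp: S_def)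
  then show ?thesis using \<pi>(1,2) \<Gamma> b\<Gamma> P(4) unfolding T_def \<Gamma>\<Gamma>[symmetric] by blast
qed

end

section \<open>Stability\<close>

lemma scorner_iff: "scorner k X \<longleftrightarrow> suid k * X = X \<and> X * suid k = X"
  by (auto simp: scorner_def corner_iff fun_eq_iff seq_sel)

lemma scorner_mono: "scorner k X \<Longrightarrow> (\<And>n. k n \<le> m n) \<Longrightarrow> scorner m X"
  by (auto simp: scorner_def intro: corner_mono)

lemma suid_le: "(\<And>n. k n \<le> m n) \<Longrightarrow> suid m * suid k = suid k"
  by (simp add: fun_eq_iff seq_sel uid_times_uid min_absorb2)

lemma bdd_isometry: "sadj X * X = suid k \<Longrightarrow> bdd X"
  unfolding bdd_def fun_eq_iff seq_sel by (intro exI[of _ 1] allI opn_isometry_le) blast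

text \<open>The inclusion of the second summand in a block sum of sizes \<open>k\<close> and
  \<open>m\<close>.\<close>

definition sshift :: "(nat \<Rightarrow> nat) \<Rightarrow> (nat \<Rightarrow> nat) \<Rightarrow> nat \<Rightarrow> fmat" where
  "sshift k m = (\<lambda>n. shift (k n) (m n))"

lemma sshift_simps:
  "sadj (sshift k m) * sshift k m = suid m" "suid k * sshift k m = 0" "sadj (sshift k m) * suid k = 0"
  "bdd (sshift k m)"
proof -
  show 1: "sadj (sshift k m) * sshift k m = suid m"
    by (simp add: fun_eq_iff seq_sel sshift_def)
  have "uid (k n) * shift (k n) (m n) = 0" for n
    using shift_disjoint[of 0 "k n" "k n" "m n"] by (simp add: shift_0)
  then show "suid k * sshift k m = 0" by (simp add: fun_eq_iff seq_sel sshift_def)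
  have "adj (shift (k n) (m n)) * uid (k n) = 0" for n
    using shift_disjoint'[of 0 "k n" "k n" "m n"] by (simp add: shift_0)
  then show "sadj (sshift k m) * suid k = 0" by (simp add: fun_eq_iff seq_sel sshift_def)
  show "bdd (sshift k m)" by (rule bdd_isometry[OF 1])
qed

lemma sshift_restrict: "(\<And>n. s n \<le> m n) \<Longrightarrow> sshift k m * suid s = sshift k s"
proof -
  assume le: "\<And>n. s n \<le> m n"
  have "shift (k n) (m n) * uid (s n) = shift (k n) (s n)" for n
    by (rule fmat_eqI) (use le[of n] in \<open>auto simp: uid_def ent_times_diagm ent_shift\<close>)
  then show ?thesis by (simp add: fun_eq_iff seq_sel sshift_def)
qed

lemma sshift_corner: "suid (\<lambda>n. k n + m n) * sshift k m = sshift k m"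
  by (simp add: fun_eq_iff seq_sel sshift_def uid_left)

lemma seq_dsum_mat_prod:
  assumes x: "x \<in> carrier (mat_prod k)" and y: "y \<in> carrier (mat_prod m)"
  shows "semb (seq_dsum x y) = semb x + sshift k m * semb y * sadj (sshift k m)"
    "seq_dsum x y \<in> carrier (mat_prod (\<lambda>n. k n + m n))"
proof -
  have c: "x n \<in> carrier_mat (k n) (k n)" "y n \<in> carrier_mat (m n) (m n)" for n
    using x y by (auto simp: mat_prod_carrier_iff)
  have d: "seq_dsum x y n = four_block_mat (x n) (0\<^sub>m (k n) (m n)) (0\<^sub>m (m n) (k n)) (y n)" for n
    using carrier_matD[OF c(1)[of n]] carrier_matD[OF c(2)[of n]] by (simp add: seq_dsum_def)
  show e: "semb (seq_dsum x y) = semb x + sshift k m * semb y * sadj (sshift k m)"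
    by (simp add: fun_eq_iff seq_sel semb_def sshift_def d emb_four_block[OF c])
  have "bdd (semb (seq_dsum x y))"
    unfolding e by (intro bdd_intros bdd_sadj sshift_simps bdd_semb[OF x] bdd_semb[OF y])
  moreover have "seq_dsum x y n \<in> carrier_mat (k n + m n) (k n + m n)" for n
    unfolding d by (rule four_block_carrier_mat[OF c])
  ultimately show "seq_dsum x y \<in> carrier (mat_prod (\<lambda>n. k n + m n))"
    by (simp add: mat_prod_carrier_iff)
qed

section \<open>Cosets modulo null sequences\<close>

context ideal_norm
begin

text \<open>In the two instances this is \<open>hs_null\<close> and \<open>op_null\<close>.\<close>

definition null_ideal :: "(nat \<Rightarrow> nat) \<Rightarrow> (nat \<Rightarrow> complex mat) set" where
  "null_ideal k = {T \<in> carrier (mat_prod k). null k (semb T)}"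

lemma ideal_null_ideal: "ideal (null_ideal k) (mat_prod k)"
proof -
  interpret M: cstar_algebra "mat_prod k" by (rule mat_prod_cstar)
  show ?thesis
  proof (rule idealI)
    show "ring (mat_prod k)" by (rule M.ring_axioms)
    show "subgroup (null_ideal k) (add_monoid (mat_prod k))"
    proof (rule M.add.subgroupI)
      show "null_ideal k \<subseteq> carrier (mat_prod k)" by (auto simp: null_ideal_def)
      have "\<zero>\<^bsub>mat_prod k\<^esub> \<in> null_ideal k" by (simp add: null_ideal_def semb_zero)
      then show "null_ideal k \<noteq> {}" by blast
      show "\<ominus>\<^bsub>mat_prod k\<^esub> a \<in> null_ideal k" if "a \<in> null_ideal k" for a
        using that by (auto simp: null_ideal_def M.a_inv_scale semb_sel M.scale_closed intro: null_scs)
      show "a \<oplus>\<^bsub>mat_prod k\<^esub> b \<in> null_ideal k" if "a \<in> null_ideal k" "b \<in> null_ideal k" for a b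
        using that by (auto simp: null_ideal_def semb_sel intro: null_add)
    qed
    fix a x assume "a \<in> null_ideal k" "x \<in> carrier (mat_prod k)"
    then show "x \<otimes>\<^bsub>mat_prod k\<^esub> a \<in> null_ideal k" "a \<otimes>\<^bsub>mat_prod k\<^esub> x \<in> null_ideal k"
      by (auto simp: null_ideal_def semb_sel intro: null_left null_right bdd_semb)
  qed
qed

abbreviation coset :: "(nat \<Rightarrow> nat) \<Rightarrow> (nat \<Rightarrow> complex mat) \<Rightarrow> (nat \<Rightarrow> complex mat) set" where
  "coset k x \<equiv> null_ideal k +>\<^bsub>mat_prod k\<^esub> x"

abbreviation quotient :: "(nat \<Rightarrow> nat) \<Rightarrow> (nat \<Rightarrow> complex mat) set star_algebra" where
  "quotient k \<equiv> star_quot (mat_prod k) (null_ideal k)"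

lemma coset_eq_iff:
  assumes "x \<in> carrier (mat_prod k)" "y \<in> carrier (mat_prod k)"
  shows "coset k x = coset k y \<longleftrightarrow> close k (semb x) (semb y)"
proof -
  interpret M: cstar_algebra "mat_prod k" by (rule mat_prod_cstar)
  have "coset k x = coset k y \<longleftrightarrow> x \<ominus>\<^bsub>mat_prod k\<^esub> y \<in> null_ideal k"
    using M.quotient_eq_iff_same_a_r_cos[OF ideal_null_ideal assms] by simp
  then show ?thesis using assms by (simp add: null_ideal_def close_def semb_sel)
qed

lemma coset_self: "x \<in> carrier (mat_prod k) \<Longrightarrow> x \<in> coset k x"
  by (rule abelian_subgroup.a_rcos_self[OF abelian_subgroupI3])
     (auto intro: ideal.axioms(1)[OF ideal_null_ideal] ring.is_abelian_group cstar_algebra.axioms(1)[OF mat_prod_cstar])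

lemma coset_member:
  assumes "x \<in> carrier (mat_prod k)" "y \<in> coset k x"
  shows "y \<in> carrier (mat_prod k)" "close k (semb y) (semb x)"
proof -
  interpret M: cstar_algebra "mat_prod k" by (rule mat_prod_cstar)
  interpret I: ideal "null_ideal k" "mat_prod k" by (rule ideal_null_ideal)
  show y: "y \<in> carrier (mat_prod k)"
    using M.a_r_coset_subset_G[OF I.a_subset assms(1)] assms(2) by blast
  have "coset k x = coset k y"
    using M.a_repr_independence[OF assms(2,1) I.a_subgroup] .
  then show "close k (semb y) (semb x)" using coset_eq_iff[OF assms(1) y] close_sym by blast
qed

text \<open>Operations on cosets are unions over all representatives. Such a union is a single coset
  once all representatives yield the same one, and there is at least one.\<close>

lemma coset_UN:
  assumes "x \<in> carrier (mat_prod k)"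
    and "\<And>y. y \<in> carrier (mat_prod k) \<Longrightarrow> close k (semb y) (semb x) \<Longrightarrow> H y = Z"
  shows "(\<Union>y\<in>coset k x. H y) = Z"
  using coset_self[OF assms(1)] coset_member[OF assms(1)] assms(2) by blast

lemma quotient_ops:
  assumes x: "x \<in> carrier (mat_prod k)"
  shows "coset k x \<in> carrier (quotient k)"
    "cscale (quotient k) c (coset k x) = coset k (cscale (mat_prod k) c x)"
    "star (quotient k) (coset k x) = coset k (star (mat_prod k) x)"
    "y \<in> carrier (mat_prod k) \<Longrightarrow> coset k x \<oplus>\<^bsub>quotient k\<^esub> coset k y = coset k (x \<oplus>\<^bsub>mat_prod k\<^esub> y)"
    "y \<in> carrier (mat_prod k) \<Longrightarrow> coset k x \<otimes>\<^bsub>quotient k\<^esub> coset k y = coset k (x \<otimes>\<^bsub>mat_prod k\<^esub> y)"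
proof -
  interpret M: cstar_algebra "mat_prod k" by (rule mat_prod_cstar)
  interpret I: ideal "null_ideal k" "mat_prod k" by (rule ideal_null_ideal)
  show "coset k x \<in> carrier (quotient k)"
    using M.a_rcosetsI[OF I.a_subset x] by (simp add: star_quot_def FactRing_def)
  show "cscale (quotient k) c (coset k x) = coset k (cscale (mat_prod k) c x)"
    unfolding star_quot_def
    by (simp, rule coset_UN[OF x], subst coset_eq_iff)
       (use x in \<open>auto simp: M.scale_closed semb_sel intro: close_scs\<close>)
  show "star (quotient k) (coset k x) = coset k (star (mat_prod k) x)"
    unfolding star_quot_def
    by (simp, rule coset_UN[OF x], subst coset_eq_iff)
       (use x in \<open>auto simp: M.star_closed semb_sel intro: close_sadj\<close>)
  assume y: "y \<in> carrier (mat_prod k)"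
  show "coset k x \<oplus>\<^bsub>quotient k\<^esub> coset k y = coset k (x \<oplus>\<^bsub>mat_prod k\<^esub> y)"
    using I.a_rcos_sum[OF x y] by (simp add: star_quot_def FactRing_def)
  show "coset k x \<otimes>\<^bsub>quotient k\<^esub> coset k y = coset k (x \<otimes>\<^bsub>mat_prod k\<^esub> y)"
    using I.rcoset_mult_add[OF x y] by (simp add: star_quot_def FactRing_def)
qed

text \<open>Representatives are chosen with no regard to the algebraic structure; the equations
  between cosets are then the closeness conditions of \<open>hom_mod\<close>.\<close>

lemma star_hom_quotient_lift:
  assumes "cstar_algebra A" "f \<in> star_hom A (quotient k)"
  shows "\<exists>\<phi>. (\<forall>a\<in>carrier A. \<phi> a \<in> carrier (mat_prod k) \<and> f a = coset k (\<phi> a)) \<and> hom_mod k A (\<lambda>a. semb (\<phi> a))"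
proof -
  interpret A: cstar_algebra A by fact
  interpret M: cstar_algebra "mat_prod k" by (rule mat_prod_cstar)
  note f = star_homD[OF assms(2)]
  have "\<exists>x. x \<in> carrier (mat_prod k) \<and> f a = coset k x" if "a \<in> carrier A" for a
    using f(1)[OF that] by (auto simp: star_quot_def FactRing_def A_RCOSETS_def')
  then obtain \<phi> where \<phi>: "\<And>a. a \<in> carrier A \<Longrightarrow> \<phi> a \<in> carrier (mat_prod k)" "\<And>a. a \<in> carrier A \<Longrightarrow> f a = coset k (\<phi> a)"
    by metis
  have *: "close k (semb (\<phi> a)) (semb z)" if "a \<in> carrier A" "z \<in> carrier (mat_prod k)" "f a = coset k z" for a z
    using that coset_eq_iff[OF \<phi>(1)[OF that(1)] that(2)] \<phi>(2) by simp
  have "hom_mod k A (\<lambda>a. semb (\<phi> a))"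
    unfolding hom_mod_def
  proof (intro conjI ballI allI)
    fix x assume x: "x \<in> carrier A"
    show "scorner k (semb (\<phi> x))" "bdd (semb (\<phi> x))" using \<phi>(1)[OF x] scorner_semb bdd_semb by auto
    note x' = \<phi>(1)[OF x]
    show "close k (semb (\<phi> (cscale A c x))) (scs c (semb (\<phi> x)))" for c
      unfolding semb_sel(1)[OF x', symmetric]
      by (rule *[OF A.scale_closed[OF x] M.scale_closed[OF x']])
         (simp only: f(2)[OF x] \<phi>(2)[OF x] quotient_ops(2)[OF x'])
    show "close k (semb (\<phi> (star A x))) (sadj (semb (\<phi> x)))"
      unfolding semb_sel(2)[OF x', symmetric]
      by (rule *[OF A.star_closed[OF x] M.star_closed[OF x']])
         (simp only: f(3)[OF x] \<phi>(2)[OF x] quotient_ops(3)[OF x'])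
    fix y assume y: "y \<in> carrier A"
    note y' = \<phi>(1)[OF y]
    show "close k (semb (\<phi> (x \<oplus>\<^bsub>A\<^esub> y))) (semb (\<phi> x) + semb (\<phi> y))"
      unfolding semb_sel(3)[OF x' y', symmetric]
      by (rule *[OF A.a_closed[OF x y] M.a_closed[OF x' y']])
         (simp only: f(4)[OF x y] \<phi>(2)[OF x] \<phi>(2)[OF y] quotient_ops(4)[OF x' y'])
    show "close k (semb (\<phi> (x \<otimes>\<^bsub>A\<^esub> y))) (semb (\<phi> x) * semb (\<phi> y))"
      unfolding semb_sel(4)[OF x' y', symmetric]
      by (rule *[OF A.m_closed[OF x y] M.m_closed[OF x' y']])
         (simp only: f(5)[OF x y] \<phi>(2)[OF x] \<phi>(2)[OF y] quotient_ops(5)[OF x' y'])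
  qed
  then show ?thesis using \<phi> by (intro exI[of _ \<phi>]) blast
qed

lemma star_hom_quotient:
  assumes "cstar_algebra A" "hom_mod k A \<Psi>"
  shows "(\<lambda>a. coset k (smat k (\<Psi> a))) \<in> star_hom A (quotient k)"
proof -
  interpret A: cstar_algebra A by fact
  interpret M: cstar_algebra "mat_prod k" by (rule mat_prod_cstar)
  note h = hom_modD[OF assms(2)]
  have c: "smat k (\<Psi> a) \<in> carrier (mat_prod k)" if "a \<in> carrier A" for a
    using h that by (intro smat_carrier)
  have s: "semb (smat k (\<Psi> a)) = \<Psi> a" if "a \<in> carrier A" for a using h(1)[OF that] by (rule semb_smat)
  have eq: "coset k (smat k (\<Psi> a)) = coset k z"
    if "a \<in> carrier A" "z \<in> carrier (mat_prod k)" "close k (\<Psi> a) (semb z)" for a z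
    using that by (simp add: coset_eq_iff[OF c] s)
  show ?thesis
    unfolding star_hom_def
  proof (intro CollectI conjI ballI allI)
    fix x assume x: "x \<in> carrier A"
    show "coset k (smat k (\<Psi> x)) \<in> carrier (quotient k)" by (rule quotient_ops[OF c[OF x]])
    show "coset k (smat k (\<Psi> (cscale A t x))) = cscale (quotient k) t (coset k (smat k (\<Psi> x)))" for t
      unfolding quotient_ops(2)[OF c[OF x]]
      using x c h by (intro eq) (auto simp: A.scale_closed M.scale_closed semb_sel s)
    show "coset k (smat k (\<Psi> (star A x))) = star (quotient k) (coset k (smat k (\<Psi> x)))"
      unfolding quotient_ops(3)[OF c[OF x]]
      using x c h by (intro eq) (auto simp: A.star_closed M.star_closed semb_sel s)
    fix y assume y: "y \<in> carrier A"
    show "coset k (smat k (\<Psi> (x \<oplus>\<^bsub>A\<^esub> y))) = coset k (smat k (\<Psi> x)) \<oplus>\<^bsub>quotient k\<^esub> coset k (smat k (\<Psi> y))"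
      unfolding quotient_ops(4)[OF c[OF x] c[OF y]]
      using x y c h by (intro eq) (auto simp: semb_sel s)
    show "coset k (smat k (\<Psi> (x \<otimes>\<^bsub>A\<^esub> y))) = coset k (smat k (\<Psi> x)) \<otimes>\<^bsub>quotient k\<^esub> coset k (smat k (\<Psi> y))"
      unfolding quotient_ops(5)[OF c[OF x] c[OF y]]
      using x y c h by (intro eq) (auto simp: semb_sel s)
  qed
qed

lemma close_antimono:
  "close k X Y \<Longrightarrow> (\<And>n. 0 < k n) \<Longrightarrow> (\<And>n. k n \<le> m n) \<Longrightarrow> close m X Y"
  unfolding close_def by (rule null_antimono)

lemma coset_dsum_cosets:
  assumes x: "x \<in> carrier (mat_prod k)" and y: "y \<in> carrier (mat_prod m)"
    and k: "\<And>n. 0 < k n" and m: "\<And>n. 0 < m n"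
  defines "t \<equiv> \<lambda>n. k n + m n"
  shows "coset_dsum (mat_prod t) (null_ideal t) (coset k x) (coset m y) = coset t (seq_dsum x y)"
  unfolding coset_dsum_def
proof (intro coset_UN x y)
  fix x' y' assume x': "x' \<in> carrier (mat_prod k)" "close k (semb x') (semb x)"
    and y': "y' \<in> carrier (mat_prod m)" "close m (semb y') (semb y)"
  have "close t (semb x' + sshift k m * semb y' * sadj (sshift k m)) (semb x + sshift k m * semb y * sadj (sshift k m))"
    by (intro close_add close_left close_right bdd_sadj sshift_simps
        close_antimono[OF x'(2) k] close_antimono[OF y'(2) m]) (simp_all add: t_def)
  then show "coset t (seq_dsum x' y') = coset t (seq_dsum x y)"
    using seq_dsum_mat_prod[OF x'(1) y'(1)] seq_dsum_mat_prod[OF x y]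
    by (simp add: coset_eq_iff t_def)
qed

text \<open>With \<open>q = 1 - \<Gamma> \<Gamma>\<^sup>*\<close>, the isometry \<open>K = \<Gamma>\<^sup>* \<oplus> q\<close> conjugates \<open>\<pi>\<close> into a homomorphism whose diagonal
  corners are, up to null sequences, \<open>f\<close> and \<open>g = q \<pi> q\<close>, and whose off-diagonal corners are null.\<close>

theorem very_flexibly_stable_soft_torus:
  assumes "0 \<le> \<epsilon>" "is_soft_torus \<epsilon> A u v"
  shows "very_flexibly_stable null_ideal A"
  unfolding very_flexibly_stable_def
proof (intro allI impI ballI)
  fix k f assume k0: "\<forall>n. 0 < k n" and f: "f \<in> star_hom A (quotient k)"
  have k: "0 < k n" for n using k0 by simp
  have cA: "cstar_algebra A" using assms(2) by (simp add: is_soft_torus_def)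
  interpret A: cstar_algebra A by (rule cA)
  obtain \<phi> where \<phi>: "\<And>a. a \<in> carrier A \<Longrightarrow> \<phi> a \<in> carrier (mat_prod k)"
    "\<And>a. a \<in> carrier A \<Longrightarrow> f a = coset k (\<phi> a)" and hom: "hom_mod k A (\<lambda>a. semb (\<phi> a))"
    using star_hom_quotient_lift[OF cA f] by blast
  define \<Phi> where "\<Phi> a = semb (\<phi> a)" for a
  have hom: "hom_mod k A \<Phi>" using hom by (simp add: \<Phi>_def[abs_def])
  note h = hom_modD[OF hom]
  obtain s \<pi> \<Gamma> where \<pi>: "\<pi> \<in> star_hom A (mat_prod s)" "\<pi> \<one>\<^bsub>A\<^esub> = \<one>\<^bsub>mat_prod s\<^esub>"
    and \<Gamma>: "\<Gamma> * sadj \<Gamma> * \<Gamma> = \<Gamma>" "suid s * \<Gamma> = \<Gamma>" "\<Gamma> * suid k = \<Gamma>" "bdd \<Gamma>"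
    and \<Gamma>1: "close k (sadj \<Gamma> * \<Gamma>) (\<Phi> \<one>\<^bsub>A\<^esub>)"
    and inter: "\<And>a. a \<in> carrier A \<Longrightarrow> close k (semb (\<pi> a) * \<Gamma>) (\<Gamma> * \<Phi> a)"
    using soft_torus_dilation[OF k assms hom] by blast
  note p = star_homD[OF \<pi>(1)]
  define \<rho> where "\<rho> a = semb (\<pi> a)" for a
  have \<rho>c: "scorner s (\<rho> a)" "bdd (\<rho> a)" if "a \<in> carrier A" for a
    using p(1)[OF that] by (auto simp: \<rho>_def scorner_semb bdd_semb)
  have \<rho>_ops: "\<rho> (x \<oplus>\<^bsub>A\<^esub> y) = \<rho> x + \<rho> y" "\<rho> (x \<otimes>\<^bsub>A\<^esub> y) = \<rho> x * \<rho> y" "\<rho> (cscale A c x) = scs c (\<rho> x)" "\<rho> (star A x) = sadj (\<rho> x)"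
    if "x \<in> carrier A" "y \<in> carrier A" for x y c
    using that p by (auto simp: \<rho>_def semb_sel)
  define m where "m n = s n + k n" for n
  define t where "t n = k n + m n" for n
  define \<kappa> where "\<kappa> = sshift k s"
  define q where "q = suid s - \<Gamma> * sadj \<Gamma>"
  define K where "K = sadj \<Gamma> + \<kappa> * q"
  have m: "0 < m n" "k n \<le> m n" "s n \<le> m n" for n using k by (auto simp: m_def)
  have kt: "k n \<le> t n" for n by (simp add: t_def)
  have \<Gamma>': "sadj \<Gamma> * suid s = sadj \<Gamma>" "suid k * sadj \<Gamma> = sadj \<Gamma>"
    using arg_cong[OF \<Gamma>(2), of sadj] arg_cong[OF \<Gamma>(3), of sadj] by simp_all
  have q\<Gamma>: "q * \<Gamma> = 0" using \<Gamma>(1,2) by (simp add: q_def left_diff_distrib)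
  have sq: "sadj q = q" by (simp add: q_def)
  have us: "suid s * suid s = suid s" by (rule suid_le) simp
  have uq: "suid s * q = q" "q * suid s = q"
    using \<Gamma>(2) \<Gamma>'(1) us by (simp_all add: q_def left_diff_distrib right_diff_distrib mult.assoc flip: mult.assoc[of "suid s"])
  have qq: "q * q = q"
  proof -
    have "q * q = q * suid s - q * \<Gamma> * sadj \<Gamma>" by (subst (2) q_def) (simp add: right_diff_distrib mult.assoc)
    then show ?thesis using q\<Gamma> uq by simp
  qed
  have \<kappa>: "sadj \<kappa> * \<kappa> = suid s" "suid k * \<kappa> = 0" "bdd \<kappa>" using sshift_simps by (auto simp: \<kappa>_def)
  have \<Gamma>\<kappa>: "\<Gamma> * \<kappa> = 0" using \<Gamma>(3) \<kappa>(2) by (metis mult.assoc mult_zero_right)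
  have \<kappa>\<Gamma>: "sadj \<kappa> * sadj \<Gamma> = 0"
  proof -
    have "sadj (\<Gamma> * \<kappa>) = 0" unfolding \<Gamma>\<kappa> by (simp add: fun_eq_iff seq_sel)
    then show ?thesis by simp
  qed
  have bq: "bdd q" unfolding q_def by (intro bdd_intros bdd_suid bdd_sadj \<Gamma>)
  have bK: "bdd K" unfolding K_def by (intro bdd_intros bdd_sadj \<Gamma> \<kappa> bq)
  have sK: "sadj K = \<Gamma> + q * sadj \<kappa>" by (simp add: K_def sq)
  have KK: "sadj K * K = suid s"
  proof -
    have "sadj K * K = \<Gamma> * sadj \<Gamma> + (\<Gamma> * \<kappa>) * q + q * (sadj \<kappa> * sadj \<Gamma>) + q * (sadj \<kappa> * \<kappa>) * q"
      unfolding sK unfolding K_def by (simp add: distrib_left distrib_right mult.assoc)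
    also have "\<dots> = \<Gamma> * sadj \<Gamma> + q" unfolding \<Gamma>\<kappa> \<kappa>\<Gamma> \<kappa>(1) uq qq by simp
    finally show ?thesis by (simp add: q_def)
  qed
  have tK: "suid t * K = K"
  proof -
    have "suid t * sadj \<Gamma> = suid t * suid k * sadj \<Gamma>" by (simp add: mult.assoc \<Gamma>'(2))
    then have "suid t * sadj \<Gamma> = sadj \<Gamma>" using suid_le[of k t] kt \<Gamma>'(2) by simp
    moreover have "suid t * \<kappa> = \<kappa>"
    proof -
      have "suid t * \<kappa> = suid t * (sshift k m * suid s)"
        unfolding \<kappa>_def sshift_restrict[OF m(3)] ..
      also have "\<dots> = (suid t * sshift k m) * suid s" by (simp add: mult.assoc)
      also have "suid t * sshift k m = sshift k m" unfolding t_def by (rule sshift_corner)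
      finally show ?thesis unfolding \<kappa>_def sshift_restrict[OF m(3)] .
    qed
    ultimately show ?thesis by (simp add: K_def distrib_left flip: mult.assoc)
  qed
  have Kt: "sadj K * suid t = sadj K" using arg_cong[OF tK, of sadj] by simp
  define F where "F a = smat t (K * \<rho> a * sadj K)" for a
  have Fc: "scorner t (K * \<rho> a * sadj K)" "bdd (K * \<rho> a * sadj K)" if "a \<in> carrier A" for a
  proof -
    show "scorner t (K * \<rho> a * sadj K)"
      unfolding scorner_iff using tK Kt by (simp add: mult.assoc flip: mult.assoc[of "suid t"])
    show "bdd (K * \<rho> a * sadj K)" by (intro bdd_intros bdd_sadj bK \<rho>c that)
  qed
  have F: "F \<in> star_hom A (mat_prod t)"
    unfolding F_def[abs_def]
  proof (rule smat_star_hom[OF Fc])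
    fix x y assume x: "x \<in> carrier A" and y: "y \<in> carrier A"
    show "K * \<rho> (x \<oplus>\<^bsub>A\<^esub> y) * sadj K = K * \<rho> x * sadj K + K * \<rho> y * sadj K"
      using x y by (simp add: \<rho>_ops distrib_left distrib_right)
    have "K * \<rho> x * sadj K * (K * \<rho> y * sadj K) = K * \<rho> x * (sadj K * K) * \<rho> y * sadj K" by (simp add: mult.assoc)
    also have "\<dots> = K * (\<rho> x * suid s) * \<rho> y * sadj K" unfolding KK by (simp add: mult.assoc)
    also have "\<dots> = K * \<rho> (x \<otimes>\<^bsub>A\<^esub> y) * sadj K"
      unfolding suid_right[OF \<rho>c(1)[OF x]] using x y by (simp add: \<rho>_ops mult.assoc)
    finally show "K * \<rho> (x \<otimes>\<^bsub>A\<^esub> y) * sadj K = K * \<rho> x * sadj K * (K * \<rho> y * sadj K)" by simp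
  next
    fix x c assume x: "x \<in> carrier A"
    show "K * \<rho> (cscale A c x) * sadj K = scs c (K * \<rho> x * sadj K)"
      using x by (simp add: \<rho>_ops)
    show "K * \<rho> (star A x) * sadj K = sadj (K * \<rho> x * sadj K)"
      using x by (simp add: \<rho>_ops mult.assoc)
  qed
  define Q where "Q a = q * \<rho> a * q" for a
  have off: "close k (q * \<rho> a * \<Gamma>) 0" "close k (sadj \<Gamma> * \<rho> a * q) 0" if a: "a \<in> carrier A" for a
  proof -
    have *: "close k (q * \<rho> a * \<Gamma>) 0" if a: "a \<in> carrier A" for a
    proof -
      have "close k (q * (\<rho> a * \<Gamma>)) (q * (\<Gamma> * \<Phi> a))"
        unfolding \<rho>_def by (rule close_left[OF bq inter[OF a]])
      moreover have "q * (\<Gamma> * \<Phi> a) = 0" using q\<Gamma> by (simp flip: mult.assoc)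
      ultimately show ?thesis by (simp add: mult.assoc)
    qed
    show "close k (q * \<rho> a * \<Gamma>) 0" by (rule *[OF a])
    \<comment> \<open>The second off-diagonal corner is the adjoint of the first one at
      \<open>star A a\<close>.\<close>
    have "sadj (q * \<rho> (star A a) * \<Gamma>) = sadj \<Gamma> * \<rho> a * q" using a by (simp add: \<rho>_ops sq mult.assoc)
    moreover have "close k (sadj (q * \<rho> (star A a) * \<Gamma>)) (sadj 0)" by (rule close_sadj[OF *[OF A.star_closed[OF a]]])
    moreover have "sadj 0 = 0" by (simp add: fun_eq_iff seq_sel)
    ultimately show "close k (sadj \<Gamma> * \<rho> a * q) 0" by simp
  qed
  have Qc: "scorner m (Q a)" "bdd (Q a)" if a: "a \<in> carrier A" for a
  proof -
    have "scorner s (Q a)" unfolding scorner_iff Q_def using uq by (simp add: mult.assoc flip: mult.assoc[of "suid s"])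
    then show "scorner m (Q a)" using m(3) by (rule scorner_mono)
    show "bdd (Q a)" unfolding Q_def by (intro bdd_intros bq \<rho>c a)
  qed
  have homQ: "hom_mod m A Q"
    unfolding hom_mod_def
  proof (intro conjI ballI allI)
    fix x assume x: "x \<in> carrier A"
    show "scorner m (Q x)" "bdd (Q x)" using Qc[OF x] by auto
    show "close m (Q (cscale A c x)) (scs c (Q x))" for c
      using x by (intro close_eq) (simp add: Q_def \<rho>_ops)
    show "close m (Q (star A x)) (sadj (Q x))"
      using x by (intro close_eq) (simp add: Q_def \<rho>_ops sq mult.assoc)
    fix y assume y: "y \<in> carrier A"
    show "close m (Q (x \<oplus>\<^bsub>A\<^esub> y)) (Q x + Q y)"
      using x y by (intro close_eq) (simp add: Q_def \<rho>_ops distrib_left distrib_right)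
    have "Q (x \<otimes>\<^bsub>A\<^esub> y) - Q x * Q y = q * (\<rho> x * suid s) * \<rho> y * q - q * \<rho> x * (q * q) * \<rho> y * q"
      unfolding suid_right[OF \<rho>c(1)[OF x]] using x y by (simp add: Q_def \<rho>_ops mult.assoc)
    also have "\<dots> = q * \<rho> x * (suid s - q) * \<rho> y * q"
      unfolding qq by (simp add: left_diff_distrib right_diff_distrib mult.assoc)
    \<comment> \<open>The defect of multiplicativity is a product of two off-diagonal corners, both
      of them null.\<close>
    also have "\<dots> = (q * \<rho> x * \<Gamma>) * (sadj \<Gamma> * \<rho> y * q)" by (simp add: q_def[symmetric] mult.assoc) (simp add: q_def mult.assoc)
    finally have e: "Q (x \<otimes>\<^bsub>A\<^esub> y) - Q x * Q y = (q * \<rho> x * \<Gamma>) * (sadj \<Gamma> * \<rho> y * q)" .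
    have "bdd (sadj \<Gamma> * \<rho> y * q)" by (intro bdd_intros bdd_sadj \<Gamma> bq \<rho>c y)
    moreover have "null k (q * \<rho> x * \<Gamma>)" using off(1)[OF x] by (simp add: close_def)
    ultimately have "null k ((q * \<rho> x * \<Gamma>) * (sadj \<Gamma> * \<rho> y * q))" by (rule null_right)
    then have "close k (Q (x \<otimes>\<^bsub>A\<^esub> y)) (Q x * Q y)" unfolding close_def e .
    then show "close m (Q (x \<otimes>\<^bsub>A\<^esub> y)) (Q x * Q y)" by (rule close_antimono) (use k m in auto)
  qed
  define g where "g a = coset m (smat m (Q a))" for a
  have g: "g \<in> star_hom A (quotient m)" unfolding g_def[abs_def] by (rule star_hom_quotient[OF cA homQ])
  have eq: "coset t (F a) = coset_dsum (mat_prod t) (null_ideal t) (f a) (g a)" if a: "a \<in> carrier A" for a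
  proof -
    have sm: "smat m (Q a) \<in> carrier (mat_prod m)" by (rule smat_carrier[OF Qc[OF a]])
    have "close k (sadj \<Gamma> * \<rho> a * \<Gamma>) (\<Phi> a)"
    proof -
      have "close k (sadj \<Gamma> * (\<rho> a * \<Gamma>)) (sadj \<Gamma> * (\<Gamma> * \<Phi> a))"
        unfolding \<rho>_def by (intro close_left bdd_sadj \<Gamma> inter a)
      moreover have "close k (sadj \<Gamma> * \<Gamma> * \<Phi> a) (\<Phi> \<one>\<^bsub>A\<^esub> * \<Phi> a)" by (intro close_right h a \<Gamma>1)
      moreover have "close k (\<Phi> \<one>\<^bsub>A\<^esub> * \<Phi> a) (\<Phi> a)" using close_sym[OF h(6)[OF A.one_closed a]] a by simp
      ultimately show ?thesis unfolding mult.assoc by (meson close_trans)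
    qed
    then have c1: "close t (sadj \<Gamma> * \<rho> a * \<Gamma>) (\<Phi> a)" using k kt by (rule close_antimono)
    have c2: "close t (q * \<rho> a * \<Gamma>) 0" "close t (sadj \<Gamma> * \<rho> a * q) 0"
      using off[OF a] k kt by (auto intro: close_antimono)
    have "K * \<rho> a * sadj K = sadj \<Gamma> * \<rho> a * \<Gamma> + (sadj \<Gamma> * \<rho> a * q) * sadj \<kappa> + \<kappa> * (q * \<rho> a * \<Gamma>) + \<kappa> * Q a * sadj \<kappa>"
      unfolding sK unfolding K_def Q_def by (simp add: distrib_left distrib_right mult.assoc)
    moreover have "close t (sadj \<Gamma> * \<rho> a * \<Gamma> + (sadj \<Gamma> * \<rho> a * q) * sadj \<kappa> + \<kappa> * (q * \<rho> a * \<Gamma>) + \<kappa> * Q a * sadj \<kappa>)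
        (\<Phi> a + 0 * sadj \<kappa> + \<kappa> * 0 + \<kappa> * Q a * sadj \<kappa>)"
      by (intro close_add close_left close_right close_refl bdd_sadj \<kappa> c1 c2)
    ultimately have "close t (K * \<rho> a * sadj K) (\<Phi> a + \<kappa> * Q a * sadj \<kappa>)" by simp
    moreover have "\<kappa> * Q a * sadj \<kappa> = sshift k m * Q a * sadj (sshift k m)"
    proof -
      \<comment> \<open>\<open>Q a\<close> lives in the first \<open>s\<close> coordinates, so
        including the second summand through \<open>s\<close> or through \<open>m\<close>
        coordinates makes no difference.\<close>
      have Qs: "Q a = suid s * Q a * suid s"
        unfolding Q_def using uq by (simp add: mult.assoc flip: mult.assoc[of "suid s"])
      have "\<kappa> * Q a * sadj \<kappa> = (sshift k m * suid s) * Q a * sadj (sshift k m * suid s)"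
        unfolding \<kappa>_def sshift_restrict[OF m(3)] ..
      also have "\<dots> = sshift k m * (suid s * Q a * suid s) * sadj (sshift k m)" by (simp add: mult.assoc)
      finally show ?thesis using Qs by simp
    qed
    moreover have "semb (F a) = K * \<rho> a * sadj K" unfolding F_def by (rule semb_smat[OF Fc(1)[OF a]])
    moreover have "semb (seq_dsum (\<phi> a) (smat m (Q a))) = \<Phi> a + sshift k m * Q a * sadj (sshift k m)"
      using seq_dsum_mat_prod(1)[OF \<phi>(1)[OF a] sm] semb_smat[OF Qc(1)[OF a]] by (simp add: \<Phi>_def)
    moreover have "seq_dsum (\<phi> a) (smat m (Q a)) \<in> carrier (mat_prod t)"
      using seq_dsum_mat_prod(2)[OF \<phi>(1)[OF a] sm] by (simp add: t_def[abs_def])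
    ultimately have "coset t (F a) = coset t (seq_dsum (\<phi> a) (smat m (Q a)))"
      using star_homD(1)[OF F a] by (simp add: coset_eq_iff)
    also have "\<dots> = coset_dsum (mat_prod t) (null_ideal t) (f a) (g a)"
      unfolding g_def \<phi>(2)[OF a] t_def[abs_def] by (rule coset_dsum_cosets[symmetric]) (use \<phi>(1)[OF a] sm k m in auto)
    finally show ?thesis .
  qed
  have t: "t = (\<lambda>n. k n + m n)" by (simp add: fun_eq_iff t_def)
  show "\<exists>m. (\<forall>n. 0 < m n) \<and> (\<exists>g\<in>star_hom A (quotient m). \<exists>F\<in>star_hom A (mat_prod (\<lambda>n. k n + m n)).
      \<forall>a\<in>carrier A. coset (\<lambda>n. k n + m n) (F a) =
        coset_dsum (mat_prod (\<lambda>n. k n + m n)) (null_ideal (\<lambda>n. k n + m n)) (f a) (g a))"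
    using m(1) g F eq unfolding t by blast
qed

end

section \<open>The two instances of an ideal norm\<close>

lemma norm_uid: "norm (uid n) = sqrt n"
proof -
  have "(norm (uid n))\<^sup>2 = (\<Sum>i<n. (norm (uid n * munit i))\<^sup>2)" by (simp add: norm_sq_columns)
  also have "\<dots> = (\<Sum>i<n. 1)" by (intro sum.cong) (auto simp: uid_left)
  finally show ?thesis by (metis card_lessThan norm_ge_zero real_sqrt_unique sum_constant mult_1_right)
qed

lemma sum_norm_columns_le: "(\<Sum>i<n. norm (E * munit i)) \<le> sqrt n * norm E"
proof -
  have "(\<Sum>i<n. norm (E * munit i))\<^sup>2 = (\<Sum>i<n. 1 * norm (E * munit i))\<^sup>2" by simp
  also have "\<dots> \<le> (\<Sum>i<n. 1\<^sup>2) * (\<Sum>i<n. (norm (E * munit i))\<^sup>2)" by (rule Cauchy_Schwarz_ineq_sum)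
  also have "\<dots> \<le> n * (norm E)\<^sup>2" using norm_sq_columns_le[of E n] by (simp add: mult_left_mono)
  also have "\<dots> = (sqrt n * norm E)\<^sup>2" by (simp add: power_mult_distrib)
  finally show ?thesis by (rule power2_le_imp_le) simp
qed

lemma norm_sq_columns_uid:
  assumes "X * uid n = X"
  shows "(norm X)\<^sup>2 = (\<Sum>i<n. (norm (X * munit i))\<^sup>2)"
proof -
  obtain N where N: "corner N X" using corner_ex by blast
  have z: "norm (X * munit i) = 0" if "n \<le> i" for i
  proof -
    have "uid n * munit i = 0"
      using that by (auto intro!: fmat_eqI simp: uid_def ent_diagm_times ent_munit ent_zero)
    then show ?thesis using assms by (metis mult.assoc mult_zero_right norm_zero)
  qed
  have "(norm X)\<^sup>2 = (\<Sum>i<max N n. (norm (X * munit i))\<^sup>2)"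
    by (rule norm_sq_columns[symmetric]) (rule corner_mono[OF N], simp)
  also have "\<dots> = (\<Sum>i<n. (norm (X * munit i))\<^sup>2)"
    by (rule sum_extend_zero[symmetric]) (simp_all add: z)
  finally show ?thesis .
qed

text \<open>The hypotheses of \<open>nu_form\<close> and \<open>nu_diag\<close> are applied to the
  \<open>n\<close> unit columns and summed: the constant contributes \<open>n * c\<close>, the error
  at most \<open>sqrt n * norm E\<close> by Cauchy-Schwarz, and \<open>sqrt n\<close> is
  \<open>norm (uid n)\<close>.\<close>

lemma ideal_norm_frobenius:
  assumes "G \<le> sequentially"
  shows "ideal_norm norm (\<lambda>n. 1 / sqrt n) G"
proof
  have *: "(norm X)\<^sup>2 \<le> norm (uid n) * (c * norm (uid n) + norm E)"
    if "X * uid n = X" "\<And>i. i < n \<Longrightarrow> (norm (X * munit i))\<^sup>2 \<le> c + norm (E * munit i)" for n X E c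
  proof -
    have "(norm X)\<^sup>2 = (\<Sum>i<n. (norm (X * munit i))\<^sup>2)" by (rule norm_sq_columns_uid[OF that(1)])
    also have "\<dots> \<le> (\<Sum>i<n. c + norm (E * munit i))" by (intro sum_mono that) simp
    also have "\<dots> \<le> n * c + sqrt n * norm E" using sum_norm_columns_le[of E n] by (simp add: sum.distrib)
    also have "\<dots> = norm (uid n) * (c * norm (uid n) + norm E)" by (simp add: norm_uid distrib_left)
    finally show ?thesis .
  qed
  show "(norm (diagm n d))\<^sup>2 \<le> norm (uid n) * (c * norm (uid n) + norm E)"
    if "0 < n" "0 \<le> c" "\<And>i. i < n \<Longrightarrow> (cmod (d i))\<^sup>2 \<le> c + norm (E * munit i)" for n c d E
    using that by (intro *) (auto simp: diagm_munit norm_cs uid_right)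
  show "(norm X)\<^sup>2 \<le> norm (uid n) * (c * norm (uid n) + norm E)"
    if "0 < n" "X * uid n = X" "0 \<le> c" "\<And>Z. (norm (X * Z))\<^sup>2 \<le> c * (norm Z)\<^sup>2 + norm (E * Z) * norm Z" for n c X E
    using that(2) by (rule *) (use that(4)[of "munit _"] in simp)
qed (auto intro: norm_triangle_ineq norm_le_opn norm_le_opn_right assms simp: norm_uid frac_le)

text \<open>Here \<open>opn (uid n)\<close> is \<open>1\<close> for positive \<open>n\<close>, so
  \<open>nu_form\<close> and \<open>nu_diag\<close> both reduce to a bound of \<open>opn\<close> by
  \<open>sqrt (c + opn E)\<close>.\<close>

lemma ideal_norm_operator: "ideal_norm opn (\<lambda>n. 1) sequentially"
proof
  have le: "(opn X)\<^sup>2 \<le> c + opn E" if "opn X \<le> sqrt (c + opn E)" "0 \<le> c" for X E c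
    using power_mono[OF that(1) opn_nonneg, of 2] that(2) by simp
  show "(opn (diagm n d))\<^sup>2 \<le> opn (uid n) * (c * opn (uid n) + opn E)"
    if n: "0 < n" and c: "0 \<le> c" and d: "\<And>i. i < n \<Longrightarrow> (cmod (d i))\<^sup>2 \<le> c + norm (E * munit i)" for n c d E
  proof -
    have "opn (diagm n d) \<le> sqrt (c + opn E)"
    proof (rule opn_diagm_le)
      fix i assume "i < n"
      have "norm (E * munit i) \<le> opn E" using norm_le_opn[of E "munit i"] by simp
      then show "cmod (d i) \<le> sqrt (c + opn E)" using d[OF \<open>i < n\<close>] by (intro real_le_rsqrt) simp
    qed (use c in simp)
    then show ?thesis using le[OF _ c] by (simp add: opn_uid[OF n])
  qed
  show "(opn X)\<^sup>2 \<le> opn (uid n) * (c * opn (uid n) + opn E)"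
    if n: "0 < n" and c: "0 \<le> c" and X: "\<And>Z. (norm (X * Z))\<^sup>2 \<le> c * (norm Z)\<^sup>2 + norm (E * Z) * norm Z" for n c X E
  proof -
    have "opn X \<le> sqrt (c + opn E)"
    proof (rule opn_least_sq)
      fix Z
      have "norm (E * Z) * norm Z \<le> opn E * norm Z * norm Z" by (intro mult_right_mono norm_le_opn) simp
      then have "(norm (X * Z))\<^sup>2 \<le> (c + opn E) * (norm Z)\<^sup>2" using X[of Z] by (simp add: algebra_simps power2_eq_square)
      then show "(norm (X * Z))\<^sup>2 \<le> (sqrt (c + opn E))\<^sup>2 * (norm Z)\<^sup>2" using c by simp
    qed (use c in simp)
    then show ?thesis using le[OF _ c] by (simp add: opn_uid[OF n])
  qed
qed (auto intro: opn_triangle opn_times opn_uid_le)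

text \<open>An ultrafilter containing a singleton would be principal; so every singleton is avoided,
  and induction on \<open>N\<close> avoids every initial segment.\<close>

lemma nontrivial_ultrafilter_le_sequentially:
  assumes "nontrivial_ultrafilter \<omega>"
  shows "\<omega> \<le> sequentially"
proof -
  have ne: "\<forall>\<^sub>F m in \<omega>. m \<noteq> n" for n
  proof (rule ccontr)
    assume "\<not> (\<forall>\<^sub>F m in \<omega>. m \<noteq> n)"
    then have n: "\<forall>\<^sub>F m in \<omega>. m = n"
      using assms unfolding nontrivial_ultrafilter_def by (metis (mono_tags, lifting) eventually_mono)
    have "\<omega> = principal {n}"
    proof (rule filter_eqI)
      fix P
      show "eventually P \<omega> \<longleftrightarrow> eventually P (principal {n})"
      proof
        assume "eventually P \<omega>"
        then have "\<forall>\<^sub>F m in \<omega>. P n" using n by eventually_elim simp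
        then show "eventually P (principal {n})"
          using assms by (simp add: nontrivial_ultrafilter_def eventually_principal)
      next
        assume "eventually P (principal {n})"
        then show "eventually P \<omega>" using n by (simp add: eventually_principal) (erule eventually_mono, simp)
      qed
    qed
    then show False using assms by (simp add: nontrivial_ultrafilter_def)
  qed
  have "\<forall>\<^sub>F m in \<omega>. N \<le> m" for N
  proof (induction N)
    case (Suc N)
    show ?case using Suc ne[of N] by eventually_elim simp
  qed simp
  then show ?thesis
    unfolding le_filter_def eventually_sequentially by (blast intro: eventually_mono)
qed

theorem proposition6p9:
  fixes \<epsilon> :: real and A :: "'a star_algebra" and u v :: 'a and \<omega> :: "nat filter"
  assumes "\<epsilon> \<ge> 0"
    and "is_soft_torus \<epsilon> A u v"
    and "nontrivial_ultrafilter \<omega>"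
  shows "very_flexibly_HS_stable \<omega> A \<and> very_flexibly_op_stable A"
proof
  interpret HS: ideal_norm norm "\<lambda>n. 1 / sqrt (real n)" \<omega>
    by (rule ideal_norm_frobenius[OF nontrivial_ultrafilter_le_sequentially[OF assms(3)]])
  have "T \<in> hs_null \<omega> k \<longleftrightarrow> T \<in> HS.null_ideal k" for k T
  proof -
    have "hs_norm (T n) = 1 / sqrt (real (k n)) * norm (semb T n)" if "T \<in> carrier (mat_prod k)" for n
      using that by (simp add: mat_prod_carrier_iff hs_norm_emb[of _ "k n"] semb_def)
    then show ?thesis
      by (auto simp: hs_null_def HS.null_ideal_def HS.null_def)
  qed
  then have "hs_null \<omega> = HS.null_ideal" by blast
  then show "very_flexibly_HS_stable \<omega> A"
    unfolding very_flexibly_HS_stable_def using HS.very_flexibly_stable_soft_torus[OF assms(1,2)] by simp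
  interpret Op: ideal_norm opn "\<lambda>n. 1" sequentially by (rule ideal_norm_operator)
  have "T \<in> op_null k \<longleftrightarrow> T \<in> Op.null_ideal k" for k T
  proof -
    have "mat_op_norm (T n) = opn (semb T n)" if "T \<in> carrier (mat_prod k)" for n
      using that by (simp add: mat_prod_carrier_iff mat_op_norm_emb[of _ "k n"] semb_def)
    then show ?thesis
      by (auto simp: op_null_def Op.null_ideal_def Op.null_def)
  qed
  then have "op_null = Op.null_ideal" by blast
  then show "very_flexibly_op_stable A"
    unfolding very_flexibly_op_stable_def using Op.very_flexibly_stable_soft_torus[OF assms(1,2)] by simp
qed

end
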